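(* Let $\underline\omega_0$ be a scaling limit state on the scaling algebra $\underline{\mathfrak A}$, i.e. $\underline\omega_0(\underline A)=\mathsf m(\lambda\mapsto\omega(\underline A_\lambda))$ for some mean $\mathsf m$ on $(0,1]$, with GNS triple $(\mathcal H_0,\pi_0,\Omega_0)$, and let $\mathcal G_0\subset\underline{\mathcal G}$ be the subgroup of all $g$ which fulfill $\underline\omega_0\circ\underline\alpha_g=\underline\omega_0$. There exists a strongly continuous unitary representation $U_0$ of $\mathcal G_0$ on $\mathcal H_0$ such that $\alpha_{0,g}\circ\pi_0=\pi_0\circ\underline\alpha_g$ with $\alpha_{0,g}=\mathrm{ad}\,U_0(g)$, for all $g\in\mathcal G_0$. One has $U_0(g)\Omega_0=\Omega_0$ for $g\in\mathcal G_0$. The representation $U_0(x)$ of translations fulfills the spectrum condition, i.e. the joint spectrum of its generators lies in the closed forward light cone $\bar{\mathcal V}_+$.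
   Context: Minkowski space is $\mathbb R^{s+1}$. A net of algebras assigns to each open bounded $\mathcal O\subset\mathbb R^{s+1}$ a $C^*$-algebra $\mathfrak A(\mathcal O)$ with $\mathfrak A(\mathcal O_1)\subset\mathfrak A(\mathcal O_2)$ if $\mathcal O_1\subset\mathcal O_2$; the quasilocal algebra, also denoted $\mathfrak A$, is the norm closure of $\bigcup_{\mathcal O}\mathfrak A(\mathcal O)$. Given theory: $\mathfrak A$ is a local net in the vacuum sector with symmetry group the proper orthochronous Poincaré group $\mathcal P_+^\uparrow$. This means: the $\mathfrak A(\mathcal O)$ are $W^*$-algebras on a common Hilbert space $\mathcal H$; there is a strongly continuous unitary representation $U$ of $\mathcal P_+^\uparrow$ on $\mathcal H$ such that $\alpha_{x,\Lambda}=\mathrm{ad}\,U(x,\Lambda)$ satisfies $\alpha_g\mathfrak A(\mathcal O)=\mathfrak A(g.\mathcal O)$; $[A_1,A_2]=0$ for $A_i\in\mathfrak A(\mathcal O_i)$ with $\mathcal O_1,\mathcal O_2$ spacelike separated; the joint spectrum of the generators of translations $U(x)$ lies in the closed forward light cone $\bar{\mathcal V}_+$; there is a unit vector $\Omega$ invariant under all $U(g)$ and cyclic for $\mathfrak A$, and it is unique up to scalars as a translation-invariant vector. The vacuum state is $\omega=(\Omega|\cdot\,\Omega)$. Scaling algebra: $\underline{\mathfrak B}$ is the $C^*$-algebra of all functions $\underline B:\mathbb R_+\to\mathcal B(\mathcal H)$, $\lambda\mapsto\underline B_\lambda$, with $\|\underline B\|=\sup_\lambda\|\underline B_\lambda\|<\infty$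 and pointwise operations. The group $\underline{\mathcal G}$ generated by Poincaré transformations and dilations, with elements $g=(\mu,x,\Lambda)$, $\mu\in\mathbb R_+$, acts on $\underline{\mathfrak B}$ by $(\underline\alpha_{\mu,x,\Lambda}\underline B)_\lambda=\alpha_{\mu\lambda x,\Lambda}(\underline B_{\mu\lambda})$. Define $\underline{\mathfrak A}(\mathcal O)=\{\underline A\in\underline{\mathfrak B}\mid\underline A_\lambda\in\mathfrak A(\lambda\mathcal O)\ \forall\lambda>0;\ g\mapsto\underline\alpha_g(\underline A)\text{ norm continuous}\}$, and let $\underline{\mathfrak A}$ be the norm closure of $\bigcup_{\mathcal O}\underline{\mathfrak A}(\mathcal O)$. A mean $\mathsf m$ on $(0,1]$ is a linear functional on the bounded functions on $(0,1]$ with $\mathsf m(\mathbf 1)=1$ and $\mathsf m(f)\ge0$ for $f\ge0$. *)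

theory Defs
  imports "HOL-Analysis.Analysis" "HOL-Algebra.Group"
begin

section \<open>Complex Hilbert spaces and their bounded operators\<close>

text \<open>The inner product is linear in its second argument. The last axiom makes it positive
  definite and compatible with the norm; completeness comes from \<^class>\<open>banach\<close>.\<close>

class chilbert_space = banach +
  fixes scaleC :: "complex \<Rightarrow> 'a \<Rightarrow> 'a"  (infixr \<open>*\<^sub>C\<close> 75)
    and cinner :: "'a \<Rightarrow> 'a \<Rightarrow> complex"
  assumes scaleC_add_right: "c *\<^sub>C (x + y) = c *\<^sub>C x + c *\<^sub>C y"
    and scaleC_add_left: "(c + d) *\<^sub>C x = c *\<^sub>C x + d *\<^sub>C x"
    and scaleC_scaleC: "c *\<^sub>C d *\<^sub>C x = (c * d) *\<^sub>C x"
    and scaleC_of_real: "complex_of_real r *\<^sub>C x = r *\<^sub>R x"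
    and cinner_commute: "cinner x y = cnj (cinner y x)"
    and cinner_add_right: "cinner x (y + z) = cinner x y + cinner x z"
    and cinner_scaleC_right: "cinner x (c *\<^sub>C y) = c * cinner x y"
    and cinner_self: "cinner x x = complex_of_real ((norm x)\<^sup>2)"

text \<open>\<open>'a \<Rightarrow>\<^sub>L 'a\<close> consists of the real-linear bounded operators; \<open>B(H)\<close> is the subset of the
  complex-linear ones, and the operator norm is the same.\<close>

definition bounded_ops :: "('h::chilbert_space \<Rightarrow>\<^sub>L 'h) set" where
  "bounded_ops = {A. \<forall>c \<psi>. blinfun_apply A (c *\<^sub>C \<psi>) = c *\<^sub>C blinfun_apply A \<psi>}"

definition op_scaleC :: "complex \<Rightarrow> ('h::chilbert_space \<Rightarrow>\<^sub>L 'h) \<Rightarrow> ('h \<Rightarrow>\<^sub>L 'h)" where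
  "op_scaleC c A = Blinfun (\<lambda>\<psi>. c *\<^sub>C blinfun_apply A \<psi>)"

definition cadj :: "('h::chilbert_space \<Rightarrow>\<^sub>L 'h) \<Rightarrow> ('h \<Rightarrow>\<^sub>L 'h)" where
  "cadj A = (THE B. \<forall>\<phi> \<psi>. cinner (blinfun_apply A \<phi>) \<psi> = cinner \<phi> (blinfun_apply B \<psi>))"

definition unitary_op :: "('h::chilbert_space \<Rightarrow>\<^sub>L 'h) \<Rightarrow> bool" where
  "unitary_op V \<longleftrightarrow> V \<in> bounded_ops \<and> cadj V o\<^sub>L V = id_blinfun \<and> V o\<^sub>L cadj V = id_blinfun"

definition ad :: "('h::chilbert_space \<Rightarrow>\<^sub>L 'h) \<Rightarrow> ('h \<Rightarrow>\<^sub>L 'h) \<Rightarrow> ('h \<Rightarrow>\<^sub>L 'h)" where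
  "ad V A = V o\<^sub>L A o\<^sub>L cadj V"

text \<open>Concrete \<open>W\<^sup>*\<close>-algebras: strongly closed *-subalgebras of \<open>B(H)\<close> containing the identity.\<close>

definition W_star_algebra :: "('h::chilbert_space \<Rightarrow>\<^sub>L 'h) set \<Rightarrow> bool" where
  "W_star_algebra M \<longleftrightarrow>
     M \<subseteq> bounded_ops \<and> id_blinfun \<in> M \<and>
     (\<forall>A\<in>M. \<forall>B\<in>M. A + B \<in> M \<and> A o\<^sub>L B \<in> M) \<and>
     (\<forall>A\<in>M. \<forall>c. op_scaleC c A \<in> M) \<and>
     (\<forall>A\<in>M. cadj A \<in> M) \<and>
     closedin strong_operator_topology M"

text \<open>The group \<open>G\<close> carries the subspace topology of the type of its elements.\<close>

definition unitary_rep ::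
  "('g::topological_space, 'b) monoid_scheme \<Rightarrow> ('g \<Rightarrow> 'h::chilbert_space \<Rightarrow>\<^sub>L 'h) \<Rightarrow> bool" where
  "unitary_rep G U \<longleftrightarrow>
     (\<forall>g\<in>carrier G. unitary_op (U g)) \<and>
     U \<one>\<^bsub>G\<^esub> = id_blinfun \<and>
     (\<forall>g\<in>carrier G. \<forall>h\<in>carrier G. U (g \<otimes>\<^bsub>G\<^esub> h) = U g o\<^sub>L U h) \<and>
     (\<forall>\<psi>. continuous_on (carrier G) (\<lambda>g. blinfun_apply (U g) \<psi>))"


section \<open>Minkowski space and the symmetry groups\<close>

text \<open>\<open>\<real>\<^sup>s\<^sup>+\<^sup>1\<close> with \<open>s = CARD('s)\<close>: coordinate \<^const>\<open>None\<close> is time, \<open>Some i\<close> are the space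
  coordinates.\<close>

type_synonym 's spacetime = "real ^ ('s option)"
type_synonym 's stmatrix = "real ^ ('s option) ^ ('s option)"

definition mink :: "'s::finite spacetime \<Rightarrow> 's spacetime \<Rightarrow> real" where
  "mink x y = x $ None * y $ None - (\<Sum>i\<in>UNIV. x $ Some i * y $ Some i)"

definition forward_cone :: "'s::finite spacetime set" where
  "forward_cone = {p. 0 \<le> p $ None \<and> 0 \<le> mink p p}"

definition spacelike_separated :: "'s::finite spacetime set \<Rightarrow> 's spacetime set \<Rightarrow> bool" where
  "spacelike_separated O\<^sub>1 O\<^sub>2 \<longleftrightarrow> (\<forall>x\<in>O\<^sub>1. \<forall>y\<in>O\<^sub>2. mink (x - y) (x - y) < 0)"

definition regions :: "'s::finite spacetime set set" where
  "regions = {R. open R \<and> bounded R}"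

definition lorentz :: "'s::finite stmatrix set" where
  "lorentz = {L. (\<forall>x y. mink (L *v x) (L *v y) = mink x y) \<and> det L = 1 \<and> 0 < L $ None $ None}"

definition poincare_group :: "('s::finite spacetime \<times> 's stmatrix) monoid" where
  "poincare_group =
     \<lparr>carrier = UNIV \<times> lorentz,
      mult = (\<lambda>(x, L) (y, M). (x + L *v y, L ** M)),
      one = (0, mat 1)\<rparr>"

definition poincare_act :: "'s::finite spacetime \<times> 's stmatrix \<Rightarrow> 's spacetime \<Rightarrow> 's spacetime" where
  "poincare_act = (\<lambda>(x, L) y. L *v y + x)"

text \<open>The element \<open>(\<mu>, x, \<Lambda>)\<close> stands for the map \<open>y \<mapsto> \<mu> (\<Lambda> y + x)\<close>, a Poincare transformation
  followed by a dilation; the product is composition. This is the group law for which \<open>scaling_act\<close> below is an action.\<close>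

definition scaling_group :: "(real \<times> 's::finite spacetime \<times> 's stmatrix) monoid" where
  "scaling_group =
     \<lparr>carrier = {0<..} \<times> UNIV \<times> lorentz,
      mult = (\<lambda>(\<mu>, x, L) (\<nu>, y, M). (\<mu> * \<nu>, inverse \<nu> *\<^sub>R x + L *v y, L ** M)),
      one = (1, 0, mat 1)\<rparr>"


section \<open>Joint spectrum of the generators of translations\<close>

definition pvm :: "('p::topological_space set \<Rightarrow> 'h::chilbert_space \<Rightarrow>\<^sub>L 'h) \<Rightarrow> bool" where
  "pvm E \<longleftrightarrow>
     (\<forall>S\<in>sets borel. E S \<in> bounded_ops \<and> cadj (E S) = E S \<and> E S o\<^sub>L E S = E S) \<and>
     E UNIV = id_blinfun \<and>
     (\<forall>F. range F \<subseteq> sets borel \<longrightarrow> disjoint_family F \<longrightarrow>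
        (\<forall>\<psi>. (\<lambda>i::nat. blinfun_apply (E (F i)) \<psi>) sums blinfun_apply (E (\<Union>i. F i)) \<psi>))"

definition pvm_support :: "('p::topological_space set \<Rightarrow> 'h::chilbert_space \<Rightarrow>\<^sub>L 'h) \<Rightarrow> 'p set" where
  "pvm_support E = {p. \<forall>W. open W \<and> p \<in> W \<longrightarrow> E W \<noteq> 0}"

text \<open>The finite measure \<open>S \<mapsto> (\<psi>|E(S)\<psi>)\<close>.\<close>

definition pvm_measure ::
  "('p::topological_space set \<Rightarrow> 'h::chilbert_space \<Rightarrow>\<^sub>L 'h) \<Rightarrow> 'h \<Rightarrow> 'p measure" where
  "pvm_measure E \<psi> =
     measure_of UNIV (sets borel) (\<lambda>S. ennreal (Re (cinner \<psi> (blinfun_apply (E S) \<psi>))))"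

text \<open>\<open>E\<close> is the joint spectral measure of the generators \<open>P\<close> of \<open>U\<close>, i.e.
  \<open>U(x) = exp(i x\<cdot>P) = \<integral> exp(i x\<cdot>p) dE(p)\<close> with the Minkowski product \<open>x\<cdot>p\<close>. The integral is
  taken weakly; diagonal matrix elements suffice by polarization.\<close>

definition joint_spectral_measure ::
  "('s::finite spacetime \<Rightarrow> 'h::chilbert_space \<Rightarrow>\<^sub>L 'h) \<Rightarrow> ('s spacetime set \<Rightarrow> 'h \<Rightarrow>\<^sub>L 'h) \<Rightarrow> bool" where
  "joint_spectral_measure U E \<longleftrightarrow>
     pvm E \<and>
     (\<forall>x \<psi>. cinner \<psi> (blinfun_apply (U x) \<psi>) = (LINT p|pvm_measure E \<psi>. cis (mink x p)))"

text \<open>The joint spectrum is the support of the joint spectral measure, which exists and is unique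
  for strongly continuous \<open>U\<close> (theorems of Stone and SNAG).\<close>

definition spectrum_condition :: "('s::finite spacetime \<Rightarrow> 'h::chilbert_space \<Rightarrow>\<^sub>L 'h) \<Rightarrow> bool" where
  "spectrum_condition U \<longleftrightarrow>
     (\<exists>E. joint_spectral_measure U E \<and> pvm_support E \<subseteq> forward_cone)"


section \<open>Local nets in the vacuum sector\<close>

definition quasilocal_algebra ::
  "('s::finite spacetime set \<Rightarrow> ('h::chilbert_space \<Rightarrow>\<^sub>L 'h) set) \<Rightarrow> ('h \<Rightarrow>\<^sub>L 'h) set" where
  "quasilocal_algebra \<AA> = closure (\<Union>R\<in>regions. \<AA> R)"

locale vacuum_net =
  fixes \<AA> :: "'s::finite spacetime set \<Rightarrow> ('h::chilbert_space \<Rightarrow>\<^sub>L 'h) set"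
    and U :: "'s spacetime \<times> 's stmatrix \<Rightarrow> 'h \<Rightarrow>\<^sub>L 'h"
    and \<Omega> :: 'h
  assumes algebras: "R \<in> regions \<Longrightarrow> W_star_algebra (\<AA> R)"
    and isotony: "\<lbrakk>R\<^sub>1 \<in> regions; R\<^sub>2 \<in> regions; R\<^sub>1 \<subseteq> R\<^sub>2\<rbrakk> \<Longrightarrow> \<AA> R\<^sub>1 \<subseteq> \<AA> R\<^sub>2"
    and rep: "unitary_rep poincare_group U"
    and covariance: "\<lbrakk>g \<in> carrier poincare_group; R \<in> regions\<rbrakk>
          \<Longrightarrow> ad (U g) ` \<AA> R = \<AA> (poincare_act g ` R)"
    and locality: "\<lbrakk>R\<^sub>1 \<in> regions; R\<^sub>2 \<in> regions; spacelike_separated R\<^sub>1 R\<^sub>2; A\<^sub>1 \<in> \<AA> R\<^sub>1; A\<^sub>2 \<in> \<AA> R\<^sub>2\<rbrakk>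
          \<Longrightarrow> A\<^sub>1 o\<^sub>L A\<^sub>2 = A\<^sub>2 o\<^sub>L A\<^sub>1"
    and spectrum: "spectrum_condition (\<lambda>x. U (x, mat 1))"
    and vacuum_norm: "norm \<Omega> = 1"
    and vacuum_invariant: "g \<in> carrier poincare_group \<Longrightarrow> blinfun_apply (U g) \<Omega> = \<Omega>"
    and vacuum_cyclic: "closure ((\<lambda>A. blinfun_apply A \<Omega>) ` quasilocal_algebra \<AA>) = UNIV"
    and vacuum_unique: "(\<forall>x. blinfun_apply (U (x, mat 1)) \<psi> = \<psi>) \<Longrightarrow> \<exists>c. \<psi> = c *\<^sub>C \<Omega>"


section \<open>The scaling algebra\<close>

text \<open>Functions of \<open>\<lambda> > 0\<close> are extended by zero to the type \<^typ>\<open>real\<close>, so that equality of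
  functions is equality on \<open>\<real>\<^sub>+\<close>.\<close>

type_synonym 'h opfun = "real \<Rightarrow> 'h \<Rightarrow>\<^sub>L 'h"

definition bounded_opfuns :: "'h::chilbert_space opfun set" where
  "bounded_opfuns =
     {B. (\<forall>l>0. B l \<in> bounded_ops) \<and> (\<forall>l\<le>0. B l = 0) \<and> bounded (B ` {0<..})}"

definition opfun_norm :: "'h::chilbert_space opfun \<Rightarrow> real" where
  "opfun_norm B = (SUP l\<in>{0<..}. norm (B l))"

definition scaling_act ::
  "('s::finite spacetime \<times> 's stmatrix \<Rightarrow> 'h::chilbert_space \<Rightarrow>\<^sub>L 'h) \<Rightarrow>
   real \<times> 's spacetime \<times> 's stmatrix \<Rightarrow> 'h opfun \<Rightarrow> 'h opfun" where
  "scaling_act U = (\<lambda>(\<mu>, x, L) B l.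
     if 0 < l then ad (U ((\<mu> * l) *\<^sub>R x, L)) (B (\<mu> * l)) else 0)"

definition scaling_local_algebra ::
  "('s::finite spacetime set \<Rightarrow> ('h::chilbert_space \<Rightarrow>\<^sub>L 'h) set) \<Rightarrow>
   ('s spacetime \<times> 's stmatrix \<Rightarrow> 'h \<Rightarrow>\<^sub>L 'h) \<Rightarrow> 's spacetime set \<Rightarrow> 'h opfun set" where
  "scaling_local_algebra \<AA> U R =
     {A \<in> bounded_opfuns.
        (\<forall>l>0. A l \<in> \<AA> ((\<lambda>y. l *\<^sub>R y) ` R)) \<and>
        (\<forall>g\<in>carrier scaling_group.
           ((\<lambda>h. opfun_norm (\<lambda>l. scaling_act U h A l - scaling_act U g A l)) \<longlongrightarrow> 0)
             (at g within carrier scaling_group))}"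

definition scaling_algebra ::
  "('s::finite spacetime set \<Rightarrow> ('h::chilbert_space \<Rightarrow>\<^sub>L 'h) set) \<Rightarrow>
   ('s spacetime \<times> 's stmatrix \<Rightarrow> 'h \<Rightarrow>\<^sub>L 'h) \<Rightarrow> 'h opfun set" where
  "scaling_algebra \<AA> U =
     {A \<in> bounded_opfuns.
        \<forall>\<epsilon>>0. \<exists>R\<in>regions. \<exists>B\<in>scaling_local_algebra \<AA> U R. opfun_norm (\<lambda>l. A l - B l) < \<epsilon>}"


section \<open>Scaling limit states and their GNS representations\<close>

text \<open>A mean is only specified on (complex) functions that are bounded on \<open>(0,1]\<close>. Positivity
  tested on \<open>(0,1]\<close> forces its value to depend on the restriction to \<open>(0,1]\<close> only.\<close>

definition mean :: "((real \<Rightarrow> complex) \<Rightarrow> complex) \<Rightarrow> bool" where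
  "mean m \<longleftrightarrow>
     (\<forall>f g. bounded (f ` {0<..1}) \<longrightarrow> bounded (g ` {0<..1}) \<longrightarrow> m (\<lambda>l. f l + g l) = m f + m g) \<and>
     (\<forall>f c. bounded (f ` {0<..1}) \<longrightarrow> m (\<lambda>l. c * f l) = c * m f) \<and>
     m (\<lambda>_. 1) = 1 \<and>
     (\<forall>f. bounded (f ` {0<..1}) \<longrightarrow> (\<forall>l\<in>{0<..1}. f l \<in> \<real>\<^sub>\<ge>\<^sub>0) \<longrightarrow> m f \<in> \<real>\<^sub>\<ge>\<^sub>0)"

definition scaling_limit_state ::
  "((real \<Rightarrow> complex) \<Rightarrow> complex) \<Rightarrow> 'h::chilbert_space \<Rightarrow> 'h opfun \<Rightarrow> complex" where
  "scaling_limit_state m \<Omega> A = m (\<lambda>l. cinner \<Omega> (blinfun_apply (A l) \<Omega>))"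

text \<open>A GNS triple of a functional \<open>w\<close> on a *-algebra \<open>C\<close> of operator-valued functions: a
  *-representation \<open>\<pi>\<close> by bounded operators on the Hilbert space \<open>'k\<close> with cyclic vector
  \<open>\<Omega>\<^sub>0\<close> implementing \<open>w\<close>.\<close>

definition gns_triple ::
  "'h::chilbert_space opfun set \<Rightarrow> ('h opfun \<Rightarrow> complex) \<Rightarrow>
   ('h opfun \<Rightarrow> 'k::chilbert_space \<Rightarrow>\<^sub>L 'k) \<Rightarrow> 'k \<Rightarrow> bool" where
  "gns_triple C w \<pi> \<Omega>\<^sub>0 \<longleftrightarrow>
     (\<forall>A\<in>C. \<pi> A \<in> bounded_ops) \<and>
     (\<forall>A\<in>C. \<forall>B\<in>C. \<pi> (\<lambda>l. A l + B l) = \<pi> A + \<pi> B) \<and>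
     (\<forall>A\<in>C. \<forall>c. \<pi> (\<lambda>l. op_scaleC c (A l)) = op_scaleC c (\<pi> A)) \<and>
     (\<forall>A\<in>C. \<forall>B\<in>C. \<pi> (\<lambda>l. A l o\<^sub>L B l) = \<pi> A o\<^sub>L \<pi> B) \<and>
     (\<forall>A\<in>C. \<pi> (\<lambda>l. cadj (A l)) = cadj (\<pi> A)) \<and>
     closure ((\<lambda>A. blinfun_apply (\<pi> A) \<Omega>\<^sub>0) ` C) = UNIV \<and>
     (\<forall>A\<in>C. w A = cinner \<Omega>\<^sub>0 (blinfun_apply (\<pi> A) \<Omega>\<^sub>0))"

definition invariance_group ::
  "('s::finite spacetime set \<Rightarrow> ('h::chilbert_space \<Rightarrow>\<^sub>L 'h) set) \<Rightarrow>
   ('s spacetime \<times> 's stmatrix \<Rightarrow> 'h \<Rightarrow>\<^sub>L 'h) \<Rightarrow> ('h opfun \<Rightarrow> complex) \<Rightarrow>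
   (real \<times> 's spacetime \<times> 's stmatrix) set" where
  "invariance_group \<AA> U w =
     {g \<in> carrier scaling_group. \<forall>A\<in>scaling_algebra \<AA> U. w (scaling_act U g A) = w A}"

end

theory Submission
  imports Defs
begin

text \<open>By invariance of the state, \<open>\<pi>\<^sub>0(A)\<Omega>\<^sub>0 \<mapsto> \<pi>\<^sub>0(\<alpha>\<^sub>g A)\<Omega>\<^sub>0\<close> is isometric on a dense subspace and extends to
  the unitary \<open>U\<^sub>0(g)\<close>; strong continuity follows from norm continuity of \<open>g \<mapsto> \<alpha>\<^sub>g A\<close> and
  \<open>\<parallel>\<pi>\<^sub>0(A)\<Omega>\<^sub>0\<parallel> \<le> \<parallel>A\<parallel>\<close>.

  For the spectrum condition, put \<open>\<psi> = \<pi>\<^sub>0(A)\<Omega>\<^sub>0\<close>. Then \<open>(\<psi>|U\<^sub>0(x)\<psi>)\<close> is the mean over \<open>\<lambda>\<close> of the Fourier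
  transforms of the spectral measures of \<open>A\<^sub>\<lambda>\<Omega>\<close>, rescaled by \<open>\<lambda>\<close>, and all of these are supported in the
  forward cone. Since \<open>x \<mapsto> \<alpha>\<^sub>x A\<close> is continuous uniformly in \<open>\<lambda>\<close>, these measures are uniformly tight, so
  the mean of their integrals is a Daniell functional on bounded continuous functions and is given by
  a measure \<open>\<mu>\<^sub>\<psi>\<close>, again supported in the cone. Trigonometric polynomials are dense in \<open>L\<^sup>2(\<mu>\<^sub>\<psi>)\<close>, and the map sending the
  character \<open>x\<close> to \<open>U\<^sub>0(x)\<psi>\<close> is isometric on them; the image of the indicator function of \<open>S\<close> is
  \<open>E(S)\<psi>\<close>, which defines the joint spectral measure.\<close>


section \<open>Operators on a complex Hilbert space\<close>


text \<open>A mean need not be countably additive, so no convergence theorem passes through it: mass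
  may escape to infinity along it, and an average of measures is a priori no more than a positive
  functional on bounded continuous functions. Tightness keeps the mass inside a ball up to
  \<epsilon>, uniformly in \<lambda>, and on the ball Dini's theorem takes over.

  The measures \<mu>_\<psi> are found one vector at a time, each from an operator function that
  represents \<psi>, and only their Fourier transforms relate those of different vectors. Linearity
  of E(S) can therefore not be read off from them. It comes from approximating the indicator of S by
  one trigonometric polynomial in several L2 spaces at once, since that polynomial yields one linear
  operator.

  All this takes place on the dense subspace of vectors
  \<open>\<pi>\<^sub>0(A)\<Omega>\<^sub>0\<close>; other vectors are reached by bounded extension.
  The Fourier analysis uses the Euclidean product, and \<open>flip\<close> translates to the
  Minkowski one.\<close>

lemma cinner_add_left: "cinner (x + y) z = cinner x z + cinner y z"
  for x y z :: "'a::chilbert_space"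
  by (metis cinner_add_right cinner_commute complex_cnj_add)

lemma cinner_scaleC_left: "cinner (c *\<^sub>C x) y = cnj c * cinner x y"
  for x y :: "'a::chilbert_space"
  by (metis cinner_commute cinner_scaleC_right complex_cnj_mult)

lemma cinner_scaleR_right: "cinner x (r *\<^sub>R y) = complex_of_real r * cinner x y"
  for x y :: "'a::chilbert_space"
  by (metis cinner_scaleC_right scaleC_of_real)

lemma cinner_scaleR_left: "cinner (r *\<^sub>R x) y = complex_of_real r * cinner x y"
  for x y :: "'a::chilbert_space"
  by (metis cinner_scaleC_left scaleC_of_real complex_cnj_complex_of_real)

lemma cinner_zero_right [simp]: "cinner x 0 = 0" for x :: "'a::chilbert_space"
  using cinner_add_right[of x 0 0] by simp

lemma cinner_zero_left [simp]: "cinner 0 x = 0" for x :: "'a::chilbert_space"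
  using cinner_add_left[of 0 0 x] by simp

lemma cinner_minus_right: "cinner x (- y) = - cinner x y" for x y :: "'a::chilbert_space"
  using cinner_scaleR_right[of x "-1" y] by simp

lemma cinner_minus_left: "cinner (- x) y = - cinner x y" for x y :: "'a::chilbert_space"
  using cinner_scaleR_left[of "-1" x y] by simp

lemma cinner_diff_right: "cinner x (y - z) = cinner x y - cinner x z"
  for x y z :: "'a::chilbert_space"
  using cinner_add_right[of x y "-z"] by (simp add: cinner_minus_right)

lemma cinner_diff_left: "cinner (x - y) z = cinner x z - cinner y z"
  for x y z :: "'a::chilbert_space"
  using cinner_add_left[of x "-y" z] by (simp add: cinner_minus_left)

lemma scaleC_zero_right [simp]: "c *\<^sub>C (0::'a::chilbert_space) = 0"
  using scaleC_add_right[of c 0 0] by simp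

lemma scaleC_minus_right: "c *\<^sub>C (- x) = - (c *\<^sub>C x)" for x :: "'a::chilbert_space"
  using scaleC_add_right[of c x "-x"] by (simp add: eq_neg_iff_add_eq_0 add.commute)

lemma scaleC_diff_right: "c *\<^sub>C (x - y) = c *\<^sub>C x - c *\<^sub>C y" for x y :: "'a::chilbert_space"
  using scaleC_add_right[of c x "-y"] by (simp add: scaleC_minus_right)

lemma scaleC_scaleR: "c *\<^sub>C (r *\<^sub>R x) = r *\<^sub>R (c *\<^sub>C x)" for x :: "'a::chilbert_space"
  by (metis scaleC_of_real scaleC_scaleC mult.commute)

lemma scaleC_one [simp]: "1 *\<^sub>C x = x" for x :: "'a::chilbert_space"
  using scaleC_of_real[of 1 x] by simp

lemma scaleC_minus_one: "(-1) *\<^sub>C x = - x" for x :: "'a::chilbert_space"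
  using scaleC_of_real[of "-1" x] by simp

lemma norm_scaleC: "norm (c *\<^sub>C x) = cmod c * norm x" for x :: "'a::chilbert_space"
proof -
  have "complex_of_real ((norm (c *\<^sub>C x))\<^sup>2) = cnj c * c * complex_of_real ((norm x)\<^sup>2)"
    using cinner_self[of "c *\<^sub>C x"] cinner_self[of x]
    by (simp add: cinner_scaleC_left cinner_scaleC_right mult_ac)
  also have "cnj c * c = complex_of_real ((cmod c)\<^sup>2)"
    using complex_norm_square[of c] by (simp add: mult.commute)
  finally have "(norm (c *\<^sub>C x))\<^sup>2 = (cmod c * norm x)\<^sup>2"
    by (simp only: of_real_mult[symmetric] of_real_eq_iff power_mult_distrib)
  then show ?thesis by (simp add: power2_eq_iff_nonneg)
qed

lemma bounded_linear_scaleC: "bounded_linear (\<lambda>x::'a::chilbert_space. c *\<^sub>C x)"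
  by (rule bounded_linear_intro[of _ "cmod c"])
     (auto simp: scaleC_add_right scaleC_scaleR norm_scaleC mult.commute)

lemma norm_add_square:
  "(norm (x + y))\<^sup>2 = (norm x)\<^sup>2 + (norm y)\<^sup>2 + 2 * Re (cinner x y)" for x y :: "'a::chilbert_space"
proof -
  have "complex_of_real ((norm (x + y))\<^sup>2) =
      complex_of_real ((norm x)\<^sup>2 + (norm y)\<^sup>2) + (cinner x y + cnj (cinner x y))"
    unfolding cinner_self[symmetric] of_real_add cinner_commute[of x y, symmetric]
      cinner_commute[of y x, symmetric]
    by (simp add: cinner_add_left cinner_add_right)
  then have "Re (complex_of_real ((norm (x + y))\<^sup>2)) =
      Re (complex_of_real ((norm x)\<^sup>2 + (norm y)\<^sup>2) + (cinner x y + cnj (cinner x y)))"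
    by simp
  then show ?thesis by simp
qed

lemma norm_diff_square:
  "(norm (x - y))\<^sup>2 = (norm x)\<^sup>2 + (norm y)\<^sup>2 - 2 * Re (cinner x y)" for x y :: "'a::chilbert_space"
  using norm_add_square[of x "-y"] by (simp add: cinner_minus_right)

lemma parallelogram:
  "(norm (x + y))\<^sup>2 + (norm (x - y))\<^sup>2 = 2 * (norm x)\<^sup>2 + 2 * (norm y)\<^sup>2" for x y :: "'a::chilbert_space"
  by (simp add: norm_add_square norm_diff_square)

lemma Re_cinner_self [simp]: "Re (cinner x x) = (norm x)\<^sup>2" for x :: "'a::chilbert_space"
  by (simp add: cinner_self)

lemma cinner_eq_zero_iff: "cinner x x = 0 \<longleftrightarrow> x = 0" for x :: "'a::chilbert_space"
  by (simp add: cinner_self)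

lemma Re_cinner_le: "Re (cinner x y) \<le> norm x * norm y" for x y :: "'a::chilbert_space"
proof (cases "x = 0 \<or> y = 0")
  case False
  then have p: "norm x > 0" "norm y > 0" by auto
  have "0 \<le> (norm (norm y *\<^sub>R x - norm x *\<^sub>R y))\<^sup>2" by simp
  also have "\<dots> = 2 * (norm x * norm y) * (norm x * norm y - Re (cinner x y))"
    unfolding norm_diff_square
    by (simp add: cinner_scaleR_left cinner_scaleR_right power_mult_distrib power2_eq_square algebra_simps)
  finally show ?thesis using mult_pos_pos[OF p] by (simp add: zero_le_mult_iff)
qed auto

lemma Cauchy_Schwarz_cinner: "cmod (cinner x y) \<le> norm x * norm y" for x y :: "'a::chilbert_space"
proof -
  define z where "z = cinner x y"
  show ?thesis
  proof (cases "z = 0")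
    case False
    define u where "u = cnj z / cmod z"
    have u: "cmod u = 1" using False by (simp add: u_def norm_divide)
    have "u * z = complex_of_real (cmod z)"
      using complex_norm_square[of z] False
      by (simp add: u_def field_simps power2_eq_square)
    then have "cmod z = Re (cinner x (u *\<^sub>C y))"
      by (simp add: cinner_scaleC_right z_def)
    also have "\<dots> \<le> norm x * norm (u *\<^sub>C y)" by (rule Re_cinner_le)
    finally show ?thesis by (simp add: norm_scaleC u z_def)
  qed (simp add: z_def)
qed

lemma bounded_bilinear_cinner: "bounded_bilinear (cinner :: 'a::chilbert_space \<Rightarrow> 'a \<Rightarrow> complex)"
proof
  show "\<exists>K. \<forall>a b::'a. cmod (cinner a b) \<le> norm a * norm b * K"
    by (rule exI[of _ 1]) (simp add: Cauchy_Schwarz_cinner)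
qed (auto simp: cinner_add_left cinner_add_right cinner_scaleR_left cinner_scaleR_right scaleR_conv_of_real)

lemmas tendsto_cinner [tendsto_intros] = bounded_bilinear.tendsto[OF bounded_bilinear_cinner]
lemmas continuous_on_cinner [continuous_intros] =
  bounded_bilinear.continuous_on[OF bounded_bilinear_cinner]

lemma cinner_ext: "(\<And>z. cinner z x = cinner z y) \<Longrightarrow> x = y" for x y :: "'a::chilbert_space"
  by (metis cinner_diff_right cinner_eq_zero_iff eq_iff_diff_eq_0)

text \<open>The representing vector is the minimiser of \<open>\<parallel>y\<parallel>\<^sup>2 - 2 Re f(y)\<close>.\<close>

lemma riesz_representation:
  fixes f :: "'a::chilbert_space \<Rightarrow> complex"
  assumes bl: "bounded_linear f" and hom: "\<And>c y. f (c *\<^sub>C y) = c * f y"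
  shows "\<exists>x. \<forall>y. f y = cinner x y"
proof -
  interpret f: bounded_linear f by (rule bl)
  define q where "q y = (norm y)\<^sup>2 - 2 * Re (f y)" for y
  obtain K where K: "\<And>y. cmod (f y) \<le> norm y * K" using f.bounded by blast
  have lb: "- K\<^sup>2 \<le> q y" for y
  proof -
    have "Re (f y) \<le> norm y * K" using K[of y] complex_Re_le_cmod order_trans by blast
    moreover have "0 \<le> (norm y - K)\<^sup>2" by simp
    ultimately show ?thesis unfolding q_def by (simp add: power2_diff)
  qed
  define m where "m = (INF y. q y)"
  have bdd: "bdd_below (range q)" using lb by (auto intro!: bdd_belowI[of _ "- K\<^sup>2"])
  have m: "m \<le> q y" for y unfolding m_def by (rule cINF_lower[OF bdd]) simp
  have "\<exists>y. q y < m + 1 / Suc n" for n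
  proof -
    have "Inf (range q) < m + 1 / Suc n" by (simp add: m_def)
    then show ?thesis using cInf_less_iff[OF _ bdd, of "m + 1 / Suc n"] by auto
  qed
  then obtain y where y: "\<And>n. q (y n) < m + 1 / Suc n" by metis
  \<comment> \<open>The value at the midpoint is at least \<open>m\<close>, and the parallelogram
    law turns this into closeness of any two almost-minimisers.\<close>
  have par: "(norm (a - b))\<^sup>2 \<le> 2 * (q a - m) + 2 * (q b - m)" for a b
  proof -
    have "q ((1/2) *\<^sub>R (a + b)) = (norm (a + b))\<^sup>2 / 4 - Re (f a) - Re (f b)"
    proof -
      have h1: "(norm ((1/2) *\<^sub>R (a + b)))\<^sup>2 = (norm (a + b))\<^sup>2 / 4" by (simp add: power2_eq_square)
      have h2: "Re (f ((1/2) *\<^sub>R (a + b))) = (Re (f a) + Re (f b)) / 2"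
        by (simp only: f.scaleR f.add) simp
      show ?thesis unfolding q_def h1 h2 by (simp add: field_simps)
    qed
    then show ?thesis using m[of "(1/2) *\<^sub>R (a + b)"] parallelogram[of a b] unfolding q_def by simp
  qed
  have "Cauchy y"
  proof (rule metric_CauchyI)
    fix e :: real assume e: "e > 0"
    \<comment> \<open>The 4 is the total weight of the two defects in \<open>par\<close>.\<close>
    then obtain N :: nat where N: "4 / e\<^sup>2 < N" using reals_Archimedean2 by blast
    have "dist (y i) (y j) < e" if "i \<ge> N" "j \<ge> N" for i j
    proof -
      define \<delta> where "\<delta> = 1 / real (Suc N)"
      have b: "q (y k) - m < \<delta>" if "k \<ge> N" for k
      proof -
        have "1 / real (Suc k) \<le> \<delta>" using that by (simp add: \<delta>_def frac_le)
        with y[of k] show ?thesis by linarith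
      qed
      have "(norm (y i - y j))\<^sup>2 < 4 * \<delta>"
        using par[of "y i" "y j"] b[OF that(1)] b[OF that(2)] by (smt (verit))
      also have "\<dots> < e\<^sup>2"
        using N e by (simp add: \<delta>_def field_simps) (smt (verit) zero_less_power)
      finally show ?thesis using e by (simp add: dist_norm power2_less_imp_less)
    qed
    then show "\<exists>M. \<forall>m\<ge>M. \<forall>n\<ge>M. dist (y m) (y n) < e" by blast
  qed
  then obtain x where x: "y \<longlonglongrightarrow> x" using Cauchy_convergent_iff convergent_def by blast
  have "(\<lambda>n. q (y n)) \<longlonglongrightarrow> q x"
    unfolding q_def by (intro tendsto_intros x f.tendsto)
  moreover have "(\<lambda>n. m + 1 / Suc n) \<longlonglongrightarrow> m + 0"
    by (intro tendsto_intros LIMSEQ_Suc[OF lim_1_over_n])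
  ultimately have qx: "q x \<le> m"
    using y LIMSEQ_le[of "\<lambda>n. q (y n)" "q x" "\<lambda>n. m + 1 / Suc n" m] by (auto intro: less_imp_le)
  have Re: "Re (f z) = Re (cinner x z)" for z
  proof -
    have ineq: "0 \<le> t\<^sup>2 * (norm z)\<^sup>2 + 2 * t * (Re (cinner x z) - Re (f z))" for t
      using m[of "x + t *\<^sub>R z"] qx unfolding q_def norm_add_square
      by (simp add: f.add f.scaleR cinner_scaleR_right power_mult_distrib algebra_simps)
    define c where "c = Re (cinner x z) - Re (f z)"
    \<comment> \<open>The added 1 makes \<open>n\<close> positive also for \<open>z = 0\<close>; the
      quadratic inequality at \<open>- c / n\<close> then forces \<open>c = 0\<close>.\<close>
    define n where "n = (norm z)\<^sup>2 + 1"
    have n: "n > 0" unfolding n_def by (simp add: add_nonneg_pos)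
    define t where "t = c / n"
    have c: "c = t * n" using n by (simp add: t_def)
    have "0 \<le> (- t)\<^sup>2 * (n - 1) + 2 * (- t) * c"
      using ineq[of "- t"] unfolding c_def n_def by simp
    also have "\<dots> = - (t\<^sup>2 * (n + 1))" unfolding c by (simp add: power2_eq_square algebra_simps)
    finally have "t = 0" using n by (simp add: mult_le_0_iff)
    then show ?thesis using c by (simp add: c_def)
  qed
  have "f z = cinner x z" for z
  proof (rule complex_eqI[OF Re])
    \<comment> \<open>On both sides the imaginary part at z is minus the real part at \<i>
      z.\<close>
    show "Im (f z) = Im (cinner x z)"
      using Re[of "\<i> *\<^sub>C z"] by (simp add: hom cinner_scaleC_right)
  qed
  then show ?thesis by blast
qed

section \<open>Adjoints, unitaries and conjugation by them\<close>

lemma bounded_ops_scaleC: "A \<in> bounded_ops \<Longrightarrow> blinfun_apply A (c *\<^sub>C x) = c *\<^sub>C blinfun_apply A x"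
  by (simp add: bounded_ops_def)

lemma adjoint_exists:
  fixes A :: "'h::chilbert_space \<Rightarrow>\<^sub>L 'h"
  assumes A: "A \<in> bounded_ops"
  shows "\<exists>B\<in>bounded_ops. \<forall>\<phi> \<psi>. cinner (blinfun_apply A \<phi>) \<psi> = cinner \<phi> (blinfun_apply B \<psi>)"
proof -
  have "\<exists>x. \<forall>\<phi>. cinner \<psi> (blinfun_apply A \<phi>) = cinner x \<phi>" for \<psi>
    by (rule riesz_representation)
       (auto simp: bounded_ops_scaleC[OF A] cinner_scaleC_right
         intro!: bounded_linear_compose[OF bounded_bilinear.bounded_linear_right[OF bounded_bilinear_cinner]]
         blinfun.bounded_linear_right)
  then obtain B where B: "\<And>\<psi> \<phi>. cinner \<psi> (blinfun_apply A \<phi>) = cinner (B \<psi>) \<phi>" by metis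
  have B': "cinner (blinfun_apply A \<phi>) \<psi> = cinner \<phi> (B \<psi>)" for \<phi> \<psi>
    by (metis B cinner_commute)
  have add: "B (x + y) = B x + B y" for x y
    by (rule cinner_ext) (simp add: B'[symmetric] cinner_add_right)
  have scC: "B (c *\<^sub>C x) = c *\<^sub>C B x" for c x
    by (rule cinner_ext) (simp add: B'[symmetric] cinner_scaleC_right)
  have nB: "norm (B x) \<le> norm x * norm A" for x
  proof -
    have "(norm (B x))\<^sup>2 = cmod (cinner (blinfun_apply A (B x)) x)"
      unfolding B' cinner_self by (simp add: norm_power)
    also have "\<dots> \<le> norm (blinfun_apply A (B x)) * norm x" by (rule Cauchy_Schwarz_cinner)
    also have "\<dots> \<le> norm A * norm (B x) * norm x" by (intro mult_right_mono norm_blinfun) simp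
    finally show ?thesis
      by (cases "B x = 0") (auto simp: power2_eq_square mult.commute)
  qed
  have bl: "bounded_linear B"
    by (rule bounded_linear_intro[of _ "norm A"]) (use add nB scC[of "complex_of_real _"] in \<open>auto simp: scaleC_of_real\<close>)
  show ?thesis
    by (rule bexI[of _ "Blinfun B"]) (auto simp: bounded_linear_Blinfun_apply[OF bl] B' bounded_ops_def scC)
qed

text \<open>Discharges the \<open>THE\<close> in \<open>cadj\<close>: the identity pins the
  candidate down, since inner products separate vectors.\<close>

lemma cadj_unique:
  fixes A B :: "'h::chilbert_space \<Rightarrow>\<^sub>L 'h"
  assumes "\<And>\<phi> \<psi>. cinner (blinfun_apply A \<phi>) \<psi> = cinner \<phi> (blinfun_apply B \<psi>)"
  shows "cadj A = B"
  unfolding cadj_def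
proof (rule the_equality)
  show "C = B" if "\<forall>\<phi> \<psi>. cinner (blinfun_apply A \<phi>) \<psi> = cinner \<phi> (blinfun_apply C \<psi>)" for C
    by (rule blinfun_eqI, rule cinner_ext) (metis assms that)
qed (use assms in blast)

lemma
  assumes "A \<in> bounded_ops"
  shows cadj_bounded_ops [simp]: "cadj A \<in> bounded_ops"
    and cinner_cadj: "cinner (blinfun_apply A \<phi>) \<psi> = cinner \<phi> (blinfun_apply (cadj A) \<psi>)"
proof -
  obtain B where B: "B \<in> bounded_ops" "\<And>\<phi> \<psi>. cinner (blinfun_apply A \<phi>) \<psi> = cinner \<phi> (blinfun_apply B \<psi>)"
    using adjoint_exists[OF assms] by blast
  have "cadj A = B" by (rule cadj_unique[OF B(2)])
  then show "cadj A \<in> bounded_ops"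
    "cinner (blinfun_apply A \<phi>) \<psi> = cinner \<phi> (blinfun_apply (cadj A) \<psi>)"
    using B by auto
qed

lemma cinner_cadj': "A \<in> bounded_ops \<Longrightarrow>
    cinner \<phi> (blinfun_apply A \<psi>) = cinner (blinfun_apply (cadj A) \<phi>) \<psi>"
  by (metis cinner_cadj cinner_commute)

lemma cadj_cadj [simp]: "A \<in> bounded_ops \<Longrightarrow> cadj (cadj A) = A"
  by (rule cadj_unique) (simp add: cinner_cadj')

lemma op_scaleC_apply [simp]: "blinfun_apply (op_scaleC c A) x = c *\<^sub>C blinfun_apply A x"
  unfolding op_scaleC_def
  by (simp add: bounded_linear_Blinfun_apply
      bounded_linear_compose[OF bounded_linear_scaleC blinfun.bounded_linear_right])

lemma bounded_ops_id [simp]: "id_blinfun \<in> bounded_ops"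
  and bounded_ops_zero [simp]: "0 \<in> bounded_ops"
  and bounded_ops_add [simp]: "A \<in> bounded_ops \<Longrightarrow> B \<in> bounded_ops \<Longrightarrow> A + B \<in> bounded_ops"
  and bounded_ops_diff [simp]: "A \<in> bounded_ops \<Longrightarrow> B \<in> bounded_ops \<Longrightarrow> A - B \<in> bounded_ops"
  and bounded_ops_compose [simp]: "A \<in> bounded_ops \<Longrightarrow> B \<in> bounded_ops \<Longrightarrow> A o\<^sub>L B \<in> bounded_ops"
  and bounded_ops_op_scaleC [simp]: "A \<in> bounded_ops \<Longrightarrow> op_scaleC c A \<in> bounded_ops"
  by (auto simp: bounded_ops_def blinfun.add_left blinfun.diff_left scaleC_add_right scaleC_diff_right
      scaleC_scaleC mult.commute)

lemma cadj_zero [simp]: "cadj 0 = 0" by (rule cadj_unique) simp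
lemma cadj_id [simp]: "cadj id_blinfun = id_blinfun" by (rule cadj_unique) simp

lemma cadj_diff: "A \<in> bounded_ops \<Longrightarrow> B \<in> bounded_ops \<Longrightarrow> cadj (A - B) = cadj A - cadj B"
  by (rule cadj_unique) (simp add: blinfun.diff_left cinner_diff_left cinner_diff_right cinner_cadj)

lemma cadj_compose: "A \<in> bounded_ops \<Longrightarrow> B \<in> bounded_ops \<Longrightarrow> cadj (A o\<^sub>L B) = cadj B o\<^sub>L cadj A"
  by (rule cadj_unique) (simp add: cinner_cadj)

lemma op_scaleC_diff: "op_scaleC c A - op_scaleC c B = op_scaleC c (A - B)"
  by (rule blinfun_eqI) (simp add: blinfun.diff_left scaleC_diff_right)

lemma op_scaleC_zero [simp]: "op_scaleC c 0 = 0"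
  by (rule blinfun_eqI) simp

lemma norm_op_scaleC_le: "norm (op_scaleC c A) \<le> cmod c * norm A"
  by (rule norm_blinfun_bound) (auto simp: norm_scaleC mult.assoc intro!: mult_left_mono norm_blinfun)

lemma norm_cadj_le: assumes "A \<in> bounded_ops" shows "norm (cadj A) \<le> norm A"
proof (rule norm_blinfun_bound)
  fix x
  let ?y = "blinfun_apply (cadj A) x"
  have "(norm ?y)\<^sup>2 = cmod (cinner (blinfun_apply A ?y) x)"
    unfolding cinner_cadj[OF assms] cinner_self by (simp add: norm_power)
  also have "\<dots> \<le> norm (blinfun_apply A ?y) * norm x" by (rule Cauchy_Schwarz_cinner)
  also have "\<dots> \<le> norm A * norm ?y * norm x" by (intro mult_right_mono norm_blinfun) simp
  finally show "norm ?y \<le> norm A * norm x"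
    by (cases "?y = 0") (auto simp: power2_eq_square)
qed simp

lemma norm_cadj [simp]: "A \<in> bounded_ops \<Longrightarrow> norm (cadj A) = norm A"
  by (metis antisym cadj_bounded_ops cadj_cadj norm_cadj_le)

lemma unitary_op_bounded_ops: "unitary_op V \<Longrightarrow> V \<in> bounded_ops"
  by (simp add: unitary_op_def)

lemma unitary_op_cadj_apply:
  assumes "unitary_op V"
  shows "blinfun_apply (cadj V) (blinfun_apply V x) = x" "blinfun_apply V (blinfun_apply (cadj V) x) = x"
  using assms unfolding unitary_op_def by (metis blinfun_apply_blinfun_compose id_blinfun.rep_eq id_apply)+

lemma unitary_op_cinner: "unitary_op V \<Longrightarrow> cinner (blinfun_apply V x) (blinfun_apply V y) = cinner x y"
  by (simp add: cinner_cadj unitary_op_bounded_ops unitary_op_cadj_apply)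

lemma unitary_op_norm: "unitary_op V \<Longrightarrow> norm (blinfun_apply V x) = norm x"
  using unitary_op_cinner[of V x x] by (simp add: cinner_self power2_eq_iff_nonneg del: of_real_power)

text \<open>Isometry makes the given inverse the adjoint: (V \<phi>|\<psi>) = (V \<phi>|V W \<psi>)
  = (\<phi>|W \<psi>).\<close>

lemma unitary_opI:
  assumes "V \<in> bounded_ops" "W \<in> bounded_ops" "V o\<^sub>L W = id_blinfun" "W o\<^sub>L V = id_blinfun"
    and "\<And>x y. cinner (blinfun_apply V x) (blinfun_apply V y) = cinner x y"
  shows "unitary_op V" "cadj V = W"
proof -
  have VW: "blinfun_apply V (blinfun_apply W y) = y" for y
    by (metis assms(3) blinfun_apply_blinfun_compose id_blinfun.rep_eq id_apply)
  show *: "cadj V = W"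
    by (rule cadj_unique) (metis assms(5) VW)
  show "unitary_op V" using assms * by (simp add: unitary_op_def)
qed

lemma ad_apply: "blinfun_apply (ad V A) x = blinfun_apply V (blinfun_apply A (blinfun_apply (cadj V) x))"
  by (simp add: ad_def)

lemma norm_ad_le: assumes "unitary_op V" shows "norm (ad V A) \<le> norm A"
proof (rule norm_blinfun_bound)
  fix x
  have "norm (blinfun_apply (ad V A) x) = norm (blinfun_apply A (blinfun_apply (cadj V) x))"
    by (simp add: ad_apply unitary_op_norm assms)
  also have "\<dots> \<le> norm A * norm (blinfun_apply (cadj V) x)" by (rule norm_blinfun)
  also have "norm (blinfun_apply (cadj V) x) = norm x"
    by (metis assms unitary_op_norm unitary_op_cadj_apply(2))
  finally show "norm (blinfun_apply (ad V A) x) \<le> norm A * norm x" .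
qed simp

lemma ad_add: "ad V (A + B) = ad V A + ad V B"
  and ad_diff: "ad V (A - B) = ad V A - ad V B"
  by (rule blinfun_eqI; simp add: ad_apply blinfun.add_left blinfun.add_right blinfun.diff_left blinfun.diff_right)+

lemma ad_op_scaleC: "V \<in> bounded_ops \<Longrightarrow> ad V (op_scaleC c A) = op_scaleC c (ad V A)"
  by (rule blinfun_eqI) (simp add: ad_apply bounded_ops_scaleC)

lemma ad_compose: "unitary_op V \<Longrightarrow> ad V (A o\<^sub>L B) = ad V A o\<^sub>L ad V B"
  by (rule blinfun_eqI) (simp add: ad_apply unitary_op_cadj_apply)

lemma ad_id: "unitary_op V \<Longrightarrow> ad V id_blinfun = id_blinfun"
  by (rule blinfun_eqI) (simp add: ad_apply unitary_op_cadj_apply)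

lemma ad_bounded_ops: "unitary_op V \<Longrightarrow> A \<in> bounded_ops \<Longrightarrow> ad V A \<in> bounded_ops"
  by (simp add: ad_def unitary_op_bounded_ops)

lemma ad_cadj: "unitary_op V \<Longrightarrow> A \<in> bounded_ops \<Longrightarrow> ad V (cadj A) = cadj (ad V A)"
  by (rule blinfun_eqI) (simp add: ad_def cadj_compose unitary_op_bounded_ops)

lemma ad_ad: "unitary_op V \<Longrightarrow> unitary_op W \<Longrightarrow> ad (V o\<^sub>L W) A = ad V (ad W A)"
  by (rule blinfun_eqI) (simp add: ad_apply cadj_compose unitary_op_bounded_ops)

lemma ad_id_left: "ad id_blinfun A = A"
  by (rule blinfun_eqI) (simp add: ad_apply)

section \<open>Operators determined on dense subspaces\<close>

definition complex_subspace :: "'a::chilbert_space set \<Rightarrow> bool" where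
  "complex_subspace D \<longleftrightarrow> (\<forall>x\<in>D. \<forall>y\<in>D. x + y \<in> D) \<and> (\<forall>c. \<forall>x\<in>D. c *\<^sub>C x \<in> D)"

text \<open>A bounded linear map on a dense subspace is uniformly continuous, so completeness
  extends it, and linearity passes to the limit. Both the implementing unitaries and the spectral
  projections are produced in this way.\<close>

lemma operator_extension:
  fixes f :: "'a::chilbert_space \<Rightarrow> 'a"
  assumes D: "complex_subspace D" "closure D = UNIV"
    and add: "\<And>x y. x \<in> D \<Longrightarrow> y \<in> D \<Longrightarrow> f (x + y) = f x + f y"
    and sc: "\<And>c x. x \<in> D \<Longrightarrow> f (c *\<^sub>C x) = c *\<^sub>C f x"
    and bd: "\<And>x. x \<in> D \<Longrightarrow> norm (f x) \<le> C * norm x"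
  shows "\<exists>F\<in>bounded_ops. \<forall>x\<in>D. blinfun_apply F x = f x"
proof -
  have Dadd: "x + y \<in> D" and Dsc: "c *\<^sub>C x \<in> D" if "x \<in> D" "y \<in> D" for x y c
    using D that unfolding complex_subspace_def by auto
  have Ddiff: "x - y \<in> D" and fdiff: "f (x - y) = f x - f y" if "x \<in> D" "y \<in> D" for x y
    using Dadd[OF that(1) Dsc[OF that(2,2), of "-1"]] add[OF that(1) Dsc[OF that(2,2), of "-1"]] sc[OF that(2), of "-1"]
    by (auto simp: scaleC_minus_one)
  \<comment> \<open>Positivity of \<open>K\<close> allows the modulus of continuity
    \<open>e / K\<close>.\<close>
  define K where "K = max C 1"
  have K: "K > 0" "C \<le> K" by (auto simp: K_def)
  have bdK: "norm (f x) \<le> K * norm x" if "x \<in> D" for x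
    using bd[OF that] K(2) by (meson mult_right_mono norm_ge_zero order_trans)
  have "uniformly_continuous_on D f"
    unfolding uniformly_continuous_on_def
  proof safe
    fix e :: real assume "e > 0"
    then show "\<exists>d>0. \<forall>x\<in>D. \<forall>x'\<in>D. dist x' x < d \<longrightarrow> dist (f x') (f x) < e"
      using K by (intro exI[of _ "e / K"])
        (auto simp: dist_norm fdiff[symmetric] field_simps intro!: le_less_trans[OF bdK[OF Ddiff]])
  qed
  then obtain g where g: "uniformly_continuous_on (closure D) g" "\<And>x. x \<in> D \<Longrightarrow> f x = g x"
    using uniformly_continuous_on_extension_on_closure[of D f] by metis
  have gc: "continuous_on UNIV g" using g(1) D(2) uniformly_continuous_imp_continuous by metis
  have lim: "(\<lambda>n. g (s n)) \<longlonglongrightarrow> g x" if "s \<longlonglongrightarrow> x" for s x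
    using gc that by (auto intro: continuous_on_tendsto_compose[of UNIV g])
  have app: "\<exists>s. (\<forall>n. s n \<in> D) \<and> s \<longlonglongrightarrow> x" for x
    using D(2) closure_sequential[of x D] by auto
  have gadd: "g (x + y) = g x + g y" for x y
  proof -
    obtain s t where s: "\<And>n. s n \<in> D" "s \<longlonglongrightarrow> x" and t: "\<And>n. t n \<in> D" "t \<longlonglongrightarrow> y"
      using app by metis
    have "(\<lambda>n. g (s n + t n)) \<longlonglongrightarrow> g (x + y)" by (intro lim tendsto_intros s t)
    moreover have "(\<lambda>n. g (s n + t n)) = (\<lambda>n. g (s n) + g (t n))"
      by (simp add: g(2)[symmetric] add s(1) t(1) Dadd)
    moreover have "(\<lambda>n. g (s n) + g (t n)) \<longlonglongrightarrow> g x + g y" by (intro tendsto_intros lim s t)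
    ultimately show ?thesis using LIMSEQ_unique by metis
  qed
  have gsc: "g (c *\<^sub>C x) = c *\<^sub>C g x" for c x
  proof -
    obtain s where s: "\<And>n. s n \<in> D" "s \<longlonglongrightarrow> x" using app by metis
    have "(\<lambda>n. g (c *\<^sub>C s n)) \<longlonglongrightarrow> g (c *\<^sub>C x)"
      by (intro lim bounded_linear.tendsto[OF bounded_linear_scaleC] s)
    moreover have "(\<lambda>n. g (c *\<^sub>C s n)) = (\<lambda>n. c *\<^sub>C g (s n))"
      by (simp add: g(2)[symmetric] sc s(1) Dsc[OF s(1) s(1)])
    moreover have "(\<lambda>n. c *\<^sub>C g (s n)) \<longlonglongrightarrow> c *\<^sub>C g x"
      by (intro bounded_linear.tendsto[OF bounded_linear_scaleC] lim s)
    ultimately show ?thesis using LIMSEQ_unique by metis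
  qed
  have gbd: "norm (g x) \<le> norm x * K" for x
  proof -
    obtain s where s: "\<And>n. s n \<in> D" "s \<longlonglongrightarrow> x" using app by metis
    show ?thesis
    proof (rule LIMSEQ_le)
      show "(\<lambda>n. norm (g (s n))) \<longlonglongrightarrow> norm (g x)" by (intro tendsto_intros lim s)
      show "(\<lambda>n. norm (s n) * K) \<longlonglongrightarrow> norm x * K" by (intro tendsto_intros s)
    qed (use bdK s(1) g(2) in \<open>auto simp: mult.commute\<close>)
  qed
  have bl: "bounded_linear g"
    by (rule bounded_linear_intro[of _ K]) (use gadd gbd gsc[of "complex_of_real _"] in \<open>auto simp: scaleC_of_real\<close>)
  show ?thesis
    by (rule bexI[of _ "Blinfun g"])
       (auto simp: bounded_linear_Blinfun_apply[OF bl] bounded_ops_def gsc g(2))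
qed

lemma continuous_eq_on_dense:
  fixes f g :: "'a::topological_space \<Rightarrow> 'b::t2_space"
  assumes "closure D = UNIV" "continuous_on UNIV f" "continuous_on UNIV g" "\<And>x. x \<in> D \<Longrightarrow> f x = g x"
  shows "f x = g x"
proof -
  have "closed {x. f x = g x}" using assms(2,3) by (intro closed_Collect_eq)
  then have "closure D \<subseteq> {x. f x = g x}" by (intro closure_minimal) (use assms(4) in auto)
  then show ?thesis using assms(1) by auto
qed

lemma blinfun_eq_on_dense:
  assumes "closure D = UNIV" "\<And>x. x \<in> D \<Longrightarrow> blinfun_apply A x = blinfun_apply B x"
  shows "A = B"
  by (rule blinfun_eqI, rule continuous_eq_on_dense[OF assms(1)])
     (use assms(2) in \<open>auto intro!: continuous_intros\<close>)

text \<open>Polarising gives the sum of the two cross terms; replacing y by \<i> y gives their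
  difference. Both vanish. Complex scalars are essential: a rotation of the real plane by a right
  angle has zero quadratic form.\<close>

lemma polarization_zero:
  fixes A :: "'a::chilbert_space \<Rightarrow>\<^sub>L 'a"
  assumes A: "A \<in> bounded_ops" and z: "\<And>x. cinner x (blinfun_apply A x) = 0"
  shows "A = 0"
proof -
  have *: "cinner x (blinfun_apply A y) + cinner y (blinfun_apply A x) = 0" for x y
    using z[of "x + y"] z[of x] z[of y]
    by (simp add: blinfun.add_right cinner_add_left cinner_add_right add.commute)
  have "cinner x (blinfun_apply A y) = 0" for x y
  proof -
    have "\<i> * (cinner x (blinfun_apply A y) - cinner y (blinfun_apply A x)) = 0"
      using *[of x "\<i> *\<^sub>C y"]
      by (simp add: bounded_ops_scaleC[OF A] cinner_scaleC_left cinner_scaleC_right algebra_simps)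
    then have "cinner x (blinfun_apply A y) = cinner y (blinfun_apply A x)" by simp
    with *[of x y] show ?thesis by (metis add_self_div_2 div_0 mult_2 no_zero_divisors mult_eq_0_iff zero_neq_numeral)
  qed
  then show ?thesis by (intro blinfun_eqI cinner_ext) simp
qed


section \<open>The Daniell-Riesz theorem\<close>


definition Cb :: "('a::metric_space \<Rightarrow> real) \<Rightarrow> bool" where
  "Cb f \<longleftrightarrow> continuous_on UNIV f \<and> bounded (range f)"

lemma CbI: "continuous_on UNIV f \<Longrightarrow> (\<And>x. \<bar>f x\<bar> \<le> C) \<Longrightarrow> Cb f"
  unfolding Cb_def by (auto intro!: boundedI[of _ C])

lemma Cb_boundE: assumes "Cb f" obtains C where "C > 0" "\<And>x. \<bar>f x\<bar> \<le> C"
  using assms unfolding Cb_def bounded_pos by auto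

lemma Cb_const [simp]: "Cb (\<lambda>_. c)" by (rule CbI[of _ "\<bar>c\<bar>"]) auto

lemma Cb_add [simp]: assumes "Cb f" "Cb g" shows "Cb (\<lambda>x. f x + g x)"
  using assms unfolding Cb_def by (auto intro!: continuous_intros bounded_plus_comp)

lemma Cb_cmult [simp]: assumes "Cb f" shows "Cb (\<lambda>x. c * f x)"
  using assms unfolding Cb_def
  by (auto intro!: continuous_intros simp: bounded_iff abs_mult) (meson abs_ge_zero mult_left_mono)

lemma Cb_uminus [simp]: "Cb f \<Longrightarrow> Cb (\<lambda>x. - f x)"
  using Cb_cmult[of f "-1"] by simp

lemma Cb_diff [simp]: "Cb f \<Longrightarrow> Cb g \<Longrightarrow> Cb (\<lambda>x. f x - g x)"
  using Cb_add[of f "\<lambda>x. - g x"] by simp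

lemma Cb_max [simp]: assumes "Cb f" "Cb g" shows "Cb (\<lambda>x. max (f x) (g x))"
proof -
  obtain C where C: "\<And>x. \<bar>f x\<bar> \<le> C" using assms Cb_boundE by metis
  obtain D where D: "\<And>x. \<bar>g x\<bar> \<le> D" using assms Cb_boundE by metis
  show ?thesis
  proof (rule CbI[of _ "max C D"])
    show "continuous_on UNIV (\<lambda>x. max (f x) (g x))"
      using assms unfolding Cb_def by (intro continuous_intros) auto
    show "\<bar>max (f x) (g x)\<bar> \<le> max C D" for x
      using C[of x] D[of x] by linarith
  qed
qed

lemma Cb_min [simp]: "Cb f \<Longrightarrow> Cb g \<Longrightarrow> Cb (\<lambda>x. min (f x) (g x))"
  using Cb_uminus[OF Cb_max[OF Cb_uminus Cb_uminus, of f g]] by (simp add: minus_max_eq_min)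

lemma Cb_sum [simp]: "(\<And>i. i \<in> I \<Longrightarrow> Cb (f i)) \<Longrightarrow> Cb (\<lambda>x. \<Sum>i\<in>I. f i x)"
  by (induction I rule: infinite_finite_induct) auto

lemma Cb_measurable: "Cb f \<Longrightarrow> f \<in> borel_measurable borel"
  unfolding Cb_def by (simp add: borel_measurable_continuous_onI)

lemma Cb_integrable:
  assumes "Cb f" "finite_measure M" "sets M = sets borel"
  shows "integrable M f"
proof -
  interpret finite_measure M by fact
  obtain C where "\<And>x. \<bar>f x\<bar> \<le> C" using assms Cb_boundE by metis
  then show ?thesis
    using Cb_measurable[OF assms(1)] measurable_cong_sets[OF assms(3) refl, of borel]
    by (intro integrable_const_bound[of _ C]) auto
qed

text \<open>The case \<open>U = UNIV\<close> is separate because \<open>infdist x {} = 0\<close>.\<close>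

definition bump :: "'a::metric_space set \<Rightarrow> nat \<Rightarrow> 'a \<Rightarrow> real" where
  "bump U k x = (if U = UNIV then 1 else min 1 (real k * infdist x (- U)))"

lemma bump_nonneg: "0 \<le> bump U k x" and bump_le_1: "bump U k x \<le> 1"
  by (auto simp: bump_def infdist_nonneg)

lemma bump_outside: "x \<notin> U \<Longrightarrow> bump U k x = 0"
  by (auto simp: bump_def)

lemma Cb_bump [simp]: "Cb (bump U k)"
proof (cases "U = UNIV")
  case False
  then have "bump U k = (\<lambda>x. min 1 (real k * infdist x (- U)))" by (simp add: bump_def fun_eq_iff)
  moreover have "continuous_on UNIV (\<lambda>x. min 1 (real k * infdist x (- U)))"
    by (intro continuous_intros)
  ultimately show ?thesis
    using bump_nonneg[of U k] bump_le_1[of U k] by (intro CbI[of _ 1]) auto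
qed (simp add: bump_def[abs_def])

lemma bump_mono: assumes "k \<le> l" shows "bump U k x \<le> bump U l x"
proof -
  have "real k * infdist x (- U) \<le> real l * infdist x (- U)"
    using assms by (intro mult_right_mono infdist_nonneg) auto
  then show ?thesis by (simp add: bump_def min.coboundedI2)
qed

lemma bump_eventually: assumes "open U" "x \<in> U" shows "\<forall>\<^sub>F k in sequentially. bump U k x = 1"
proof (cases "U = UNIV")
  case False
  then have "infdist x (- U) > 0"
    using assms infdist_pos_not_in_closed[of "- U" x] by auto
  then obtain n :: nat where "1 / infdist x (- U) < n" using reals_Archimedean2 by blast
  then have n: "1 < n * infdist x (- U)" using \<open>infdist x (- U) > 0\<close> by (simp add: field_simps)
  have "bump U k x = 1" if "k \<ge> n" for k
  proof -
    have "n * infdist x (- U) \<le> k * infdist x (- U)" using that by (intro mult_right_mono infdist_nonneg) auto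
    then show ?thesis using n False by (simp add: bump_def)
  qed
  then show ?thesis unfolding eventually_sequentially by blast
qed (simp add: bump_def)

lemma bump_LIMSEQ: "open U \<Longrightarrow> (\<lambda>k. bump U k x) \<longlonglongrightarrow> indicator U x"
  using bump_eventually[of U x] bump_outside[of x U]
  by (cases "x \<in> U") (auto intro: tendsto_eventually)

section \<open>From a Daniell functional to an outer measure\<close>

locale daniell_functional =
  fixes \<Lambda> :: "('a::metric_space \<Rightarrow> real) \<Rightarrow> real"
  assumes add: "Cb f \<Longrightarrow> Cb g \<Longrightarrow> \<Lambda> (\<lambda>x. f x + g x) = \<Lambda> f + \<Lambda> g"
    and scale: "Cb f \<Longrightarrow> \<Lambda> (\<lambda>x. c * f x) = c * \<Lambda> f"
    and pos: "Cb f \<Longrightarrow> (\<And>x. 0 \<le> f x) \<Longrightarrow> 0 \<le> \<Lambda> f"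
    and daniell: "(\<And>k. Cb (h k)) \<Longrightarrow> (\<And>x. decseq (\<lambda>k. h k x)) \<Longrightarrow> (\<And>x. (\<lambda>k. h k x) \<longlonglongrightarrow> 0)
          \<Longrightarrow> (\<lambda>k. \<Lambda> (h k)) \<longlonglongrightarrow> 0"
begin

lemma zero: "\<Lambda> (\<lambda>_. 0) = 0"
  using scale[of "\<lambda>_. 0" 0] by simp

lemma diff: "Cb f \<Longrightarrow> Cb g \<Longrightarrow> \<Lambda> (\<lambda>x. f x - g x) = \<Lambda> f - \<Lambda> g"
  using add[of f "\<lambda>x. (-1) * g x"] scale[of g "-1"] by simp

lemma mono: "Cb f \<Longrightarrow> Cb g \<Longrightarrow> (\<And>x. f x \<le> g x) \<Longrightarrow> \<Lambda> f \<le> \<Lambda> g"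
  using pos[of "\<lambda>x. g x - f x"] diff[of g f] by simp

lemma sum: "(\<And>i. i \<in> I \<Longrightarrow> Cb (f i)) \<Longrightarrow> finite I \<Longrightarrow> \<Lambda> (\<lambda>x. \<Sum>i\<in>I. f i x) = (\<Sum>i\<in>I. \<Lambda> (f i))"
  by (induction I rule: infinite_finite_induct) (auto simp: zero add)

text \<open>Domination by the indicator replaces compact support inside \<open>U\<close>, since the
  metric space need not be locally compact.\<close>

definition test :: "'a set \<Rightarrow> ('a \<Rightarrow> real) set" where
  "test U = {f. Cb f \<and> (\<forall>x. 0 \<le> f x \<and> f x \<le> indicator U x)}"

definition content :: "'a set \<Rightarrow> ennreal" where
  "content U = (SUP f\<in>test U. ennreal (\<Lambda> f))"

definition outer :: "'a set \<Rightarrow> ennreal" where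
  "outer A = (INF U\<in>{U. open U \<and> A \<subseteq> U}. content U)"

lemma test_upper: "f \<in> test U \<Longrightarrow> ennreal (\<Lambda> f) \<le> content U"
  unfolding content_def by (rule SUP_upper)

lemma zero_in_test: "(\<lambda>_. 0) \<in> test U"
  by (auto simp: test_def)

lemma test_mono: "U \<subseteq> V \<Longrightarrow> test U \<subseteq> test V"
proof
  fix f assume U: "U \<subseteq> V" and f: "f \<in> test U"
  have "f x \<le> indicator V x" for x
  proof -
    have "f x \<le> indicator U x" using f by (simp add: test_def)
    also have "\<dots> \<le> indicator V x" by (rule indicator_leI) (use U in auto)
    finally show ?thesis .
  qed
  with f show "f \<in> test V" by (simp add: test_def)
qed

lemma content_mono: "U \<subseteq> V \<Longrightarrow> content U \<le> content V"
  unfolding content_def by (intro SUP_subset_mono test_mono) auto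

lemma test_bounds:
  assumes "f \<in> test U"
  shows "Cb f" "0 \<le> f x" "f x \<le> 1" "x \<notin> U \<Longrightarrow> f x = 0"
proof -
  have *: "Cb f" "0 \<le> f x" "f x \<le> indicator U x" using assms by (auto simp: test_def)
  then show "Cb f" "0 \<le> f x" by auto
  show "f x \<le> 1" using *(3) by (rule order_trans) (simp add: indicator_def)
  show "x \<notin> U \<Longrightarrow> f x = 0" using * by simp
qed

lemma outer_open: "open U \<Longrightarrow> outer U = content U"
  unfolding outer_def by (intro antisym INF_lower INF_greatest) (auto intro: content_mono)

lemma outer_mono: "A \<subseteq> B \<Longrightarrow> outer A \<le> outer B"
  unfolding outer_def by (intro INF_superset_mono) auto

lemma content_UNIV: "content UNIV = ennreal (\<Lambda> (\<lambda>_. 1))"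
  unfolding content_def test_def
  by (intro antisym SUP_least SUP_upper2[of "\<lambda>_. 1"] ennreal_leI mono) auto

lemma content_empty: "content {} = 0"
proof -
  have "test {} = {\<lambda>_. 0}"
    using zero_in_test[of "{}"] by (auto simp: test_def fun_eq_iff intro: antisym)
  then show ?thesis by (simp add: content_def zero)
qed

text \<open>This is where the Daniell axiom enters: it stands in for the compactness argument that
  would cover the support of a test function by finitely many \<open>U i\<close>. The part of
  \<open>f\<close> that exceeds the bumps used so far decreases to zero, hence so does its value
  under \<Lambda>.\<close>

lemma content_UN_le:
  fixes U :: "nat \<Rightarrow> 'a set"
  assumes U: "\<And>i. open (U i)"
  shows "content (\<Union>i. U i) \<le> (\<Sum>i. content (U i))"
  unfolding content_def[of "\<Union>i. U i"]
proof (rule SUP_least)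
  fix f assume f: "f \<in> test (\<Union>i. U i)"
  then have Cf: "Cb f" by (simp add: test_def)
  \<comment> \<open>\<open>k\<close> counts the sets and also sets the steepness of their bumps, so
    a single index makes \<open>H k\<close> increase and eventually reach 1 at each point of the
    union.\<close>
  define H where "H k x = (\<Sum>i<k. bump (U i) k x)" for k x
  have CH: "Cb (H k)" for k unfolding H_def by simp
  define r where "r k x = max 0 (f x - H k x)" for k x
  have Cr: "Cb (r k)" for k using Cf CH unfolding r_def by simp
  have Hmono: "H k x \<le> H l x" if "k \<le> l" for k l x
  proof -
    have "H k x \<le> (\<Sum>i<k. bump (U i) l x)" unfolding H_def by (intro sum_mono bump_mono that)
    also have "\<dots> \<le> H l x" unfolding H_def by (intro sum_mono2) (use that bump_nonneg in auto)
    finally show ?thesis .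
  qed
  have "(\<lambda>k. \<Lambda> (r k)) \<longlonglongrightarrow> 0"
  proof (rule daniell)
    show "decseq (\<lambda>k. r k x)" for x
      unfolding decseq_def r_def by (intro allI impI max.mono diff_left_mono Hmono order_refl)
    show "(\<lambda>k. r k x) \<longlonglongrightarrow> 0" for x
    proof (cases "x \<in> (\<Union>i. U i)")
      case True
      then obtain i where i: "x \<in> U i" by blast
      have "\<forall>\<^sub>F k in sequentially. r k x = 0"
        using bump_eventually[OF U i] eventually_gt_at_top[of i]
      proof eventually_elim
        case (elim k)
        have "bump (U i) k x \<le> H k x"
          unfolding H_def by (rule member_le_sum) (use elim bump_nonneg in auto)
        moreover have "f x \<le> 1" by (rule test_bounds[OF f])
        ultimately show ?case using elim by (simp add: r_def)
      qed
      then show ?thesis by (rule tendsto_eventually)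
    next
      case False
      then have "f x = 0" by (rule test_bounds(4)[OF f])
      moreover have "0 \<le> H k x" for k unfolding H_def by (intro sum_nonneg bump_nonneg)
      ultimately show ?thesis by (simp add: r_def)
    qed
  qed (rule Cr)
  show "ennreal (\<Lambda> f) \<le> (\<Sum>i. content (U i))"
  proof (rule ennreal_le_epsilon)
    fix e :: real assume "e > 0"
    then obtain k where k: "\<Lambda> (r k) < e"
      using \<open>(\<lambda>k. \<Lambda> (r k)) \<longlonglongrightarrow> 0\<close> by (metis LIMSEQ_D abs_ge_self diff_zero le_less_trans order_refl real_norm_def)
    have "\<Lambda> f \<le> \<Lambda> (\<lambda>x. H k x + r k x)" by (rule mono) (auto simp: Cf CH Cr r_def)
    also have "\<dots> = (\<Sum>i<k. \<Lambda> (bump (U i) k)) + \<Lambda> (r k)"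
      by (simp add: add CH Cr) (simp add: H_def[abs_def] sum)
    finally have "ennreal (\<Lambda> f) \<le> ennreal ((\<Sum>i<k. \<Lambda> (bump (U i) k)) + e)"
      using k by (intro ennreal_leI) simp
    also have "\<dots> = (\<Sum>i<k. ennreal (\<Lambda> (bump (U i) k))) + ennreal e"
      using \<open>e > 0\<close> by (subst ennreal_plus) (auto intro!: sum_nonneg pos bump_nonneg sum_ennreal[symmetric])
    also have "(\<Sum>i<k. ennreal (\<Lambda> (bump (U i) k))) \<le> (\<Sum>i<k. content (U i))"
      by (intro sum_mono test_upper)
         (auto simp: test_def bump_nonneg indicator_def bump_le_1 bump_outside)
    also have "\<dots> \<le> (\<Sum>i. content (U i))" by (rule sum_le_suminf) auto
    finally show "ennreal (\<Lambda> f) \<le> (\<Sum>i. content (U i)) + ennreal e"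
      by (simp add: add_right_mono)
  qed
qed

lemma outer_finite: "outer A < \<infinity>"
proof -
  have "outer A \<le> content UNIV" using outer_mono[of A UNIV] outer_open[of UNIV] by simp
  then show ?thesis by (simp add: content_UNIV le_less_trans)
qed

lemma outer_approx:
  assumes "e > 0" shows "\<exists>U. open U \<and> A \<subseteq> U \<and> content U \<le> outer A + ennreal e"
proof -
  obtain r where r: "r \<ge> 0" "outer A = ennreal r"
    using outer_finite[of A] by (cases "outer A") auto
  then have "outer A < outer A + ennreal e"
    using assms by (simp add: ennreal_plus[symmetric] ennreal_less_iff del: ennreal_plus)
  then obtain U where "open U" "A \<subseteq> U" "content U < outer A + ennreal e"
    unfolding outer_def INF_less_iff by blast
  then show ?thesis by (auto intro: less_imp_le)
qed

lemma outer_UN_le: "outer (\<Union>i. A i) \<le> (\<Sum>i. outer (A i))" for A :: "nat \<Rightarrow> 'a set"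
proof (rule ennreal_le_epsilon)
  fix e :: real assume e: "e > 0"
  have "\<exists>U. open U \<and> A i \<subseteq> U \<and> content U \<le> outer (A i) + ennreal (e * (1/2)^Suc i)" for i
    using e by (intro outer_approx) simp
  then obtain U where U: "\<And>i. open (U i)" "\<And>i. A i \<subseteq> U i"
      "\<And>i. content (U i) \<le> outer (A i) + ennreal (e * (1/2)^Suc i)" by metis
  have "outer (\<Union>i. A i) \<le> outer (\<Union>i. U i)" by (intro outer_mono UN_mono U) simp
  also have "\<dots> = content (\<Union>i. U i)" by (intro outer_open open_UN) (use U in auto)
  also have "\<dots> \<le> (\<Sum>i. content (U i))" by (rule content_UN_le[OF U(1)])
  also have "\<dots> \<le> (\<Sum>i. outer (A i) + ennreal (e * (1/2)^Suc i))"
    by (intro suminf_le U summableI)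
  also have "\<dots> = (\<Sum>i. outer (A i)) + (\<Sum>i. ennreal (e * (1/2)^Suc i))"
    by (rule suminf_add[symmetric]) auto
  also have "(\<Sum>i. ennreal (e * (1/2)^Suc i)) = ennreal e"
    using sums_mult[OF power_half_series, of e] e
    by (intro suminf_ennreal_eq) auto
  finally show "outer (\<Union>i. A i) \<le> (\<Sum>i. outer (A i)) + ennreal e" .
qed

lemma outer_measure_space: "outer_measure_space (Pow UNIV) outer"
  unfolding outer_measure_space_def
  by (auto simp: positive_def outer_open[of "{}"] content_empty increasing_def outer_mono
      countably_subadditive_def outer_UN_le)

text \<open>The half of Caratheodory's condition that is not subadditivity, for an open set
  \<open>U\<close>. Since \<open>U - V\<close> need not be open, it is enclosed in the open set
  \<open>W\<close> on which a test function \<open>f\<close> for \<open>U \<inter> V\<close> stays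
  below \<delta>. Lowering \<open>f\<close> by \<delta> makes it vanish on \<open>W\<close>, so any
  test function of \<open>W\<close> can be added to it within \<open>U\<close>.\<close>

lemma outer_split_open:
  assumes U: "open U" and V: "open V"
  shows "content (U \<inter> V) + outer (U - V) \<le> content U"
proof -
  have "ennreal (\<Lambda> f) + outer (U - V) \<le> content U" if f: "f \<in> test (U \<inter> V)" for f
  proof (rule ennreal_le_epsilon)
    fix e :: real assume e: "e > 0"
    \<comment> \<open>Lowering \<open>f\<close> by \<delta> costs at most \<delta> times the value
      of \<Lambda> at 1, which is at most \<open>e\<close>; the added 1 covers the case that this
      value is zero.\<close>
    define \<delta> where "\<delta> = e / (\<Lambda> (\<lambda>_. 1) + 1)"
    have L1: "\<Lambda> (\<lambda>_. 1) \<ge> 0" by (rule pos) auto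
    have d: "\<delta> > 0" "\<delta> * \<Lambda> (\<lambda>_. 1) \<le> e"
      using e L1 unfolding \<delta>_def by (auto simp: field_simps)
    have Cf: "Cb f" and f0: "\<And>x. 0 \<le> f x" and f1: "\<And>x. f x \<le> 1" and fo: "\<And>x. x \<notin> U \<inter> V \<Longrightarrow> f x = 0"
      by (rule test_bounds[OF f])+
    define f' where "f' x = max 0 (f x - \<delta>)" for x
    have Cf': "Cb f'" using Cf unfolding f'_def by simp
    have f'0: "0 \<le> f' x" for x by (simp add: f'_def)
    define W where "W = U - {x. f x \<ge> \<delta>}"
    have "closed {x. f x \<ge> \<delta>}" using Cf unfolding Cb_def by (intro closed_Collect_le continuous_on_const) auto
    then have W: "open W" "U - V \<subseteq> W"
      using U fo d by (auto simp: W_def intro!: open_Diff)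
    have "ennreal (\<Lambda> f') + content W \<le> content U"
      unfolding content_def[of W]
    proof (subst ennreal_SUP_add_right)
      show "test W \<noteq> {}" using zero_in_test by blast
      show "(SUP g\<in>test W. ennreal (\<Lambda> f') + ennreal (\<Lambda> g)) \<le> content U"
      proof (rule SUP_least)
        fix g assume g: "g \<in> test W"
        then have Cg: "Cb g" and g0: "\<And>x. 0 \<le> g x" and g1: "\<And>x. g x \<le> indicator W x" by (auto simp: test_def)
        have "f' x + g x \<le> indicator U x" for x
        proof (cases "f x \<ge> \<delta>")
          case True
          then have "g x = 0" using g0[of x] g1[of x] by (simp add: W_def)
          moreover have "x \<in> U" using True fo d by force
          ultimately show ?thesis using f1[of x] d by (simp add: f'_def max_def)
        next
          case False
          then show ?thesis using g1[of x] by (simp add: f'_def W_def indicator_def split: if_splits)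
        qed
        then have "(\<lambda>x. f' x + g x) \<in> test U"
          using Cb_add[OF Cf' Cg] g0 f'0 by (auto simp: test_def)
        from test_upper[OF this] show "ennreal (\<Lambda> f') + ennreal (\<Lambda> g) \<le> content U"
          using Cf' Cg g0 by (simp add: add ennreal_plus[symmetric] pos f'0 del: ennreal_plus)
      qed
    qed
    moreover have "outer (U - V) \<le> content W" using outer_mono[OF W(2)] outer_open[OF W(1)] by simp
    moreover have "ennreal (\<Lambda> f) \<le> ennreal (\<Lambda> f') + ennreal e"
    proof -
      have "\<Lambda> f \<le> \<Lambda> (\<lambda>x. f' x + \<delta> * 1)" by (rule mono) (auto simp: Cf Cf' f'_def)
      also have "\<dots> = \<Lambda> f' + \<delta> * \<Lambda> (\<lambda>_. 1)" using add[OF Cf', of "\<lambda>_. \<delta> * 1"] scale[of "\<lambda>_. 1" \<delta>] by simp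
      finally have "\<Lambda> f \<le> \<Lambda> f' + e" using d by simp
      moreover have "0 \<le> \<Lambda> f'" by (rule pos[OF Cf']) (simp add: f'_def)
      ultimately show ?thesis using e by (simp add: ennreal_plus[symmetric] ennreal_leI del: ennreal_plus)
    qed
    ultimately have "ennreal (\<Lambda> f) + outer (U - V) \<le> (ennreal (\<Lambda> f') + ennreal e) + content W"
      by (intro add_mono) auto
    also have "\<dots> = (ennreal (\<Lambda> f') + content W) + ennreal e" by (simp add: add_ac)
    also have "\<dots> \<le> content U + ennreal e" using \<open>ennreal (\<Lambda> f') + content W \<le> content U\<close> by (rule add_right_mono)
    finally show "ennreal (\<Lambda> f) + outer (U - V) \<le> content U + ennreal e" .
  qed
  then have "(SUP f\<in>test (U \<inter> V). ennreal (\<Lambda> f) + outer (U - V)) \<le> content U" by (rule SUP_least)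
  then show ?thesis
    unfolding content_def[of "U \<inter> V"]
    using zero_in_test by (subst ennreal_SUP_add_left[symmetric]) auto
qed

text \<open>\<open>outer\<close> is an infimum over open supersets, so it is enough to split open
  sets, which \<open>outer_split_open\<close> does; the other inequality is subadditivity.\<close>

lemma open_in_lambda_system:
  assumes V: "open V"
  shows "V \<in> lambda_system UNIV (Pow UNIV) outer"
proof -
  have "outer (V \<inter> A) + outer (- V \<inter> A) = outer A" for A
  proof (rule antisym)
    show "outer (V \<inter> A) + outer (- V \<inter> A) \<le> outer A"
      unfolding outer_def[of A]
    proof (rule INF_greatest)
      fix U assume "U \<in> {U. open U \<and> A \<subseteq> U}"
      then have U: "open U" "A \<subseteq> U" by auto
      have "outer (V \<inter> A) \<le> content (U \<inter> V)"
        using outer_mono[of "V \<inter> A" "U \<inter> V"] U outer_open[OF open_Int[OF U(1) V]] by auto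
      moreover have "outer (- V \<inter> A) \<le> outer (U - V)" by (rule outer_mono) (use U in auto)
      ultimately show "outer (V \<inter> A) + outer (- V \<inter> A) \<le> content U"
        using outer_split_open[OF U(1) V] by (meson add_mono order_trans)
    qed
    interpret P: sigma_algebra UNIV "Pow (UNIV :: 'a set)" by (rule sigma_algebra_Pow)
    have "subadditive (Pow UNIV) outer"
      using outer_measure_space unfolding outer_measure_space_def
      by (intro P.countably_subadditive_subadditive) auto
    then show "outer A \<le> outer (V \<inter> A) + outer (- V \<inter> A)"
      using subadditiveD[of "Pow UNIV" outer "V \<inter> A" "- V \<inter> A"] 
      by (simp add: Int_Un_distrib2[symmetric] disjoint_iff)
  qed
  then show ?thesis by (simp add: lambda_system_def Compl_eq_Diff_UNIV[symmetric])
qed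

section \<open>The representing measure and its integral\<close>

definition riesz_measure :: "'a measure" where
  "riesz_measure = measure_of UNIV (sets borel) outer"

lemma space_riesz [simp]: "space riesz_measure = UNIV"
  and sets_riesz [simp, measurable_cong]: "sets riesz_measure = sets borel"
  unfolding riesz_measure_def using sets.sigma_sets_eq[of borel] by (auto simp: space_measure_of_conv)

lemma emeasure_riesz: assumes "A \<in> sets borel" shows "emeasure riesz_measure A = outer A"
  unfolding riesz_measure_def
proof (rule emeasure_measure_of_sigma)
  interpret P: sigma_algebra UNIV "Pow (UNIV :: 'a set)" by (rule sigma_algebra_Pow)
  have ms: "measure_space UNIV (lambda_system UNIV (Pow UNIV) outer) outer"
    by (rule P.caratheodory_lemma[OF outer_measure_space])
  then interpret L: sigma_algebra UNIV "lambda_system UNIV (Pow UNIV) outer" by (simp add: measure_space_def)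
  have "sigma_sets UNIV (Collect open) \<subseteq> lambda_system UNIV (Pow UNIV) outer"
    by (rule L.sigma_sets_subset) (use open_in_lambda_system in blast)
  moreover have "sets (borel :: 'a measure) = sigma_sets UNIV (Collect open)"
    by (simp add: borel_def)
  ultimately have "sets borel \<subseteq> lambda_system UNIV (Pow UNIV) outer" by metis
  then have "measure_space UNIV (sets borel) outer"
    using measure_down[OF ms] sets.sigma_algebra_axioms[of "borel :: 'a measure"] by simp
  then show "sigma_algebra UNIV (sets (borel :: 'a measure))" "positive (sets borel) outer" "countably_additive (sets borel) outer"
    by (auto simp: measure_space_def)
qed (use assms in simp)

lemma emeasure_riesz_open: "open U \<Longrightarrow> emeasure riesz_measure U = content U"
  by (simp add: emeasure_riesz outer_open)

lemma finite_measure_riesz: "finite_measure riesz_measure"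
  by (rule finite_measureI) (simp add: emeasure_riesz_open content_UNIV)

text \<open>A layer-cake comparison. For each slice of \<open>f\<close> of height
  \<open>1 / N\<close>, the lower level set bounds its value under \<Lambda> from above, and the
  upper level set bounds its integral from below. Consecutive levels telescope and leave an error of
  at most \<open>m 0 / N\<close>.\<close>

lemma riesz_integral_unit_le:
  assumes f: "Cb f" and f0: "\<And>x. 0 \<le> f x" and f1: "\<And>x. f x \<le> 1"
  shows "\<Lambda> f \<le> (\<integral>x. f x \<partial>riesz_measure)"
proof -
  interpret finite_measure riesz_measure by (rule finite_measure_riesz)
  define m where "m t = measure riesz_measure {x. f x > t}" for t
  have op: "open {x. f x > t}" for t
    using f unfolding Cb_def by (intro open_Collect_less continuous_on_const) auto
  have tm: "\<Lambda> g \<le> m t" if "g \<in> test {x. f x > t}" for g t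
  proof -
    have "ennreal (\<Lambda> g) \<le> emeasure riesz_measure {x. f x > t}"
      using test_upper[OF that] by (simp add: emeasure_riesz_open op)
    then show ?thesis by (simp add: m_def emeasure_eq_measure)
  qed
  have ineq: "\<Lambda> f \<le> (\<integral>x. f x \<partial>riesz_measure) + m 0 / real N" if N: "N > 0" for N :: nat
  proof -
    \<comment> \<open>The slice of \<open>f\<close> between the heights \<open>i / N\<close> and
      \<open>(i + 1) / N\<close>; the slices add up to \<open>f\<close>.\<close>
    define g where "g i x = max 0 (min (1 / real N) (f x - real i / real N))" for i x
    have Cg: "Cb (g i)" for i using f unfolding g_def by simp
    have part: "(\<Sum>i<n. g i x) = min (f x) (real n / real N)" for n x
    proof (induction n)
      case (Suc n)
      have step: "min y a + max 0 (min h (y - a)) = min y (a + h)" if "h > 0" for y a h :: real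
        using that by (auto simp: min_def max_def)
      have "(\<Sum>i<Suc n. g i x) = min (f x) (real n / real N) + g n x" using Suc by simp
      also have "\<dots> = min (f x) (real n / real N + 1 / real N)" unfolding g_def by (rule step) (use N in simp)
      finally show ?case by (simp add: add_divide_distrib add.commute)
    qed (simp add: f0)
    have fsum: "f x = (\<Sum>i<N. g i x)" for x using part[where n = N and x = x] N f1[of x] by simp
    have gu: "\<Lambda> (g i) \<le> m (real i / real N) / real N" for i
    proof -
      have "0 \<le> g i x" "g i x \<le> 1 / real N" for x by (auto simp: g_def)
      then have "0 \<le> real N * g i x" "real N * g i x \<le> 1" for x
        using N mult_left_mono[of "g i x" "1 / real N" "real N"] by auto
      moreover have "g i x = 0" if "\<not> f x > real i / real N" for x using that by (simp add: g_def)
      ultimately have "(\<lambda>x. real N * g i x) \<in> test {x. f x > real i / real N}"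
        using Cg[of i] by (auto simp: test_def indicator_def)
      then have "real N * \<Lambda> (g i) \<le> m (real i / real N)" using tm scale[OF Cg] by metis
      then show ?thesis using N by (simp add: field_simps)
    qed
    have gl: "m (real (Suc i) / real N) / real N \<le> (\<integral>x. g i x \<partial>riesz_measure)" for i
    proof -
      have "(\<integral>x. indicator {x. f x > real (Suc i) / real N} x / real N \<partial>riesz_measure) \<le> (\<integral>x. g i x \<partial>riesz_measure)"
      proof (rule integral_mono)
        show "integrable riesz_measure (g i)" by (rule Cb_integrable[OF Cg finite_measure_riesz]) simp
        show "indicator {x. f x > real (Suc i) / real N} x / real N \<le> g i x" for x
          using N by (auto simp: g_def indicator_def field_simps max_def min_def)
      qed (use op[THEN borel_open] in \<open>auto intro!: integrable_real_indicator simp: less_top[symmetric] emeasure_eq_measure\<close>)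
      then show ?thesis by (simp add: m_def)
    qed
    have "\<Lambda> f = (\<Sum>i<N. \<Lambda> (g i))" using sum[of "{..<N}" g] Cg fsum by (simp add: fun_eq_iff[symmetric] fsum[abs_def])
    also have "\<dots> \<le> (\<Sum>i<N. m (real i / real N) / real N)" by (intro sum_mono gu)
    also have "\<dots> = (\<Sum>i<N. m (real (Suc i) / real N) / real N) + (m 0 / real N - m (real N / real N) / real N)"
    proof -
      have "(\<Sum>i<N. m (real (Suc i) / real N) / real N - m (real i / real N) / real N) = m (real N / real N) / real N - m (real 0 / real N) / real N"
        by (rule sum_lessThan_telescope)
      then show ?thesis by (simp add: sum_subtractf)
    qed
    also have "\<dots> \<le> (\<Sum>i<N. \<integral>x. g i x \<partial>riesz_measure) + m 0 / real N"
      using gl N by (intro add_mono sum_mono) (auto simp: m_def)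
    also have "(\<Sum>i<N. \<integral>x. g i x \<partial>riesz_measure) = (\<integral>x. f x \<partial>riesz_measure)"
      unfolding fsum by (rule Bochner_Integration.integral_sum[symmetric]) (auto intro!: Cb_integrable[OF Cg finite_measure_riesz])
    finally show ?thesis .
  qed
  have "(\<lambda>N. (\<integral>x. f x \<partial>riesz_measure) + m 0 / real (Suc N)) \<longlonglongrightarrow> (\<integral>x. f x \<partial>riesz_measure) + 0"
    by (intro tendsto_intros tendsto_divide_0[OF tendsto_const] filterlim_compose[OF filterlim_real_sequentially filterlim_Suc]
          filterlim_at_top_imp_at_infinity)
  then show ?thesis
    using ineq by (intro LIMSEQ_le_const[of _ _ "\<Lambda> f"]) (auto simp del: of_nat_Suc)
qed

theorem riesz_integral:
  assumes f: "Cb f"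
  shows "\<Lambda> f = (\<integral>x. f x \<partial>riesz_measure)"
proof -
  interpret finite_measure riesz_measure by (rule finite_measure_riesz)
  have L1: "\<Lambda> (\<lambda>_. 1) = (\<integral>x. 1 \<partial>riesz_measure)"
    using emeasure_riesz_open[of UNIV] pos[of "\<lambda>_. 1"] by (simp add: content_UNIV emeasure_eq_measure)
  have int: "integrable riesz_measure g" if "Cb g" for g :: "'a \<Rightarrow> real"
    by (rule Cb_integrable[OF that finite_measure_riesz]) simp
  have unit: "\<Lambda> g = (\<integral>x. g x \<partial>riesz_measure)" if g: "Cb g" "\<And>x. 0 \<le> g x" "\<And>x. g x \<le> 1" for g
  proof (rule antisym)
    show "\<Lambda> g \<le> (\<integral>x. g x \<partial>riesz_measure)" by (rule riesz_integral_unit_le) fact+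
    \<comment> \<open>The reverse inequality is the one already proved, for \<open>1 - g\<close>, as
      \<Lambda> and the integral agree on the constant 1.\<close>
    have "\<Lambda> (\<lambda>x. 1 - g x) \<le> (\<integral>x. 1 - g x \<partial>riesz_measure)"
      by (rule riesz_integral_unit_le) (use g in auto)
    then show "(\<integral>x. g x \<partial>riesz_measure) \<le> \<Lambda> g"
      using g int by (simp add: diff L1 Bochner_Integration.integral_diff)
  qed
  obtain C where C: "C > 0" "\<And>x. \<bar>f x\<bar> \<le> C" using Cb_boundE[OF f] by blast
  \<comment> \<open>An affine change brings \<open>f\<close> into the unit interval:
    \<open>a * f\<close> lies between -1/2 and 1/2, and \<open>b\<close> shifts it.\<close>
  define a where "a = 1 / (2 * C)"
  define b :: real where "b = 1 / 2"
  define g where "g x = a * f x + b * 1" for x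
  have Cg: "Cb g" using f unfolding g_def by (intro Cb_add Cb_cmult Cb_const)
  have "\<bar>a * f x\<bar> \<le> b" for x
    using C(1) C(2)[of x] by (simp add: a_def b_def abs_mult field_simps)
  then have g01: "0 \<le> g x" "g x \<le> 1" for x by (auto simp: g_def b_def abs_le_iff) (smt (verit) field_sum_of_halves)+
  have "\<Lambda> g = (\<integral>x. g x \<partial>riesz_measure)"
    using Cg g01 by (rule unit)
  moreover have "\<Lambda> g = a * \<Lambda> f + b * \<Lambda> (\<lambda>_. 1)"
    unfolding g_def add[OF Cb_cmult[OF f] Cb_cmult[OF Cb_const]] scale[OF f] scale[OF Cb_const] ..
  moreover have "(\<integral>x. g x \<partial>riesz_measure) = a * (\<integral>x. f x \<partial>riesz_measure) + b * (\<integral>x. 1 \<partial>riesz_measure)"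
    unfolding g_def using int[OF f] by (subst Bochner_Integration.integral_add) auto
  moreover have "a \<noteq> 0" using C by (simp add: a_def)
  ultimately show ?thesis using L1 by simp
qed

end


section \<open>Trigonometric polynomials\<close>


text \<open>A relation, because it is not clear in advance that the function determines the
  operator: the same \<open>f\<close> may arise from different expressions. That it does so on the
  vectors of interest is a consequence of \<open>trig_norm\<close>.\<close>

inductive trig_poly :: "('a::euclidean_space \<Rightarrow> 'k::chilbert_space \<Rightarrow>\<^sub>L 'k) \<Rightarrow> ('a \<Rightarrow> complex) \<Rightarrow> ('k \<Rightarrow>\<^sub>L 'k) \<Rightarrow> bool"
  for V where
  trig_char: "trig_poly V (\<lambda>p. cis (x \<bullet> p)) (V x)"
| trig_add: "trig_poly V f F \<Longrightarrow> trig_poly V g G \<Longrightarrow> trig_poly V (\<lambda>p. f p + g p) (F + G)"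
| trig_scale: "trig_poly V f F \<Longrightarrow> trig_poly V (\<lambda>p. c * f p) (op_scaleC c F)"

lemma trig_poly_continuous: "trig_poly V f F \<Longrightarrow> continuous_on UNIV f"
  by (induction rule: trig_poly.induct) (auto intro!: continuous_intros continuous_on_cis)

lemma trig_poly_bounded: "trig_poly V f F \<Longrightarrow> \<exists>C. \<forall>p. cmod (f p) \<le> C"
proof (induction rule: trig_poly.induct)
  case (trig_add f F g G)
  then obtain C D where "\<And>p. cmod (f p) \<le> C" "\<And>p. cmod (g p) \<le> D" by auto
  then show ?case by (intro exI[of _ "C + D"] allI norm_triangle_mono)
next
  case (trig_scale f F c)
  then obtain C where "\<And>p. cmod (f p) \<le> C" by auto
  then show ?case by (intro exI[of _ "cmod c * C"]) (simp add: norm_mult mult_left_mono)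
qed (auto intro: exI[of _ 1])

locale translation_rep =
  fixes V :: "'a::euclidean_space \<Rightarrow> 'k::chilbert_space \<Rightarrow>\<^sub>L 'k"
  assumes V0: "V 0 = id_blinfun" and Vadd: "V (x + y) = V x o\<^sub>L V y" and Vun: "unitary_op (V x)"
begin

lemma trig_bounded_ops: "trig_poly V f F \<Longrightarrow> F \<in> bounded_ops"
  by (induction rule: trig_poly.induct) (auto simp: unitary_op_bounded_ops Vun)

lemma trig_mult_char:
  "trig_poly V g G \<Longrightarrow> trig_poly V (\<lambda>p. cis (x \<bullet> p) * g p) (V x o\<^sub>L G)"
proof (induction rule: trig_poly.induct)
  case (trig_char y)
  then show ?case using trig_poly.trig_char[of V "x + y"]
    by (simp add: cis_mult inner_add_left Vadd)
next
  case (trig_add f F g G)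
  show ?case using trig_poly.trig_add[OF trig_add.IH] 
    by (simp add: distrib_left bounded_bilinear.add_right[OF bounded_bilinear_blinfun_compose])
next
  case (trig_scale f F c)
  have "op_scaleC c (V x o\<^sub>L F) = V x o\<^sub>L op_scaleC c F"
    by (rule blinfun_eqI) (simp add: bounded_ops_scaleC unitary_op_bounded_ops Vun)
  then show ?case using trig_poly.trig_scale[OF trig_scale.IH, of c] by (simp add: mult_ac)
qed

text \<open>Products are what Stone-Weierstrass asks for; the pairing respects them because
  \<open>V\<close> turns sums into compositions.\<close>

lemma trig_mult:
  "trig_poly V f F \<Longrightarrow> trig_poly V g G \<Longrightarrow> trig_poly V (\<lambda>p. f p * g p) (F o\<^sub>L G)"
proof (induction rule: trig_poly.induct)
  case (trig_char y)
  then show ?case by (rule trig_mult_char)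
next
  case (trig_add f F g' G')
  show ?case using trig_poly.trig_add[OF trig_add.IH(1)[OF trig_add.prems] trig_add.IH(2)[OF trig_add.prems]]
    by (simp add: distrib_right bounded_bilinear.add_left[OF bounded_bilinear_blinfun_compose])
next
  case (trig_scale f F c)
  have "op_scaleC c (F o\<^sub>L G) = op_scaleC c F o\<^sub>L G"
    by (rule blinfun_eqI) simp
  then show ?case using trig_poly.trig_scale[OF trig_scale.IH[OF trig_scale.prems], of c] by (simp add: mult_ac)
qed

lemma trig_const: "trig_poly V (\<lambda>_. c) (op_scaleC c id_blinfun)"
  using trig_scale[OF trig_char[of V 0], of c] by (simp add: V0)

definition real_trig :: "('a \<Rightarrow> real) \<Rightarrow> bool" where
  "real_trig g \<longleftrightarrow> (\<exists>G. trig_poly V (\<lambda>p. complex_of_real (g p)) G)"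

lemma real_trig_add: "real_trig f \<Longrightarrow> real_trig g \<Longrightarrow> real_trig (\<lambda>p. f p + g p)"
  unfolding real_trig_def using trig_add by (fastforce simp: of_real_add)

lemma real_trig_mult: "real_trig f \<Longrightarrow> real_trig g \<Longrightarrow> real_trig (\<lambda>p. f p * g p)"
  unfolding real_trig_def using trig_mult by (fastforce simp: of_real_mult)

lemma real_trig_const: "real_trig (\<lambda>_. c)"
  unfolding real_trig_def using trig_const by blast

lemma real_trig_diff: "real_trig f \<Longrightarrow> real_trig g \<Longrightarrow> real_trig (\<lambda>p. f p - g p)"
  using real_trig_add[OF _ real_trig_mult[OF real_trig_const[of "-1"]], of f g] by simp

lemma real_trig_cos: "real_trig (\<lambda>p. cos (x \<bullet> p))"
proof -
  have "(1/2) * (cis (x \<bullet> p) + cis ((- x) \<bullet> p)) = complex_of_real (cos (x \<bullet> p))" for p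
    by (simp add: complex_eq_iff)
  then show ?thesis unfolding real_trig_def
    using trig_scale[OF trig_add[OF trig_char[of V x] trig_char[of V "-x"]], of "1/2"] by auto
qed

lemma real_trig_sin: "real_trig (\<lambda>p. sin (x \<bullet> p))"
proof -
  have *: "(- \<i>/2) * (cis (x \<bullet> p) + (-1) * cis ((- x) \<bullet> p)) = complex_of_real (sin (x \<bullet> p))" for p
    by (simp add: complex_eq_iff)
  show ?thesis unfolding real_trig_def
    by (rule exI, rule trig_scale[OF trig_add[OF trig_char[of V x] trig_scale[OF trig_char[of V "-x"], of "-1"]],
          of "-\<i>/2", unfolded *])
qed

lemma real_trig_Cb: "real_trig g \<Longrightarrow> Cb g"
proof -
  assume "real_trig g"
  then obtain G where G: "trig_poly V (\<lambda>p. complex_of_real (g p)) G" by (auto simp: real_trig_def)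
  have "continuous_on UNIV (\<lambda>p. Re (complex_of_real (g p)))"
    by (intro continuous_intros trig_poly_continuous[OF G])
  moreover obtain C where "\<And>p. cmod (complex_of_real (g p)) \<le> C" using trig_poly_bounded[OF G] by blast
  ultimately show "Cb g" by (intro CbI[of _ C]) auto
qed

lemma real_trig_separates: assumes "p \<noteq> q" shows "\<exists>g. real_trig g \<and> g p \<noteq> g q"
proof -
  \<comment> \<open>Normalised so that the phases at \<open>p\<close> and \<open>q\<close> differ by
    exactly 1, which is not a multiple of 2 pi.\<close>
  define x where "x = (1 / ((p - q) \<bullet> (p - q))) *\<^sub>R (p - q)"
  have "x \<bullet> p - x \<bullet> q = 1"
    using assms unfolding inner_diff_right[symmetric] x_def by simp
  then have x: "x \<bullet> p = x \<bullet> q + 1" by simp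
  have "cos (x \<bullet> p) \<noteq> cos (x \<bullet> q) \<or> sin (x \<bullet> p) \<noteq> sin (x \<bullet> q)"
  proof (rule ccontr)
    assume "\<not> ?thesis"
    then have "cos (x \<bullet> p - x \<bullet> q) = 1" using sin_cos_squared_add[of "x \<bullet> q"]
      by (simp add: cos_diff power2_eq_square)
    then have "cos (1::real) = 1" using x by simp
    moreover have "cos (1::real) < cos 0" using pi_gt3 by (intro cos_monotone_0_pi) auto
    ultimately show False by simp
  qed
  then show ?thesis using real_trig_cos[of x] real_trig_sin[of x] by blast
qed

lemma real_trig_poly: "real_polynomial_function q \<Longrightarrow> real_trig g \<Longrightarrow> real_trig (\<lambda>p. q (g p))"
proof (induction rule: real_polynomial_function.induct)
  case (linear f)
  have "f t = f 1 * t" for t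
    using linear.hyps linear_simps(5)[of f t 1] by (simp add: mult.commute)
  then have "(\<lambda>p. f (g p)) = (\<lambda>p. f 1 * g p)" by (intro ext)
  then show ?case using real_trig_mult[OF real_trig_const[of "f 1"] linear.prems] by argo
qed (auto intro: real_trig_const real_trig_add real_trig_mult)

text \<open>Stone-Weierstrass gives no control outside the compact set; composing with a polynomial
  that approximates the truncation to \<open>[-B, B]\<close> does.\<close>

lemma real_trig_approx:
  assumes f: "continuous_on UNIV f" "\<And>p. \<bar>f p\<bar> \<le> B" and K: "compact K" and e: "e > 0"
  shows "\<exists>g. real_trig g \<and> (\<forall>p. \<bar>g p\<bar> \<le> B + e) \<and> (\<forall>p\<in>K. \<bar>f p - g p\<bar> < e)"
proof -
  have "\<exists>g. real_trig g \<and> (\<forall>p\<in>K. \<bar>f p - g p\<bar> < e / 2)"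
  proof (rule Stone_Weierstrass_HOL[OF K])
    show "\<And>f. real_trig f \<Longrightarrow> continuous_on K f"
      using real_trig_Cb unfolding Cb_def by (blast intro: continuous_on_subset)
    show "continuous_on K f" using f(1) by (blast intro: continuous_on_subset)
  qed (use real_trig_add real_trig_mult real_trig_const real_trig_separates e in auto)
  then obtain g where g: "real_trig g" "\<And>p. p \<in> K \<Longrightarrow> \<bar>f p - g p\<bar> < e / 2" by blast
  obtain C where C: "\<And>p. \<bar>g p\<bar> \<le> C" using Cb_boundE[OF real_trig_Cb[OF g(1)]] by blast
  define c where "c t = max (- B) (min B t)" for t
  have "B \<ge> 0" using f(2) abs_ge_zero order_trans by blast
  have "continuous_on {-C..C} c" unfolding c_def by (intro continuous_intros)
  then obtain q where q: "real_polynomial_function q" "\<And>t. t \<in> {-C..C} \<Longrightarrow> \<bar>c t - q t\<bar> < e / 2"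
    using Stone_Weierstrass_real_polynomial_function[of "{-C..C}" c "e/2"] e by auto
  have qg: "\<bar>c (g p) - q (g p)\<bar> < e / 2" for p using q(2) C[of p] by (auto simp: abs_le_iff)
  have "\<bar>q (g p)\<bar> \<le> B + e" for p
  proof -
    have "\<bar>c (g p)\<bar> \<le> B" using \<open>B \<ge> 0\<close> by (auto simp: c_def abs_le_iff)
    then show ?thesis using qg[of p] e abs_triangle_ineq2[of "q (g p)" "c (g p)"]
      by (simp add: abs_minus_commute)
  qed
  moreover have "\<bar>f p - q (g p)\<bar> < e" if "p \<in> K" for p
  proof -
    \<comment> \<open>Clamping to an interval that contains the values of \<open>f\<close> can only
      bring \<open>g\<close> nearer to \<open>f\<close>.\<close>
    have "\<bar>f p - c (g p)\<bar> \<le> \<bar>f p - g p\<bar>"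
      using f(2)[of p] unfolding c_def by (auto simp: abs_le_iff max_def min_def)
    then show ?thesis
      using g(2)[OF that] qg[of p] abs_triangle_ineq[of "f p - c (g p)" "c (g p) - q (g p)"] by simp
  qed
  ultimately show ?thesis using real_trig_poly[OF q(1) g(1)] by blast
qed

end

section \<open>Bounded Borel functions and approximation in mean square\<close>

definition bounded_borel :: "('a::topological_space \<Rightarrow> real) \<Rightarrow> bool" where
  "bounded_borel f \<longleftrightarrow> f \<in> borel_measurable borel \<and> (\<exists>C. \<forall>x. \<bar>f x\<bar> \<le> C)"

lemma bounded_borelI: "f \<in> borel_measurable borel \<Longrightarrow> (\<And>x. \<bar>f x\<bar> \<le> C) \<Longrightarrow> bounded_borel f"
  by (auto simp: bounded_borel_def)

lemma bounded_borel_add [simp]: assumes "bounded_borel f" "bounded_borel g" shows "bounded_borel (\<lambda>x. f x + g x)"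
proof -
  obtain C D where "\<And>x. \<bar>f x\<bar> \<le> C" "\<And>x. \<bar>g x\<bar> \<le> D" using assms unfolding bounded_borel_def by blast
  then show ?thesis using assms
    by (intro bounded_borelI[of _ "C + D"]) (auto simp: bounded_borel_def intro: order_trans[OF abs_triangle_ineq add_mono])
qed

lemma bounded_borel_mult [simp]: assumes "bounded_borel f" "bounded_borel g" shows "bounded_borel (\<lambda>x. f x * g x)"
proof -
  obtain C D where "\<And>x. \<bar>f x\<bar> \<le> C" "\<And>x. \<bar>g x\<bar> \<le> D" using assms unfolding bounded_borel_def by blast
  moreover from this have "C \<ge> 0" using abs_ge_zero order_trans by blast
  ultimately show ?thesis using assms
    by (intro bounded_borelI[of _ "C * D"]) (auto simp: bounded_borel_def abs_mult intro!: mult_mono)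
qed

lemma bounded_borel_const [simp]: "bounded_borel (\<lambda>_. c)"
  by (rule bounded_borelI[of _ "\<bar>c\<bar>"]) auto

lemma bounded_borel_diff [simp]: "bounded_borel f \<Longrightarrow> bounded_borel g \<Longrightarrow> bounded_borel (\<lambda>x. f x - g x)"
  using bounded_borel_add[OF _ bounded_borel_mult[OF bounded_borel_const[of "-1"]], of f g] by simp

lemma bounded_borel_power2 [simp]: "bounded_borel f \<Longrightarrow> bounded_borel (\<lambda>x. (f x)\<^sup>2)"
  unfolding power2_eq_square by simp

lemma bounded_borel_indicator [simp]: "S \<in> sets borel \<Longrightarrow> bounded_borel (indicator S)"
  by (rule bounded_borelI[of _ 1]) (auto simp: indicator_def)

lemma bounded_borel_Cb: "Cb f \<Longrightarrow> bounded_borel f"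
  using Cb_boundE Cb_measurable unfolding bounded_borel_def by metis

lemma bounded_borel_integrable:
  assumes "bounded_borel f" "finite_measure M" "sets M = sets borel"
  shows "integrable M f"
proof -
  interpret finite_measure M by fact
  obtain C where "\<And>x. \<bar>f x\<bar> \<le> C" using assms unfolding bounded_borel_def by metis
  then show ?thesis
    using assms(1) measurable_cong_sets[OF assms(3) refl, of borel] unfolding bounded_borel_def
    by (intro integrable_const_bound[of _ C]) auto
qed

lemma bounded_borel_tendsto_integral:
  assumes "\<And>n. bounded_borel (h n)" "bounded_borel f" "\<And>n x. \<bar>h n x\<bar> \<le> C" "\<And>x. (\<lambda>n. h n x) \<longlonglongrightarrow> f x"
    and M: "finite_measure M" "sets M = sets borel"
  shows "(\<lambda>n. \<integral>x. h n x \<partial>M) \<longlonglongrightarrow> (\<integral>x. f x \<partial>M)"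
proof -
  interpret finite_measure M by fact
  show ?thesis
    using assms(1-4) measurable_cong_sets[OF M(2) refl, of borel] unfolding bounded_borel_def
    by (intro integral_dominated_convergence[where w = "\<lambda>_. C"]) auto
qed

lemma square_add_le: "(a + b)\<^sup>2 \<le> 2 * a\<^sup>2 + 2 * b\<^sup>2" for a b :: real
  using zero_le_power2[of "a - b"] by (simp add: power2_eq_square algebra_simps)

lemma integral_square_add_le:
  assumes f: "bounded_borel f" and g: "bounded_borel g" and M: "finite_measure M" "sets M = sets borel"
  shows "(\<integral>p. (f p + g p)\<^sup>2 \<partial>M) \<le> 2 * (\<integral>p. (f p)\<^sup>2 \<partial>M) + 2 * (\<integral>p. (g p)\<^sup>2 \<partial>M)"
proof -
  note int = bounded_borel_integrable[OF _ M]
  have "(\<integral>p. (f p + g p)\<^sup>2 \<partial>M) \<le> (\<integral>p. 2 * (f p)\<^sup>2 + 2 * (g p)\<^sup>2 \<partial>M)"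
    using f g by (intro integral_mono int square_add_le bounded_borel_add bounded_borel_mult) auto
  also have "\<dots> = 2 * (\<integral>p. (f p)\<^sup>2 \<partial>M) + 2 * (\<integral>p. (g p)\<^sup>2 \<partial>M)"
    using f g by (subst Bochner_Integration.integral_add) (auto intro!: int bounded_borel_mult)
  finally show ?thesis .
qed

text \<open>Several finite measures at once: the approximant of an indicator has to serve a finite
  set of vectors simultaneously, so that the spectral projection can be seen to be linear.\<close>

locale trig_measures = translation_rep V for V :: "'a::euclidean_space \<Rightarrow> 'k::chilbert_space \<Rightarrow>\<^sub>L 'k" +
  fixes I :: "'i set" and M :: "'i \<Rightarrow> 'a measure"
  assumes I: "finite I" and M: "\<And>i. i \<in> I \<Longrightarrow> finite_measure (M i)" "\<And>i. i \<in> I \<Longrightarrow> sets (M i) = sets borel"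
begin

definition L2_approx :: "('a \<Rightarrow> real) \<Rightarrow> bool" where
  "L2_approx f \<longleftrightarrow> bounded_borel f \<and>
     (\<forall>e>0. \<exists>g. real_trig g \<and> (\<forall>i\<in>I. (\<integral>p. (f p - g p)\<^sup>2 \<partial>M i) < e))"

text \<open>Dominated convergence, with a constant as dominating function, in each of the finitely
  many measures. This closure property carries approximability from trigonometric polynomials to
  continuous functions and on to indicators.\<close>

lemma L2_approx_limit:
  assumes h: "\<And>n. L2_approx (h n)" and C: "\<And>n p. \<bar>h n p\<bar> \<le> C" and lim: "\<And>p. (\<lambda>n. h n p) \<longlonglongrightarrow> f p"
  shows "L2_approx f"
proof -
  have bh: "bounded_borel (h n)" for n using h unfolding L2_approx_def by blast
  have "f \<in> borel_measurable borel"
    using bh unfolding bounded_borel_def by (intro borel_measurable_LIMSEQ_real[OF lim]) auto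
  moreover have fC: "\<bar>f p\<bar> \<le> C" for p
    by (rule LIMSEQ_le_const2[OF tendsto_rabs[OF lim]]) (use C in auto)
  ultimately have bf: "bounded_borel f" by (rule bounded_borelI)
  have "\<exists>g. real_trig g \<and> (\<forall>i\<in>I. (\<integral>p. (f p - g p)\<^sup>2 \<partial>M i) < e)" if e: "e > 0" for e
  proof -
    \<comment> \<open>Quarters, because \<open>square_add_le\<close> doubles each of the two squared
      errors.\<close>
    have "\<forall>\<^sub>F n in sequentially. \<forall>i\<in>I. (\<integral>p. (f p - h n p)\<^sup>2 \<partial>M i) < e / 4"
    proof (rule eventually_ball_finite[OF I], rule ballI)
      fix i assume i: "i \<in> I"
      have "(\<lambda>n. \<integral>p. (f p - h n p)\<^sup>2 \<partial>M i) \<longlonglongrightarrow> (\<integral>p. 0 \<partial>M i)"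
      proof (rule bounded_borel_tendsto_integral[where C = "(2 * C)\<^sup>2", OF _ _ _ _ M(1,2)[OF i]])
        show "\<bar>(f p - h n p)\<^sup>2\<bar> \<le> (2 * C)\<^sup>2" for n p
        proof -
          have "\<bar>f p - h n p\<bar> \<le> \<bar>2 * C\<bar>"
            using fC[of p] C[of n p] abs_triangle_ineq4[of "f p" "h n p"] by simp
          then show ?thesis by (simp add: abs_le_square_iff)
        qed
        show "(\<lambda>n. (f p - h n p)\<^sup>2) \<longlonglongrightarrow> 0" for p
          using tendsto_power[OF tendsto_diff[OF tendsto_const lim], of "f p" p 2] by simp
      qed (use bf bh in auto)
      then show "\<forall>\<^sub>F n in sequentially. (\<integral>p. (f p - h n p)\<^sup>2 \<partial>M i) < e / 4"
        using e by (intro order_tendstoD(2)[where y = 0]) auto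
    qed
    then obtain n where n: "\<And>i. i \<in> I \<Longrightarrow> (\<integral>p. (f p - h n p)\<^sup>2 \<partial>M i) < e / 4"
      using eventually_happens'[OF sequentially_bot] by blast
    obtain g where g: "real_trig g" "\<And>i. i \<in> I \<Longrightarrow> (\<integral>p. (h n p - g p)\<^sup>2 \<partial>M i) < e / 4"
    proof -
      have "e / 4 > 0" using e by simp
      then show thesis using h[of n] that unfolding L2_approx_def by blast
    qed
    have bg: "bounded_borel g" using g(1) real_trig_Cb bounded_borel_Cb by blast
    have "(\<integral>p. (f p - g p)\<^sup>2 \<partial>M i) < e" if i: "i \<in> I" for i
    proof -
      show ?thesis
        using integral_square_add_le[OF bounded_borel_diff[OF bf bh] bounded_borel_diff[OF bh bg] M(1)[OF i] M(2)[OF i], of n n]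
          n[OF i] g(2)[OF i] by simp
    qed
    then show ?thesis using g(1) by blast
  qed
  then show ?thesis using bf unfolding L2_approx_def by blast
qed

lemma L2_approx_real_trig: "real_trig g \<Longrightarrow> L2_approx g"
  unfolding L2_approx_def using bounded_borel_Cb[OF real_trig_Cb] by (auto intro!: exI[of _ g])

lemma L2_approx_add:
  assumes f: "L2_approx f" and h: "L2_approx h" shows "L2_approx (\<lambda>p. f p + h p)"
proof -
  have bf: "bounded_borel f" and bh: "bounded_borel h" using assms unfolding L2_approx_def by auto
  have "\<exists>g. real_trig g \<and> (\<forall>i\<in>I. (\<integral>p. (f p + h p - g p)\<^sup>2 \<partial>M i) < e)" if e: "e > 0" for e
  proof -
    have "e / 4 > 0" using e by simp
    obtain g1 where g1: "real_trig g1" "\<And>i. i \<in> I \<Longrightarrow> (\<integral>p. (f p - g1 p)\<^sup>2 \<partial>M i) < e / 4"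
      using f \<open>e / 4 > 0\<close> unfolding L2_approx_def by blast
    obtain g2 where g2: "real_trig g2" "\<And>i. i \<in> I \<Longrightarrow> (\<integral>p. (h p - g2 p)\<^sup>2 \<partial>M i) < e / 4"
      using h \<open>e / 4 > 0\<close> unfolding L2_approx_def by blast
    have bg: "bounded_borel g1" "bounded_borel g2" using g1(1) g2(1) real_trig_Cb bounded_borel_Cb by auto
    have "(\<integral>p. (f p + h p - (g1 p + g2 p))\<^sup>2 \<partial>M i) < e" if i: "i \<in> I" for i
    proof -
      have eq: "(f p - g1 p) + (h p - g2 p) = f p + h p - (g1 p + g2 p)" for p by simp
      show ?thesis
        using integral_square_add_le[OF bounded_borel_diff[OF bf bg(1)] bounded_borel_diff[OF bh bg(2)] M(1)[OF i] M(2)[OF i], unfolded eq]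
          g1(2)[OF i] g2(2)[OF i] by linarith
    qed
    then show ?thesis using real_trig_add[OF g1(1) g2(1)] by blast
  qed
  then show ?thesis using bf bh unfolding L2_approx_def by auto
qed

lemma L2_approx_minus: assumes f: "L2_approx f" shows "L2_approx (\<lambda>p. - f p)"
proof -
  have bf: "bounded_borel f" using assms unfolding L2_approx_def by auto
  have "\<exists>g. real_trig g \<and> (\<forall>i\<in>I. (\<integral>p. (- f p - g p)\<^sup>2 \<partial>M i) < e)" if e: "e > 0" for e
  proof -
    obtain g where g: "real_trig g" "\<And>i. i \<in> I \<Longrightarrow> (\<integral>p. (f p - g p)\<^sup>2 \<partial>M i) < e"
      using f e unfolding L2_approx_def by blast
    have "(- f p - (0 - g p))\<^sup>2 = (f p - g p)\<^sup>2" for p by (simp add: power2_eq_square algebra_simps)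
    then show ?thesis using g real_trig_diff[OF real_trig_const[of 0] g(1)] by (intro exI[of _ "\<lambda>p. 0 - g p"]) simp
  qed
  then show ?thesis using bounded_borel_diff[OF bounded_borel_const[of 0] bf] unfolding L2_approx_def by simp
qed

text \<open>The n-th approximant is close to \<open>f\<close> only on the ball of radius n. Outside,
  its uniform bound is enough, since \<open>L2_approx_limit\<close> asks for bounded pointwise
  convergence only.\<close>

lemma L2_approx_Cb: assumes f: "Cb f" shows "L2_approx f"
proof -
  obtain B where B: "\<And>p. \<bar>f p\<bar> \<le> B" using Cb_boundE[OF f] by blast
  have "\<exists>g. real_trig g \<and> (\<forall>p. \<bar>g p\<bar> \<le> B + 1 / Suc n) \<and> (\<forall>p\<in>cball 0 (real n). \<bar>f p - g p\<bar> < 1 / Suc n)" for n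
    using f B unfolding Cb_def by (intro real_trig_approx) auto
  then obtain g where g: "\<And>n. real_trig (g n)" "\<And>n p. \<bar>g n p\<bar> \<le> B + 1 / Suc n"
      "\<And>n p. p \<in> cball 0 (real n) \<Longrightarrow> \<bar>f p - g n p\<bar> < 1 / Suc n" by metis
  show ?thesis
  proof (rule L2_approx_limit[of g "B + 1"])
    show "\<bar>g n p\<bar> \<le> B + 1" for n p
      using g(2)[of n p] by (rule order_trans) (simp add: field_simps)
    show "(\<lambda>n. g n p) \<longlonglongrightarrow> f p" for p
    proof (rule LIM_zero_cancel, rule Lim_null_comparison[of _ "\<lambda>n. 1 / Suc n"])
      obtain N :: nat where "norm p \<le> N" using real_arch_simple by blast
      then show "\<forall>\<^sub>F n in sequentially. norm (g n p - f p) \<le> 1 / Suc n"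
        using g(3)[of p] by (intro eventually_sequentiallyI[of N])
          (auto simp: abs_minus_commute dist_norm intro!: less_imp_le)
      show "(\<lambda>n. 1 / real (Suc n)) \<longlonglongrightarrow> 0" by (rule LIMSEQ_Suc[OF lim_1_over_n])
    qed
  qed (rule L2_approx_real_trig[OF g(1)])
qed

text \<open>Dynkin induction from the open sets, whose indicators are limits of bumps. Disjointness
  keeps the partial sums of indicators bounded by 1.\<close>

lemma L2_approx_indicator: assumes "S \<in> sets borel" shows "L2_approx (indicator S)"
proof -
  have "Int_stable (Collect (open :: 'a set \<Rightarrow> bool))" "Collect open \<subseteq> Pow (UNIV :: 'a set)"
    "S \<in> sigma_sets UNIV (Collect open)" using assms by (auto simp: Int_stable_def borel_def)
  then show ?thesis
  proof (induction rule: sigma_sets_induct_disjoint)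
    case (basic A)
    then show ?case
      by (intro L2_approx_limit[OF L2_approx_Cb[OF Cb_bump] _ bump_LIMSEQ, of A 1])
        (auto simp: bump_nonneg bump_le_1)
  next
    case empty
    show ?case using L2_approx_real_trig[OF real_trig_const[of 0]] by (simp add: indicator_def[abs_def])
  next
    case (compl A)
    have "(\<lambda>p. 1 + - indicator A p :: real) = indicator (UNIV - A)" by (auto simp: indicator_def fun_eq_iff)
    then show ?case
      using L2_approx_add[OF L2_approx_real_trig[OF real_trig_const[of 1]] L2_approx_minus[OF compl.IH]] by simp
  next
    case (union A)
    show ?case
    proof (rule L2_approx_limit[of "\<lambda>n p. \<Sum>i<n. indicator (A i) p" 1])
      have eq: "(\<Sum>i<n. indicator (A i) p :: real) = indicator (\<Union>i<n. A i) p" for n p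
        by (rule indicator_UN_disjoint[symmetric]) (auto intro: disjoint_family_on_mono[OF _ union.hyps(1)])
      show "\<bar>\<Sum>i<n. indicator (A i) p :: real\<bar> \<le> 1" for n p unfolding eq by (simp add: indicator_def)
      show "(\<lambda>n. \<Sum>i<n. indicator (A i) p :: real) \<longlonglongrightarrow> indicator (\<Union>i. A i) p" for p
        unfolding eq by (rule LIMSEQ_indicator_UN)
      show "L2_approx (\<lambda>p. \<Sum>i<n. indicator (A i) p)" for n
        by (induction n) (auto intro: L2_approx_add union.IH L2_approx_real_trig[OF real_trig_const])
    qed
  qed
qed

lemma real_trig_dense:
  assumes "S \<in> sets borel" "e > 0"
  obtains g where "real_trig g" "\<And>i. i \<in> I \<Longrightarrow> (\<integral>p. (indicator S p - g p)\<^sup>2 \<partial>M i) < e"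
  using L2_approx_indicator[OF assms(1)] assms(2) unfolding L2_approx_def by blast

end


section \<open>Projection-valued measures\<close>


lemma pvm_norm_square:
  assumes "pvm E" "S \<in> sets borel"
  shows "cinner \<psi> (blinfun_apply (E S) \<psi>) = complex_of_real ((norm (blinfun_apply (E S) \<psi>))\<^sup>2)"
proof -
  have E: "E S \<in> bounded_ops" "cadj (E S) = E S" "E S o\<^sub>L E S = E S" using assms unfolding pvm_def by auto
  have "cinner (blinfun_apply (E S) \<psi>) (blinfun_apply (E S) \<psi>) = cinner \<psi> (blinfun_apply (cadj (E S) o\<^sub>L E S) \<psi>)"
    by (simp add: cinner_cadj[OF E(1)])
  then show ?thesis using E by (simp add: cinner_self)
qed

text \<open>The constantly empty family is disjoint, and a series with constant terms converges only
  if they vanish.\<close>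

lemma pvm_empty: assumes "pvm E" shows "E {} = 0"
proof (rule blinfun_eqI)
  fix \<psi>
  have "(\<lambda>i::nat. blinfun_apply (E {}) \<psi>) sums blinfun_apply (E (\<Union>i::nat. {})) \<psi>"
    using assms unfolding pvm_def by (elim conjE allE[of _ "\<lambda>_. {}"]) (auto simp: disjoint_family_on_def)
  then have "(\<lambda>i::nat. blinfun_apply (E {}) \<psi>) \<longlonglongrightarrow> 0" by (intro summable_LIMSEQ_zero) (simp add: sums_iff)
  then show "blinfun_apply (E {}) \<psi> = blinfun_apply 0 \<psi>" by (simp add: LIMSEQ_const_iff)
qed

lemma
  assumes E: "pvm E"
  shows sets_pvm_measure [simp]: "sets (pvm_measure E \<psi>) = sets borel"
    and space_pvm_measure [simp]: "space (pvm_measure E \<psi>) = UNIV"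
    and emeasure_pvm_measure: "S \<in> sets borel \<Longrightarrow>
      emeasure (pvm_measure E \<psi>) S = ennreal ((norm (blinfun_apply (E S) \<psi>))\<^sup>2)"
proof -
  show "sets (pvm_measure E \<psi>) = sets borel" "space (pvm_measure E \<psi>) = UNIV"
    unfolding pvm_measure_def using sets.sigma_sets_eq[of borel] by (auto simp: space_measure_of_conv)
  define f where "f S = ennreal (Re (cinner \<psi> (blinfun_apply (E S) \<psi>)))" for S
  have f: "f S = ennreal ((norm (blinfun_apply (E S) \<psi>))\<^sup>2)" if "S \<in> sets borel" for S
    using pvm_norm_square[OF E that, of \<psi>] by (simp add: f_def)
  have "countably_additive (sets borel) f"
  proof (rule countably_additiveI)
    fix F :: "nat \<Rightarrow> 'a set"
    assume F: "range F \<subseteq> sets borel" "disjoint_family F" "(\<Union>i. F i) \<in> sets borel"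
    have "(\<lambda>i. blinfun_apply (E (F i)) \<psi>) sums blinfun_apply (E (\<Union>i. F i)) \<psi>"
      using E F unfolding pvm_def by blast
    then have "(\<lambda>i. Re (cinner \<psi> (blinfun_apply (E (F i)) \<psi>))) sums Re (cinner \<psi> (blinfun_apply (E (\<Union>i. F i)) \<psi>))"
      by (intro sums_Re bounded_linear.sums[OF bounded_bilinear.bounded_linear_right[OF bounded_bilinear_cinner]])
    then show "(\<Sum>i. f (F i)) = f (\<Union>i. F i)"
      unfolding f_def using pvm_norm_square[OF E] F(1,3)
      by (intro suminf_ennreal_eq) (auto simp: subset_iff)
  qed
  moreover have "positive (sets borel) f" by (simp add: positive_def f_def pvm_empty[OF E])
  ultimately show "emeasure (pvm_measure E \<psi>) S = ennreal ((norm (blinfun_apply (E S) \<psi>))\<^sup>2)" if "S \<in> sets borel"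
    unfolding f[OF that, symmetric] unfolding pvm_measure_def f_def
    using sets.sigma_algebra_axioms[of "borel :: 'a measure"] that
    by (intro emeasure_measure_of_sigma) auto
qed

lemma measure_pvm_measure:
  "pvm E \<Longrightarrow> S \<in> sets borel \<Longrightarrow> measure (pvm_measure E \<psi>) S = (norm (blinfun_apply (E S) \<psi>))\<^sup>2"
  unfolding measure_def by (simp add: emeasure_pvm_measure)

lemma finite_measure_pvm_measure: "pvm E \<Longrightarrow> finite_measure (pvm_measure E \<psi>)"
  by (rule finite_measureI) (simp add: emeasure_pvm_measure)

lemma pvm_measure_total: "pvm E \<Longrightarrow> measure (pvm_measure E \<psi>) UNIV = (norm \<psi>)\<^sup>2"
  by (simp add: measure_pvm_measure) (simp add: pvm_def)

text \<open>The measure \<open>pvm_measure E \<psi>\<close> depends quadratically on \<psi>, so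
  those of nearby vectors are compared through inequalities on sets; this lifts such an inequality
  to integrals.\<close>

lemma nn_integral_le_combination:
  assumes sets: "sets N\<^sub>1 = sets M" "sets N\<^sub>2 = sets M"
    and le: "\<And>S. S \<in> sets M \<Longrightarrow> emeasure M S \<le> c * emeasure N\<^sub>1 S + d * emeasure N\<^sub>2 S"
    and f: "f \<in> borel_measurable M"
  shows "(\<integral>\<^sup>+x. f x \<partial>M) \<le> c * (\<integral>\<^sup>+x. f x \<partial>N\<^sub>1) + d * (\<integral>\<^sup>+x. f x \<partial>N\<^sub>2)"
proof -
  have mN: "u \<in> borel_measurable N\<^sub>1" "u \<in> borel_measurable N\<^sub>2" if "u \<in> borel_measurable M" for u :: "'a \<Rightarrow> ennreal"
    using that by (simp_all only: measurable_cong_sets[OF sets(1) refl] measurable_cong_sets[OF sets(2) refl])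
  from f show ?thesis
  proof (induction rule: borel_measurable_induct)
    case (cong f g)
    have "space N\<^sub>1 = space M" "space N\<^sub>2 = space M" using sets sets_eq_imp_space_eq by blast+
    then have "integral\<^sup>N N\<^sub>1 f = integral\<^sup>N N\<^sub>1 g" "integral\<^sup>N N\<^sub>2 f = integral\<^sup>N N\<^sub>2 g" "integral\<^sup>N M f = integral\<^sup>N M g"
      using cong.hyps by (auto intro!: nn_integral_cong)
    then show ?case using cong.IH by simp
  next
    case (set A)
    then show ?case using le[of A] sets by simp
  next
    case (mult u a)
    show ?case
      using mult_left_mono[OF mult.IH, of a] mult.hyps mN[OF mult.hyps(2)]
      by (simp add: nn_integral_cmult distrib_left mult.left_commute)
  next
    case (add u v)
    then have um: "u \<in> borel_measurable M" and vm: "v \<in> borel_measurable M" by auto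
    have "(\<integral>\<^sup>+x. v x + u x \<partial>M) = (\<integral>\<^sup>+x. v x \<partial>M) + (\<integral>\<^sup>+x. u x \<partial>M)"
      by (rule nn_integral_add[OF vm um])
    also have "\<dots> \<le> (c * (\<integral>\<^sup>+x. v x \<partial>N\<^sub>1) + d * (\<integral>\<^sup>+x. v x \<partial>N\<^sub>2)) + (c * (\<integral>\<^sup>+x. u x \<partial>N\<^sub>1) + d * (\<integral>\<^sup>+x. u x \<partial>N\<^sub>2))"
      by (intro add_mono add.IH)
    also have "\<dots> = c * (\<integral>\<^sup>+x. v x + u x \<partial>N\<^sub>1) + d * (\<integral>\<^sup>+x. v x + u x \<partial>N\<^sub>2)"
      unfolding nn_integral_add[OF mN(1)[OF vm] mN(1)[OF um]] nn_integral_add[OF mN(2)[OF vm] mN(2)[OF um]]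
      by (simp only: distrib_left add_ac)
    finally show ?case .
  next
    case (seq U)
    have mono: "U i x \<le> (SUP i. U i x)" for i x by (rule SUP_upper) simp
    have "(\<integral>\<^sup>+x. (SUP i. U i x) \<partial>M) = (SUP i. \<integral>\<^sup>+x. U i x \<partial>M)"
      by (rule nn_integral_monotone_convergence_SUP) (use seq in auto)
    also have "\<dots> \<le> c * (\<integral>\<^sup>+x. (SUP i. U i x) \<partial>N\<^sub>1) + d * (\<integral>\<^sup>+x. (SUP i. U i x) \<partial>N\<^sub>2)"
      by (rule SUP_least, rule order_trans[OF seq.IH])
         (auto intro!: add_mono mult_left_mono nn_integral_mono mono)
    finally show ?case by (simp add: image_comp)
  qed
qed

text \<open>Young's inequality for the cross term, with a free parameter: a small \<open>t\<close>
  keeps the coefficient of the reference vector near 1 at the price of a large one on the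
  difference.\<close>

lemma norm_square_perturb:
  fixes x y :: "'a::real_normed_vector"
  assumes t: "t > 0"
  shows "(norm x)\<^sup>2 \<le> (1 + t) * (norm y)\<^sup>2 + (1 + 1 / t) * (norm (x - y))\<^sup>2"
proof -
  have "norm x \<le> norm y + norm (x - y)" by (metis add.commute diff_add_cancel norm_triangle_ineq)
  then have "(norm x)\<^sup>2 \<le> (norm y + norm (x - y))\<^sup>2" by (simp add: power_mono)
  also have "\<dots> \<le> (1 + t) * (norm y)\<^sup>2 + (1 + 1 / t) * (norm (x - y))\<^sup>2"
  proof -
    have "0 \<le> (t * norm y - norm (x - y))\<^sup>2 / t" using t by simp
    then show ?thesis using t by (simp add: power2_eq_square field_simps)
  qed
  finally show ?thesis .
qed

text \<open>\<open>norm_square_perturb\<close>, applied to E(S)\<psi> and E(S)\<phi>, holds for all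
  S with the same \<open>t\<close> and so passes to integrals.\<close>

lemma pvm_integral_perturb:
  assumes E: "pvm E" and f: "bounded_borel f" "\<And>p. 0 \<le> f p" "\<And>p. f p \<le> C" and t: "t > 0"
  shows "(\<integral>p. f p \<partial>pvm_measure E \<psi>) \<le>
    (1 + t) * (\<integral>p. f p \<partial>pvm_measure E \<phi>) + (1 + 1 / t) * (C * (norm (\<psi> - \<phi>))\<^sup>2)"
proof -
  have fm: "f \<in> borel_measurable borel" using f by (simp add: bounded_borel_def)
  then have m: "f \<in> borel_measurable (pvm_measure E \<eta>)" for \<eta>
    using measurable_cong_sets[OF sets_pvm_measure[OF E, of \<eta>] refl, of borel] by auto
  have int: "integrable (pvm_measure E \<eta>) f" for \<eta>
    by (rule bounded_borel_integrable[OF f(1) finite_measure_pvm_measure[OF E] sets_pvm_measure[OF E]])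
  have nn: "(\<integral>\<^sup>+p. ennreal (f p) \<partial>pvm_measure E \<eta>) = ennreal (\<integral>p. f p \<partial>pvm_measure E \<eta>)" for \<eta>
    using f by (intro nn_integral_eq_integral int) auto
  have "(\<integral>\<^sup>+p. ennreal (f p) \<partial>pvm_measure E \<psi>) \<le> ennreal (1 + t) * (\<integral>\<^sup>+p. ennreal (f p) \<partial>pvm_measure E \<phi>) +
      ennreal (1 + 1 / t) * (\<integral>\<^sup>+p. ennreal (f p) \<partial>pvm_measure E (\<psi> - \<phi>))"
  proof (rule nn_integral_le_combination)
    fix S assume "S \<in> sets (pvm_measure E \<psi>)"
    then have S: "S \<in> sets borel" using E by simp
    show "emeasure (pvm_measure E \<psi>) S \<le> ennreal (1 + t) * emeasure (pvm_measure E \<phi>) S +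
       ennreal (1 + 1 / t) * emeasure (pvm_measure E (\<psi> - \<phi>)) S"
      using norm_square_perturb[OF t, of "blinfun_apply (E S) \<psi>" "blinfun_apply (E S) \<phi>"] t
      unfolding emeasure_pvm_measure[OF E S]
      by (simp add: ennreal_mult[symmetric] ennreal_plus[symmetric] blinfun.diff_right ennreal_leI del: ennreal_plus)
  qed (use E m in auto)
  then have "(\<integral>p. f p \<partial>pvm_measure E \<psi>) \<le> (1 + t) * (\<integral>p. f p \<partial>pvm_measure E \<phi>) +
      (1 + 1 / t) * (\<integral>p. f p \<partial>pvm_measure E (\<psi> - \<phi>))"
    unfolding nn using t f
    by (simp add: ennreal_mult[symmetric] ennreal_plus[symmetric] integral_nonneg_AE ennreal_le_iff del: ennreal_plus)
  also have "(\<integral>p. f p \<partial>pvm_measure E (\<psi> - \<phi>)) \<le> (\<integral>p. C \<partial>pvm_measure E (\<psi> - \<phi>))"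
    using f(3) by (intro integral_mono int finite_measure.integrable_const finite_measure_pvm_measure[OF E])
  also have "(\<integral>p. C \<partial>pvm_measure E (\<psi> - \<phi>)) = C * (norm (\<psi> - \<phi>))\<^sup>2"
    using pvm_measure_total[OF E] E by simp
  finally show ?thesis using t by (simp add: mult_left_mono)
qed

lemma pvm_integral_continuous_nonneg:
  assumes E: "pvm E" and f: "bounded_borel f" "\<And>p. 0 \<le> f p" and lim: "s \<longlonglongrightarrow> \<psi>"
  shows "(\<lambda>n. \<integral>p. f p \<partial>pvm_measure E (s n)) \<longlonglongrightarrow> (\<integral>p. f p \<partial>pvm_measure E \<psi>)"
proof -
  obtain C where C: "\<And>p. f p \<le> C" using f unfolding bounded_borel_def by (auto simp: abs_le_iff)
  have C0: "C \<ge> 0" using f(2) C order_trans by blast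
  define J where "J \<phi> = (\<integral>p. f p \<partial>pvm_measure E \<phi>)" for \<phi>
  have Jb: "J \<phi> \<le> C * (norm \<phi>)\<^sup>2" "0 \<le> J \<phi>" for \<phi>
  proof -
    have "J \<phi> \<le> (\<integral>p. C \<partial>pvm_measure E \<phi>)" unfolding J_def
      using C by (intro integral_mono bounded_borel_integrable[OF f(1)] finite_measure.integrable_const
        finite_measure_pvm_measure[OF E] sets_pvm_measure[OF E])
    also have "\<dots> = C * (norm \<phi>)\<^sup>2" using pvm_measure_total[OF E] E by simp
    finally show "J \<phi> \<le> C * (norm \<phi>)\<^sup>2" .
    show "0 \<le> J \<phi>" unfolding J_def using f by (intro integral_nonneg_AE) auto
  qed
  obtain B where B: "\<And>n. norm (s n) \<le> B"
    using convergent_imp_Bseq[OF convergentI[OF lim]] unfolding Bseq_def by blast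
  have nB: "norm \<psi> \<le> B" by (rule LIMSEQ_le_const2[OF tendsto_norm[OF lim]]) (use B in auto)
  have JB: "J \<phi> \<le> C * B\<^sup>2" if "norm \<phi> \<le> B" for \<phi>
    using Jb(1)[of \<phi>] C0 that by (meson mult_left_mono norm_ge_zero order_trans power_mono)
  show ?thesis unfolding J_def[symmetric]
  proof (rule LIMSEQ_I)
    fix e :: real assume e: "e > 0"
    define K where "K = C * B\<^sup>2"
    have K: "K \<ge> 0" using C0 by (simp add: K_def)
    \<comment> \<open>Both integrals are at most \<open>K\<close>, so this \<open>t\<close> bounds
      either relative error by \<open>e / 2\<close>; the added 1 avoids division by zero.\<close>
    define t where "t = e / (2 * (K + 1))"
    have t: "t > 0" "t * (C * B\<^sup>2) \<le> e / 2" using e K by (auto simp: t_def field_simps K_def[symmetric])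
    have "(\<lambda>n. (1 + 1 / t) * (C * (norm (s n - \<psi>))\<^sup>2)) \<longlonglongrightarrow> (1 + 1 / t) * (C * (norm (\<psi> - \<psi>))\<^sup>2)"
      by (intro tendsto_intros lim)
    then have "\<forall>\<^sub>F n in sequentially. (1 + 1 / t) * (C * (norm (s n - \<psi>))\<^sup>2) < e / 2"
      using e by (intro order_tendstoD(2)) auto
    then obtain N where N: "\<And>n. n \<ge> N \<Longrightarrow> (1 + 1 / t) * (C * (norm (s n - \<psi>))\<^sup>2) < e / 2"
      unfolding eventually_sequentially by blast
    have "norm (J (s n) - J \<psi>) < e" if "n \<ge> N" for n
    proof -
      define K where "K = (1 + 1 / t) * (C * (norm (s n - \<psi>))\<^sup>2)"
      have "J (s n) \<le> J \<psi> + t * J \<psi> + K"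
        using pvm_integral_perturb[OF E f(1,2) C t(1), of "s n" \<psi>] unfolding J_def K_def by (simp add: distrib_right)
      moreover have "J \<psi> \<le> J (s n) + t * J (s n) + K"
        using pvm_integral_perturb[OF E f(1,2) C t(1), of \<psi> "s n"] unfolding J_def K_def
        by (simp add: norm_minus_commute distrib_right)
      moreover have "t * J \<psi> \<le> e / 2" "t * J (s n) \<le> e / 2"
        using JB[OF nB] JB[OF B[of n]] t by (meson less_imp_le mult_left_mono order_trans)+
      moreover have "K < e / 2" using N[OF that] by (simp add: K_def)
      ultimately show ?thesis by (simp add: abs_less_iff)
    qed
    then show "\<exists>N. \<forall>n\<ge>N. norm (J (s n) - J \<psi>) < e" by blast
  qed
qed

lemma integral_cis:
  fixes x :: "'a::euclidean_space"
  assumes "finite_measure M" "sets M = sets borel"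
  shows "(\<integral>p. cis (x \<bullet> p) \<partial>M) = Complex (\<integral>p. cos (x \<bullet> p) \<partial>M) (\<integral>p. sin (x \<bullet> p) \<partial>M)"
    and "integrable M (\<lambda>p. cis (x \<bullet> p))"
proof -
  interpret finite_measure M by fact
  have "continuous_on UNIV (\<lambda>p. cis (x \<bullet> p))" by (intro continuous_intros)
  then have "(\<lambda>p. cis (x \<bullet> p)) \<in> borel_measurable borel" by (rule borel_measurable_continuous_onI)
  then have m: "(\<lambda>p. cis (x \<bullet> p)) \<in> borel_measurable M"
    by (simp only: measurable_cong_sets[OF assms(2) refl])
  show i: "integrable M (\<lambda>p. cis (x \<bullet> p))"
    by (rule integrable_const_bound[of _ 1]) (use m in auto)
  show "(\<integral>p. cis (x \<bullet> p) \<partial>M) = Complex (\<integral>p. cos (x \<bullet> p) \<partial>M) (\<integral>p. sin (x \<bullet> p) \<partial>M)"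
    using integral_Re[OF i] integral_Im[OF i] by (simp add: complex_eq_iff)
qed

lemma bounded_borel_cos [simp]: "bounded_borel (\<lambda>p. cos (x \<bullet> p))"
  and bounded_borel_sin [simp]: "bounded_borel (\<lambda>p. sin (x \<bullet> p))" for x :: "'a::euclidean_space"
  by (rule bounded_borelI[of _ 1], intro borel_measurable_continuous_onI continuous_intros, simp)+

lemma pvm_integral_continuous:
  assumes E: "pvm E" and f: "bounded_borel f" and lim: "s \<longlonglongrightarrow> \<psi>"
  shows "(\<lambda>n. \<integral>p. f p \<partial>pvm_measure E (s n)) \<longlonglongrightarrow> (\<integral>p. f p \<partial>pvm_measure E \<psi>)"
proof -
  obtain C where C: "\<And>p. \<bar>f p\<bar> \<le> C" using f unfolding bounded_borel_def by blast
  \<comment> \<open>Adding the bound \<open>C\<close> makes the integrand nonnegative.\<close>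
  have eq: "(\<integral>p. f p \<partial>pvm_measure E \<phi>) = (\<integral>p. C + f p \<partial>pvm_measure E \<phi>) - (\<integral>p. C \<partial>pvm_measure E \<phi>)" for \<phi>
    using f by (subst Bochner_Integration.integral_add)
      (auto intro!: bounded_borel_integrable[OF _ finite_measure_pvm_measure[OF E] sets_pvm_measure[OF E]])
  have "C \<ge> 0" using C abs_ge_zero order_trans by blast
  moreover have "0 \<le> C + f p" for p using C[of p] by (simp add: abs_le_iff)
  ultimately show ?thesis unfolding eq
    using f by (intro tendsto_diff pvm_integral_continuous_nonneg[OF E _ _ lim]) auto
qed

text \<open>Both sides are continuous in \<psi>, the right one by
  \<open>pvm_integral_continuous\<close> for cosine and sine separately.\<close>

lemma pvm_cis_from_dense:
  fixes E :: "'a::euclidean_space set \<Rightarrow> 'k::chilbert_space \<Rightarrow>\<^sub>L 'k"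
  assumes E: "pvm E" and D: "closure D = UNIV"
    and eq: "\<And>\<psi>. \<psi> \<in> D \<Longrightarrow> cinner \<psi> (blinfun_apply A \<psi>) = (\<integral>p. cis (x \<bullet> p) \<partial>pvm_measure E \<psi>)"
  shows "cinner \<psi> (blinfun_apply A \<psi>) = (\<integral>p. cis (x \<bullet> p) \<partial>pvm_measure E \<psi>)"
proof -
  obtain s where s: "\<And>n. s n \<in> D" "s \<longlonglongrightarrow> \<psi>" using D closure_sequential[of \<psi> D] by auto
  have "(\<lambda>n. \<integral>p. cis (x \<bullet> p) \<partial>pvm_measure E (s n)) \<longlonglongrightarrow> (\<integral>p. cis (x \<bullet> p) \<partial>pvm_measure E \<psi>)"
    unfolding integral_cis(1)[OF finite_measure_pvm_measure[OF E] sets_pvm_measure[OF E]]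
    by (intro tendsto_Complex pvm_integral_continuous[OF E] s) auto
  moreover have "(\<lambda>n. cinner (s n) (blinfun_apply A (s n))) \<longlonglongrightarrow> cinner \<psi> (blinfun_apply A \<psi>)"
    by (intro tendsto_intros s)
  ultimately show ?thesis using s(1) eq LIMSEQ_unique by simp
qed

section \<open>Projection-valued measures from data on a dense set\<close>

lemma polarization_zero_dense:
  fixes A :: "'a::chilbert_space \<Rightarrow>\<^sub>L 'a"
  assumes D: "closure D = UNIV" and A: "A \<in> bounded_ops"
    and z: "\<And>x. x \<in> D \<Longrightarrow> cinner x (blinfun_apply A x) = 0"
  shows "A = 0"
proof (rule polarization_zero[OF A])
  show "cinner x (blinfun_apply A x) = 0" for x
    by (rule continuous_eq_on_dense[OF D, where f = "\<lambda>x. cinner x (blinfun_apply A x)" and g = "\<lambda>_. 0"])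
       (auto intro!: continuous_intros z)
qed

text \<open>The last two hypotheses make (\<psi>|E(S)\<psi>) equal to the squared norm of E(S)\<psi>
  on \<open>D\<close>. By density and polarisation E(S) is the product of its adjoint with itself,
  so it is self-adjoint and hence a projection. Additivity in S is polarised in the same way from
  that of the measures.\<close>

lemma pvmI_dense:
  fixes E :: "'a::topological_space set \<Rightarrow> 'k::chilbert_space \<Rightarrow>\<^sub>L 'k"
  assumes D: "closure D = UNIV"
    and bo: "\<And>S. S \<in> sets borel \<Longrightarrow> E S \<in> bounded_ops"
    and fin: "\<And>\<psi>. \<psi> \<in> D \<Longrightarrow> finite_measure (\<mu> \<psi>)" and sets: "\<And>\<psi>. \<psi> \<in> D \<Longrightarrow> sets (\<mu> \<psi>) = sets borel"
    and tot: "\<And>\<psi>. \<psi> \<in> D \<Longrightarrow> measure (\<mu> \<psi>) UNIV = (norm \<psi>)\<^sup>2"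
    and n: "\<And>S \<psi>. S \<in> sets borel \<Longrightarrow> \<psi> \<in> D \<Longrightarrow> (norm (blinfun_apply (E S) \<psi>))\<^sup>2 = measure (\<mu> \<psi>) S"
    and i: "\<And>S \<psi>. S \<in> sets borel \<Longrightarrow> \<psi> \<in> D \<Longrightarrow> cinner \<psi> (blinfun_apply (E S) \<psi>) = complex_of_real (measure (\<mu> \<psi>) S)"
  shows "pvm E"
proof -
  have proj: "E S = cadj (E S) o\<^sub>L E S" if S: "S \<in> sets borel" for S
  proof -
    have "E S - (cadj (E S) o\<^sub>L E S) = 0"
    proof (rule polarization_zero_dense[OF D])
      fix \<psi> assume p: "\<psi> \<in> D"
      have "cinner \<psi> (blinfun_apply (cadj (E S)) (blinfun_apply (E S) \<psi>)) = complex_of_real ((norm (blinfun_apply (E S) \<psi>))\<^sup>2)"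
        by (simp only: cinner_cadj[OF bo[OF S], symmetric] cinner_self)
      then show "cinner \<psi> (blinfun_apply (E S - (cadj (E S) o\<^sub>L E S)) \<psi>) = 0"
        using n[OF S p] i[OF S p] by (simp add: blinfun.diff_left cinner_diff_right)
    qed (simp add: bo[OF S])
    then show ?thesis by simp
  qed
  have sa: "cadj (E S) = E S" if S: "S \<in> sets borel" for S
  proof -
    have "cadj (E S) = cadj (cadj (E S) o\<^sub>L E S)" using proj[OF S] by simp
    also have "\<dots> = cadj (E S) o\<^sub>L E S" by (subst cadj_compose) (auto simp: bo[OF S])
    finally show ?thesis using proj[OF S] by simp
  qed
  have le: "norm (blinfun_apply (E S) \<psi>) \<le> norm \<psi>" if S: "S \<in> sets borel" for S \<psi>
  proof -
    have "(norm (blinfun_apply (E S) \<psi>))\<^sup>2 = cmod (cinner \<psi> (blinfun_apply (cadj (E S) o\<^sub>L E S) \<psi>))"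
      by (simp add: cinner_cadj[OF bo[OF S], symmetric] cinner_self norm_power)
    also have "\<dots> = cmod (cinner \<psi> (blinfun_apply (E S) \<psi>))" using proj[OF S] by simp
    also have "\<dots> \<le> norm \<psi> * norm (blinfun_apply (E S) \<psi>)" by (rule Cauchy_Schwarz_cinner)
    finally show ?thesis
      by (cases "blinfun_apply (E S) \<psi> = 0") (auto simp: power2_eq_square)
  qed
  have one: "E UNIV = id_blinfun"
  proof (rule blinfun_eq_on_dense[OF D])
    fix \<psi> assume p: "\<psi> \<in> D"
    have "(norm (\<psi> - blinfun_apply (E UNIV) \<psi>))\<^sup>2 = 0"
      unfolding norm_diff_square using n[OF _ p, of UNIV] i[OF _ p, of UNIV] tot[OF p] by simp
    then show "blinfun_apply (E UNIV) \<psi> = blinfun_apply id_blinfun \<psi>" by simp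
  qed
  have add: "E (S \<union> T) = E S + E T" if S: "S \<in> sets borel" and T: "T \<in> sets borel" and dis: "S \<inter> T = {}" for S T
  proof -
    have "E (S \<union> T) - (E S + E T) = 0"
    proof (rule polarization_zero_dense[OF D])
      fix \<psi> assume p: "\<psi> \<in> D"
      interpret finite_measure "\<mu> \<psi>" by (rule fin[OF p])
      have "measure (\<mu> \<psi>) (S \<union> T) = measure (\<mu> \<psi>) S + measure (\<mu> \<psi>) T"
        by (rule finite_measure_Union) (use S T sets[OF p] dis in auto)
      then show "cinner \<psi> (blinfun_apply (E (S \<union> T) - (E S + E T)) \<psi>) = 0"
        using i[OF S p] i[OF T p] i[OF sets.Un[OF S T] p]
        by (simp add: blinfun.diff_left blinfun.add_left cinner_diff_right cinner_add_right)
    qed (intro bounded_ops_diff bounded_ops_add bo sets.Un S T)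
    then show ?thesis by simp
  qed
  have ca: "(\<lambda>i. blinfun_apply (E (F i)) \<psi>) sums blinfun_apply (E (\<Union>i. F i)) \<psi>"
    if F: "range F \<subseteq> sets borel" "disjoint_family F" for F :: "nat \<Rightarrow> 'a set" and \<psi>
  proof -
    \<comment> \<open>Tails: the partial sums differ from the full value by E(R k)\<psi>, so
      countable additivity means that this tends to zero.\<close>
    define R where "R k = (\<Union>i\<in>{k..}. F i)" for k
    have Fm: "F k \<in> sets borel" and Rm: "R k \<in> sets borel" for k using F(1) by (auto simp: R_def)
    have "{k..} = insert k {Suc k..}" for k :: nat by auto
    then have Rk: "R k = F k \<union> R (Suc k)" for k
      unfolding R_def by (metis UN_insert)
    have Rd: "F k \<inter> R (Suc k) = {}" for k
      using F(2) by (auto simp: R_def disjoint_family_on_def) (metis IntI empty_iff not_less_eq_eq order_refl)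
    have step: "E (R k) = E (F k) + E (R (Suc k))" for k by (subst Rk) (rule add[OF Fm Rm Rd])
    have part: "(\<Sum>i<k. blinfun_apply (E (F i)) \<psi>) = blinfun_apply (E (\<Union>i. F i)) \<psi> - blinfun_apply (E (R k)) \<psi>" for k
    proof (induction k)
      case 0
      then show ?case by (simp add: R_def)
    next
      case (Suc k)
      then show ?case using step[of k] by (simp add: blinfun.add_left)
    qed
    have RD: "(\<lambda>k. blinfun_apply (E (R k)) \<phi>) \<longlonglongrightarrow> 0" if p: "\<phi> \<in> D" for \<phi>
    proof -
      interpret finite_measure "\<mu> \<phi>" by (rule fin[OF p])
      have "(\<lambda>k. measure (\<mu> \<phi>) (R k)) \<longlonglongrightarrow> measure (\<mu> \<phi>) (\<Inter>k. R k)"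
      proof (rule finite_Lim_measure_decseq)
        show "range R \<subseteq> sets (\<mu> \<phi>)" using Rm sets[OF p] by auto
        show "decseq R" unfolding decseq_def R_def by (intro allI impI UN_mono) auto
      qed
      moreover have "(\<Inter>k. R k) = {}"
      proof (rule ccontr)
        assume "(\<Inter>k. R k) \<noteq> {}"
        then obtain p where p: "\<And>k. p \<in> R k" by blast
        obtain a where a: "p \<in> F a" using p[of 0] by (auto simp: R_def)
        obtain b where "b \<ge> Suc a" "p \<in> F b" using p[of "Suc a"] by (auto simp: R_def)
        then show False using a F(2) disjoint_family_onD[OF F(2), of a b] by auto
      qed
      ultimately have "(\<lambda>k. sqrt ((norm (blinfun_apply (E (R k)) \<phi>))\<^sup>2)) \<longlonglongrightarrow> sqrt 0"
        by (intro tendsto_real_sqrt) (simp add: n[OF Rm p])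
      then show ?thesis by (simp add: tendsto_norm_zero_iff)
    qed
    \<comment> \<open>From vectors in \<open>D\<close>, where the measures of the tails decrease to
      zero, to all vectors, because every E(R k) has norm at most 1.\<close>
    have "(\<lambda>k. blinfun_apply (E (R k)) \<psi>) \<longlonglongrightarrow> 0"
    proof (rule LIMSEQ_I)
      fix e :: real assume e: "e > 0"
      have "\<psi> \<in> closure D" using D by simp
      then obtain \<phi> where p: "\<phi> \<in> D" "dist \<phi> \<psi> < e / 2"
        using e closure_approachable by (metis half_gt_zero)
      obtain N where N: "\<And>k. k \<ge> N \<Longrightarrow> norm (blinfun_apply (E (R k)) \<phi>) < e / 2"
        using LIMSEQ_D[OF RD[OF p(1)], of "e/2"] e by auto
      have "norm (blinfun_apply (E (R k)) \<psi>) < e" if "k \<ge> N" for k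
      proof -
        have "norm (blinfun_apply (E (R k)) \<psi>) \<le> norm (blinfun_apply (E (R k)) \<phi>) + norm (blinfun_apply (E (R k)) (\<psi> - \<phi>))"
          by (metis add.commute blinfun.diff_right diff_add_cancel norm_triangle_ineq)
        also have "\<dots> < e / 2 + e / 2"
          using N[OF that] le[OF Rm, of k "\<psi> - \<phi>"] p(2) by (simp add: dist_norm norm_minus_commute)
        finally show ?thesis by simp
      qed
      then show "\<exists>N. \<forall>k\<ge>N. norm (blinfun_apply (E (R k)) \<psi> - 0) < e" by auto
    qed
    then show ?thesis unfolding sums_def part by (auto intro: tendsto_eq_intros)
  qed
  show ?thesis
    unfolding pvm_def using bo sa proj one ca by auto
qed


section \<open>The spectral measure of a representation of translations\<close>


text \<open>The order of choices matters: first \<open>t\<close> is fixed small against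
  \<open>J\<close>, then \<open>n\<close> is taken large for that \<open>t\<close>.\<close>

lemma tendsto_norm_square_perturb:
  fixes I\<^sub>n a :: "nat \<Rightarrow> real"
  assumes le: "\<And>n t. t > 0 \<Longrightarrow> \<bar>I\<^sub>n n - J\<bar> \<le> t * J + (1 + 1 / t) * a n" and a: "a \<longlonglongrightarrow> 0" and J: "J \<ge> 0"
  shows "I\<^sub>n \<longlonglongrightarrow> J"
proof (rule LIMSEQ_I)
  fix e :: real assume e: "e > 0"
  define t where "t = e / (2 * (J + 1))"
  have t: "t > 0" "t * J \<le> e / 2" using e J by (auto simp: t_def field_simps)
  have "(\<lambda>n. (1 + 1 / t) * a n) \<longlonglongrightarrow> (1 + 1 / t) * 0" by (intro tendsto_intros a)
  then have "\<forall>\<^sub>F n in sequentially. (1 + 1 / t) * a n < e / 2"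
    using e by (intro order_tendstoD(2)) auto
  then obtain N where "\<And>n. n \<ge> N \<Longrightarrow> (1 + 1 / t) * a n < e / 2" unfolding eventually_sequentially by blast
  then show "\<exists>N. \<forall>n\<ge>N. norm (I\<^sub>n n - J) < e"
    using le[OF t(1)] t(2) by (intro exI[of _ N]) (smt (verit) field_sum_of_halves real_norm_def)
qed

lemma abs_square_diff_le:
  fixes a b d :: real
  assumes "\<bar>a - b\<bar> \<le> d" "t > 0"
  shows "\<bar>a\<^sup>2 - b\<^sup>2\<bar> \<le> t * b\<^sup>2 + (1 + 1 / t) * d\<^sup>2"
proof -
  define w where "w = a - b"
  have w: "w\<^sup>2 \<le> d\<^sup>2" using assms(1) abs_le_square_iff[of w d] by (simp add: w_def)
  have "2 * \<bar>b * w\<bar> \<le> t * b\<^sup>2 + w\<^sup>2 / t"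
  proof -
    have "0 \<le> (t * \<bar>b\<bar> - \<bar>w\<bar>)\<^sup>2 / t" using assms by simp
    then show ?thesis using assms by (simp add: power2_eq_square field_simps abs_mult)
  qed
  moreover have "a\<^sup>2 - b\<^sup>2 = 2 * (b * w) + w\<^sup>2" by (simp add: w_def power2_eq_square algebra_simps)
  ultimately have "\<bar>a\<^sup>2 - b\<^sup>2\<bar> \<le> t * b\<^sup>2 + w\<^sup>2 / t + w\<^sup>2"
    using abs_triangle_ineq[of "2 * (b * w)" "w\<^sup>2"] by simp
  also have "w\<^sup>2 / t \<le> d\<^sup>2 / t" using w assms by (simp add: divide_right_mono)
  finally show ?thesis using w by (simp add: distrib_right)
qed

text \<open>Measures are given for vectors of \<open>D\<close> only, with no stated relation between
  different vectors; everything is extracted from their Fourier transforms.\<close>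

locale dense_spectral_data = translation_rep V for V :: "'a::euclidean_space \<Rightarrow> 'k::chilbert_space \<Rightarrow>\<^sub>L 'k" +
  fixes D :: "'k set" and \<mu> :: "'k \<Rightarrow> 'a measure"
  assumes D: "complex_subspace D" "closure D = UNIV"
    and fin: "\<And>\<psi>. \<psi> \<in> D \<Longrightarrow> finite_measure (\<mu> \<psi>)" and sets: "\<And>\<psi>. \<psi> \<in> D \<Longrightarrow> sets (\<mu> \<psi>) = sets borel"
    and FT: "\<And>\<psi> x. \<psi> \<in> D \<Longrightarrow> cinner \<psi> (blinfun_apply (V x) \<psi>) = (\<integral>p. cis (x \<bullet> p) \<partial>\<mu> \<psi>)"
begin

lemma space: "\<psi> \<in> D \<Longrightarrow> space (\<mu> \<psi>) = UNIV"
  using sets_eq_imp_space_eq[OF sets] by simp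

lemma total: assumes "\<psi> \<in> D" shows "measure (\<mu> \<psi>) UNIV = (norm \<psi>)\<^sup>2"
proof -
  have "complex_of_real ((norm \<psi>)\<^sup>2) = complex_of_real (measure (\<mu> \<psi>) UNIV)"
    using FT[OF assms, of 0] space[OF assms]
    by (simp add: V0 cinner_self scaleR_conv_of_real del: of_real_power)
  then show ?thesis by (simp only: of_real_eq_iff)
qed

lemma trig_measurable: "trig_poly V f F \<Longrightarrow> f \<in> borel_measurable borel"
  by (rule borel_measurable_continuous_onI[OF trig_poly_continuous])

lemma trig_integrable:
  assumes f: "trig_poly V f F" and g: "trig_poly V g G" and p: "\<psi> \<in> D"
  shows "integrable (\<mu> \<psi>) (\<lambda>p. cnj (f p) * g p)"
proof -
  interpret finite_measure "\<mu> \<psi>" by (rule fin[OF p])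
  obtain A where A: "\<And>p. cmod (f p) \<le> A" using trig_poly_bounded[OF f] by blast
  obtain B where B: "\<And>p. cmod (g p) \<le> B" using trig_poly_bounded[OF g] by blast
  have "A \<ge> 0" using A norm_ge_zero order_trans by blast
  have "(\<lambda>p. cnj (f p) * g p) \<in> borel_measurable borel"
    by (rule borel_measurable_continuous_onI)
       (intro continuous_intros trig_poly_continuous[OF f] trig_poly_continuous[OF g])
  then have "(\<lambda>p. cnj (f p) * g p) \<in> borel_measurable (\<mu> \<psi>)"
    by (simp only: measurable_cong_sets[OF sets[OF p] refl])
  then show ?thesis
    by (rule integrable_const_bound[of _ "A * B", rotated])
       (use A B \<open>A \<ge> 0\<close> in \<open>auto simp: norm_mult intro!: mult_mono AE_I2\<close>)
qed

text \<open>Inner products of translates depend only on the difference of the translations, so the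
  Fourier transform of a single measure governs the whole orbit of \<psi>.\<close>

lemma trig_gram_char:
  assumes p: "\<psi> \<in> D"
  shows "trig_poly V g G \<Longrightarrow> cinner (blinfun_apply (V x) \<psi>) (blinfun_apply G \<psi>) = (\<integral>p. cnj (cis (x \<bullet> p)) * g p \<partial>\<mu> \<psi>)"
proof (induction rule: trig_poly.induct)
  case (trig_char y)
  have "blinfun_apply (V y) \<psi> = blinfun_apply (V x) (blinfun_apply (V (y - x)) \<psi>)"
    using Vadd[of x "y - x"] by simp
  then have "cinner (blinfun_apply (V x) \<psi>) (blinfun_apply (V y) \<psi>) = (\<integral>p. cis ((y - x) \<bullet> p) \<partial>\<mu> \<psi>)"
    using FT[OF p, of "y - x"] by (simp add: unitary_op_cinner Vun)
  also have "(\<lambda>p. cis ((y - x) \<bullet> p)) = (\<lambda>p. cnj (cis (x \<bullet> p)) * cis (y \<bullet> p))"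
    by (simp add: cis_cnj cis_mult inner_diff_left)
  finally show ?case .
next
  case (trig_add f F g G)
  then show ?case
    by (simp add: blinfun.add_left cinner_add_right distrib_left
        Bochner_Integration.integral_add trig_integrable[OF trig_poly.trig_char _ p])
next
  case (trig_scale f F c)
  then show ?case by (simp add: cinner_scaleC_right mult.left_commute)
qed

lemma trig_gram:
  assumes p: "\<psi> \<in> D" and g: "trig_poly V g G"
  shows "trig_poly V f F \<Longrightarrow> cinner (blinfun_apply F \<psi>) (blinfun_apply G \<psi>) = (\<integral>p. cnj (f p) * g p \<partial>\<mu> \<psi>)"
proof (induction rule: trig_poly.induct)
  case (trig_char y)
  show ?case by (rule trig_gram_char[OF p g])
next
  case (trig_add f F h H)
  then show ?case
    by (simp add: blinfun.add_left cinner_add_left distrib_right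
        Bochner_Integration.integral_add trig_integrable[OF _ g p])
next
  case (trig_scale f F c)
  then show ?case by (simp add: cinner_scaleC_left mult.assoc)
qed

lemma trig_diff: "trig_poly V f F \<Longrightarrow> trig_poly V g G \<Longrightarrow> trig_poly V (\<lambda>p. f p - g p) (F - G)"
proof -
  assume f: "trig_poly V f F" and g: "trig_poly V g G"
  have "op_scaleC (-1) G = - G" by (rule blinfun_eqI) (simp add: scaleC_minus_one blinfun.minus_left)
  then show ?thesis using trig_add[OF f trig_scale[OF g, of "-1"]] by simp
qed

lemma trig_norm:
  assumes p: "\<psi> \<in> D" and f: "trig_poly V f F"
  shows "(norm (blinfun_apply F \<psi>))\<^sup>2 = (\<integral>p. (cmod (f p))\<^sup>2 \<partial>\<mu> \<psi>)"
proof -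
  have "cnj (f p) * f p = complex_of_real ((cmod (f p))\<^sup>2)" for p
    using complex_norm_square[of "f p"] by (simp add: mult.commute)
  then have "complex_of_real ((norm (blinfun_apply F \<psi>))\<^sup>2) = complex_of_real (\<integral>p. (cmod (f p))\<^sup>2 \<partial>\<mu> \<psi>)"
    using trig_gram[OF p f f] by (simp add: cinner_self del: of_real_power)
  then show ?thesis using of_real_eq_iff by blast
qed

text \<open>\<open>spectral S \<psi> \<eta>\<close> says \<open>\<eta> = E(S)\<psi>\<close>: the distance of \<open>\<eta>\<close> to \<open>f(P)\<psi>\<close> is the
  \<open>L\<^sup>2\<close>-distance of the indicator of \<open>S\<close> to \<open>f\<close>.\<close>

definition spectral :: "'a set \<Rightarrow> 'k \<Rightarrow> 'k \<Rightarrow> bool" where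
  "spectral S \<psi> \<eta> \<longleftrightarrow> (\<forall>f F. trig_poly V f F \<longrightarrow>
     (norm (\<eta> - blinfun_apply F \<psi>))\<^sup>2 = (\<integral>p. (cmod (complex_of_real (indicator S p) - f p))\<^sup>2 \<partial>\<mu> \<psi>))"

text \<open>Every approximating sequence leads to \<eta>, not just the one that produced it. So any
  convenient common sequence may be used to compare several vectors.\<close>

lemma spectral_tendsto:
  assumes "spectral S \<psi> \<eta>" and g: "\<And>n. trig_poly V (\<lambda>p. complex_of_real (g n p)) (G n)"
    and a: "(\<lambda>n. \<integral>p. (indicator S p - g n p)\<^sup>2 \<partial>\<mu> \<psi>) \<longlonglongrightarrow> 0"
  shows "(\<lambda>n. blinfun_apply (G n) \<psi>) \<longlonglongrightarrow> \<eta>"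
proof -
  have "(norm (\<eta> - blinfun_apply (G n) \<psi>))\<^sup>2 = (\<integral>p. (indicator S p - g n p)\<^sup>2 \<partial>\<mu> \<psi>)" for n
    using assms(1) g[of n] unfolding spectral_def by (auto simp: of_real_diff[symmetric] simp del: of_real_diff)
  then have "(\<lambda>n. sqrt ((norm (\<eta> - blinfun_apply (G n) \<psi>))\<^sup>2)) \<longlonglongrightarrow> sqrt 0"
    using a by (intro tendsto_real_sqrt) simp
  then have "(\<lambda>n. norm (blinfun_apply (G n) \<psi> - \<eta>)) \<longlonglongrightarrow> 0" by (simp add: norm_minus_commute)
  then show ?thesis by (simp add: LIM_zero_cancel tendsto_norm_zero_iff)
qed

lemma real_trig_bounded_borel: "trig_poly V (\<lambda>p. complex_of_real (g p)) G \<Longrightarrow> bounded_borel g"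
  using real_trig_Cb bounded_borel_Cb unfolding real_trig_def by blast

text \<open>By the isometry the vectors \<open>G n\<close> \<psi> form a Cauchy sequence. Their
  limit has the right distance to every other \<open>F\<close> \<psi>, because replacing
  \<open>g n\<close> by the indicator changes the squared L2 distance to \<open>f\<close> by an
  amount that tends to zero.\<close>

lemma spectral_limit:
  assumes p: "\<psi> \<in> D" and S: "S \<in> sets borel" and g: "\<And>n. trig_poly V (\<lambda>p. complex_of_real (g n p)) (G n)"
    and a: "(\<lambda>n. \<integral>p. (indicator S p - g n p)\<^sup>2 \<partial>\<mu> \<psi>) \<longlonglongrightarrow> 0"
  shows "\<exists>\<eta>. spectral S \<psi> \<eta>"
proof -
  note int = bounded_borel_integrable[OF _ fin[OF p] sets[OF p]]
  have bg: "bounded_borel (g n)" for n by (rule real_trig_bounded_borel[OF g])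
  have bS: "bounded_borel (indicator S :: 'a \<Rightarrow> real)" using S by simp
  define a' where "a' n = (\<integral>p. (indicator S p - g n p)\<^sup>2 \<partial>\<mu> \<psi>)" for n
  have dist: "(norm (blinfun_apply (G m) \<psi> - blinfun_apply (G n) \<psi>))\<^sup>2 \<le> 2 * a' m + 2 * a' n" for m n
  proof -
    have "(norm (blinfun_apply (G m) \<psi> - blinfun_apply (G n) \<psi>))\<^sup>2 = (\<integral>p. (g m p - g n p)\<^sup>2 \<partial>\<mu> \<psi>)"
      using trig_norm[OF p trig_diff[OF g[of m] g[of n]]]
      by (simp add: blinfun.diff_left of_real_diff[symmetric] del: of_real_diff)
    \<comment> \<open>The indicator of \<open>S\<close> is inserted between the two
      polynomials.\<close>
    also have "\<dots> \<le> 2 * a' m + 2 * a' n"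
      using integral_square_add_le[OF bounded_borel_diff[OF bg bS] bounded_borel_diff[OF bS bg] fin[OF p] sets[OF p], of m n]
      by (simp add: a'_def power2_commute[of "g m _"])
    finally show ?thesis .
  qed
  have "Cauchy (\<lambda>n. blinfun_apply (G n) \<psi>)"
  proof (rule metric_CauchyI)
    fix e :: real assume e: "e > 0"
    then have "\<forall>\<^sub>F n in sequentially. a' n < e\<^sup>2 / 4"
      using a unfolding a'_def by (intro order_tendstoD(2)[where y = 0]) auto
    then obtain N where N: "\<And>n. n \<ge> N \<Longrightarrow> a' n < e\<^sup>2 / 4" unfolding eventually_sequentially by blast
    have "dist (blinfun_apply (G m) \<psi>) (blinfun_apply (G n) \<psi>) < e" if "m \<ge> N" "n \<ge> N" for m n
    proof -
      have "(norm (blinfun_apply (G m) \<psi> - blinfun_apply (G n) \<psi>))\<^sup>2 < e\<^sup>2"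
        using dist[of m n] N[OF that(1)] N[OF that(2)] by simp
      then show ?thesis using e by (simp add: dist_norm power2_less_imp_less)
    qed
    then show "\<exists>M. \<forall>m\<ge>M. \<forall>n\<ge>M. dist (blinfun_apply (G m) \<psi>) (blinfun_apply (G n) \<psi>) < e" by blast
  qed
  then obtain \<eta> where \<eta>: "(\<lambda>n. blinfun_apply (G n) \<psi>) \<longlonglongrightarrow> \<eta>"
    using Cauchy_convergent_iff convergent_def by blast
  have "spectral S \<psi> \<eta>" unfolding spectral_def
  proof (intro allI impI)
    fix f F assume f: "trig_poly V f F"
    define u where "u n p = cmod (complex_of_real (g n p) - f p)" for n p
    define v where "v p = cmod (complex_of_real (indicator S p) - f p)" for p
    obtain B where B: "\<And>p. cmod (f p) \<le> B" using trig_poly_bounded[OF f] by blast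
    have bu: "bounded_borel (\<lambda>p. cmod (complex_of_real (h p) - f p))" if h: "bounded_borel h" for h
    proof -
      obtain C where "\<And>p. \<bar>h p\<bar> \<le> C" using h unfolding bounded_borel_def by blast
      then show ?thesis using h trig_measurable[OF f] B unfolding bounded_borel_def
        by (auto intro!: exI[of _ "C + B"] order_trans[OF norm_triangle_ineq4] add_mono)
    qed
    have "(\<lambda>n. \<integral>p. (u n p)\<^sup>2 \<partial>\<mu> \<psi>) \<longlonglongrightarrow> (\<integral>p. (v p)\<^sup>2 \<partial>\<mu> \<psi>)"
    proof (rule tendsto_norm_square_perturb[where a = a'])
      fix n and t :: real assume t: "t > 0"
      have "\<bar>(\<integral>p. (u n p)\<^sup>2 \<partial>\<mu> \<psi>) - (\<integral>p. (v p)\<^sup>2 \<partial>\<mu> \<psi>)\<bar> = \<bar>\<integral>p. (u n p)\<^sup>2 - (v p)\<^sup>2 \<partial>\<mu> \<psi>\<bar>"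
        unfolding u_def v_def
        by (subst Bochner_Integration.integral_diff) (auto intro!: int bounded_borel_power2 bu bg bS)
      also have "\<dots> \<le> (\<integral>p. \<bar>(u n p)\<^sup>2 - (v p)\<^sup>2\<bar> \<partial>\<mu> \<psi>)" by (rule integral_abs_bound)
      also have "\<dots> \<le> (\<integral>p. t * (v p)\<^sup>2 + (1 + 1 / t) * (indicator S p - g n p)\<^sup>2 \<partial>\<mu> \<psi>)"
      proof (rule integral_mono)
        show "\<bar>(u n p)\<^sup>2 - (v p)\<^sup>2\<bar> \<le> t * (v p)\<^sup>2 + (1 + 1 / t) * (indicator S p - g n p)\<^sup>2" for p
        proof -
          have "\<bar>u n p - v p\<bar> \<le> cmod ((complex_of_real (g n p) - f p) - (complex_of_real (indicator S p) - f p))"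
            unfolding u_def v_def by (rule norm_triangle_ineq3)
          also have "\<dots> = \<bar>indicator S p - g n p\<bar>"
            by (simp add: of_real_diff[symmetric] abs_minus_commute del: of_real_diff)
          finally show ?thesis using abs_square_diff_le[OF _ t] by (metis power2_abs)
        qed
        show "integrable (\<mu> \<psi>) (\<lambda>p. \<bar>(u n p)\<^sup>2 - (v p)\<^sup>2\<bar>)"
          unfolding u_def v_def
          by (intro integrable_abs Bochner_Integration.integrable_diff int bounded_borel_power2 bu bg bS)
        show "integrable (\<mu> \<psi>) (\<lambda>p. t * (v p)\<^sup>2 + (1 + 1 / t) * (indicator S p - g n p)\<^sup>2)"
          unfolding v_def by (intro int bounded_borel_add bounded_borel_mult bounded_borel_const bounded_borel_power2
              bounded_borel_diff bu bg bS)
      qed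
      also have "\<dots> = t * (\<integral>p. (v p)\<^sup>2 \<partial>\<mu> \<psi>) + (1 + 1 / t) * a' n"
        unfolding a'_def v_def
        by (subst Bochner_Integration.integral_add)
           (auto intro!: int bounded_borel_mult bounded_borel_power2 bu bg bS bounded_borel_diff)
      finally show "\<bar>(\<integral>p. (u n p)\<^sup>2 \<partial>\<mu> \<psi>) - (\<integral>p. (v p)\<^sup>2 \<partial>\<mu> \<psi>)\<bar> \<le> t * (\<integral>p. (v p)\<^sup>2 \<partial>\<mu> \<psi>) + (1 + 1 / t) * a' n" .
    qed (use a in \<open>auto simp: a'_def[abs_def]\<close>)
    moreover have "(\<integral>p. (u n p)\<^sup>2 \<partial>\<mu> \<psi>) = (norm (blinfun_apply (G n) \<psi> - blinfun_apply F \<psi>))\<^sup>2" for n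
      using trig_norm[OF p trig_diff[OF g[of n] f]] by (simp add: u_def blinfun.diff_left)
    moreover have "(\<lambda>n. (norm (blinfun_apply (G n) \<psi> - blinfun_apply F \<psi>))\<^sup>2) \<longlonglongrightarrow> (norm (\<eta> - blinfun_apply F \<psi>))\<^sup>2"
      by (intro tendsto_intros \<eta>)
    ultimately show "(norm (\<eta> - blinfun_apply F \<psi>))\<^sup>2 = (\<integral>p. (cmod (complex_of_real (indicator S p) - f p))\<^sup>2 \<partial>\<mu> \<psi>)"
      unfolding v_def using LIMSEQ_unique by simp
  qed
  then show ?thesis by blast
qed

lemma approx_sequence:
  assumes S: "S \<in> sets borel" and A: "finite A" "A \<subseteq> D"
  shows "\<exists>g G. (\<forall>n::nat. trig_poly V (\<lambda>p. complex_of_real (g n p)) (G n)) \<and>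
    (\<forall>\<psi>\<in>A. (\<lambda>n. \<integral>p. (indicator S p - g n p)\<^sup>2 \<partial>\<mu> \<psi>) \<longlonglongrightarrow> 0)"
proof -
  interpret trig_measures V A \<mu>
    by (intro trig_measures.intro trig_measures_axioms.intro translation_rep_axioms)
       (simp_all add: A(1) fin sets subsetD[OF A(2)])
  have "\<exists>g G. trig_poly V (\<lambda>p. complex_of_real (g p)) G \<and> (\<forall>\<psi>\<in>A. (\<integral>p. (indicator S p - g p)\<^sup>2 \<partial>\<mu> \<psi>) < 1 / Suc n)" for n
  proof -
    have "1 / real (Suc n) > 0" by simp
    then obtain g where "real_trig g" "\<And>\<psi>. \<psi> \<in> A \<Longrightarrow> (\<integral>p. (indicator S p - g p)\<^sup>2 \<partial>\<mu> \<psi>) < 1 / Suc n"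
      using real_trig_dense[OF S] by blast
    then show ?thesis unfolding real_trig_def by blast
  qed
  then obtain g G where g: "\<And>n. trig_poly V (\<lambda>p. complex_of_real (g n p)) (G n)"
    "\<And>n \<psi>. \<psi> \<in> A \<Longrightarrow> (\<integral>p. (indicator S p - g n p)\<^sup>2 \<partial>\<mu> \<psi>) < 1 / Suc n" by metis
  have "(\<lambda>n::nat. \<integral>p. (indicator S p - g n p)\<^sup>2 \<partial>\<mu> \<psi>) \<longlonglongrightarrow> 0" if "\<psi> \<in> A" for \<psi>
  proof (rule tendsto_sandwich[OF _ _ tendsto_const LIMSEQ_Suc[OF lim_1_over_n]])
    show "\<forall>\<^sub>F n in sequentially. 0 \<le> (\<integral>p. (indicator S p - g n p)\<^sup>2 \<partial>\<mu> \<psi>)" by simp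
    show "\<forall>\<^sub>F n in sequentially. (\<integral>p. (indicator S p - g n p)\<^sup>2 \<partial>\<mu> \<psi>) \<le> 1 / real (Suc n)"
      using g(2)[OF that] by (intro always_eventually allI less_imp_le) auto
  qed
  then show ?thesis using g(1) by blast
qed

definition spec :: "'a set \<Rightarrow> 'k \<Rightarrow> 'k" where
  "spec S \<psi> = (SOME \<eta>. spectral S \<psi> \<eta>)"

lemma spectral_spec: assumes "S \<in> sets borel" "\<psi> \<in> D" shows "spectral S \<psi> (spec S \<psi>)"
proof -
  have "finite {\<psi>}" "{\<psi>} \<subseteq> D" using assms(2) by auto
  from approx_sequence[OF assms(1) this]
  obtain g G where "\<forall>n::nat. trig_poly V (\<lambda>p. complex_of_real (g n p)) (G n)"
    "\<forall>\<psi>\<in>{\<psi>}. (\<lambda>n. \<integral>p. (indicator S p - g n p)\<^sup>2 \<partial>\<mu> \<psi>) \<longlonglongrightarrow> 0" by blast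
  note g = this[rule_format]
  have "\<exists>\<eta>. spectral S \<psi> \<eta>" by (rule spectral_limit[OF assms(2,1) g(1) g(2)]) simp
  then show ?thesis unfolding spec_def by (rule someI_ex[of "spectral S \<psi>"])
qed

text \<open>One sequence of operators has all three vectors as limits, and each of these operators
  is additive.\<close>

lemma spec_add:
  assumes S: "S \<in> sets borel" and p: "\<psi> \<in> D" "\<phi> \<in> D"
  shows "spec S (\<psi> + \<phi>) = spec S \<psi> + spec S \<phi>"
proof -
  have s: "\<psi> + \<phi> \<in> D" using D(1) p by (simp add: complex_subspace_def)
  have "finite {\<psi>, \<phi>, \<psi> + \<phi>}" "{\<psi>, \<phi>, \<psi> + \<phi>} \<subseteq> D" using p s by auto
  from approx_sequence[OF S this]
  obtain g G where "\<forall>n::nat. trig_poly V (\<lambda>p. complex_of_real (g n p)) (G n)"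
    "\<forall>\<eta>\<in>{\<psi>, \<phi>, \<psi> + \<phi>}. (\<lambda>n. \<integral>p. (indicator S p - g n p)\<^sup>2 \<partial>\<mu> \<eta>) \<longlonglongrightarrow> 0" by blast
  note g = this[rule_format]
  have lim: "(\<lambda>n. blinfun_apply (G n) \<eta>) \<longlonglongrightarrow> spec S \<eta>" if "\<eta> \<in> {\<psi>, \<phi>, \<psi> + \<phi>}" for \<eta>
    using that p s by (intro spectral_tendsto[OF spectral_spec[OF S] g(1) g(2)]) auto
  have "(\<lambda>n. blinfun_apply (G n) \<psi> + blinfun_apply (G n) \<phi>) \<longlonglongrightarrow> spec S \<psi> + spec S \<phi>"
    by (intro tendsto_add lim) auto
  then show ?thesis using lim[of "\<psi> + \<phi>"] LIMSEQ_unique by (simp add: blinfun.add_right) blast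
qed

lemma spec_scaleC:
  assumes S: "S \<in> sets borel" and p: "\<psi> \<in> D"
  shows "spec S (c *\<^sub>C \<psi>) = c *\<^sub>C spec S \<psi>"
proof -
  have s: "c *\<^sub>C \<psi> \<in> D" using D(1) p by (simp add: complex_subspace_def)
  have "finite {\<psi>, c *\<^sub>C \<psi>}" "{\<psi>, c *\<^sub>C \<psi>} \<subseteq> D" using p s by auto
  from approx_sequence[OF S this]
  obtain g G where "\<forall>n::nat. trig_poly V (\<lambda>p. complex_of_real (g n p)) (G n)"
    "\<forall>\<eta>\<in>{\<psi>, c *\<^sub>C \<psi>}. (\<lambda>n. \<integral>p. (indicator S p - g n p)\<^sup>2 \<partial>\<mu> \<eta>) \<longlonglongrightarrow> 0" by blast
  note g = this[rule_format]
  have lim: "(\<lambda>n. blinfun_apply (G n) \<eta>) \<longlonglongrightarrow> spec S \<eta>" if "\<eta> \<in> {\<psi>, c *\<^sub>C \<psi>}" for \<eta>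
    using that p s by (intro spectral_tendsto[OF spectral_spec[OF S] g(1) g(2)]) auto
  have "(\<lambda>n. c *\<^sub>C blinfun_apply (G n) \<psi>) \<longlonglongrightarrow> c *\<^sub>C spec S \<psi>"
    by (intro bounded_linear.tendsto[OF bounded_linear_scaleC] lim) auto
  then show ?thesis using lim[of "c *\<^sub>C \<psi>"] LIMSEQ_unique
    by (simp add: bounded_ops_scaleC[OF trig_bounded_ops[OF g(1)]]) blast
qed

lemma
  assumes S: "S \<in> sets borel" and p: "\<psi> \<in> D"
  shows spec_norm: "(norm (spec S \<psi>))\<^sup>2 = measure (\<mu> \<psi>) S"
    and spec_cinner: "cinner \<psi> (spec S \<psi>) = complex_of_real (measure (\<mu> \<psi>) S)"
proof -
  interpret finite_measure "\<mu> \<psi>" by (rule fin[OF p])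
  note int = bounded_borel_integrable[OF _ fin[OF p] sets[OF p]]
  \<comment> \<open>Constants are trigonometric polynomials; the values 0, 1 and \<i> of
    \<open>c\<close> yield the norm and the real and imaginary parts of the inner product.\<close>
  have c: "(norm (spec S \<psi> - c *\<^sub>C \<psi>))\<^sup>2 = (\<integral>p. (cmod (complex_of_real (indicator S p) - c))\<^sup>2 \<partial>\<mu> \<psi>)" for c
    using spectral_spec[OF S p] trig_const[of c] unfolding spectral_def by fastforce
  have m: "(\<integral>p. indicator S p \<partial>\<mu> \<psi>) = measure (\<mu> \<psi>) S" using sets[OF p] S by (simp add: space[OF p])
  have intS: "integrable (\<mu> \<psi>) (\<lambda>p. a * indicator S p :: real)" for a using S by (intro int bounded_borel_mult) auto
  have "(\<integral>p. (cmod (complex_of_real (indicator S p) - 0))\<^sup>2 \<partial>\<mu> \<psi>) = (\<integral>p. indicator S p \<partial>\<mu> \<psi>)"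
    by (rule Bochner_Integration.integral_cong) (auto simp: indicator_def)
  then show n: "(norm (spec S \<psi>))\<^sup>2 = measure (\<mu> \<psi>) S" using c[of 0] scaleC_of_real[of 0 \<psi>] m by simp
  have "(\<integral>p. (cmod (complex_of_real (indicator S p) - 1))\<^sup>2 \<partial>\<mu> \<psi>) = (\<integral>p. 1 - 1 * indicator S p \<partial>\<mu> \<psi>)"
    by (rule Bochner_Integration.integral_cong) (auto simp: indicator_def)
  also have "\<dots> = (norm \<psi>)\<^sup>2 - measure (\<mu> \<psi>) S"
    using intS[of 1] by (subst Bochner_Integration.integral_diff) (auto simp: m space[OF p] total[OF p])
  finally have "(norm (spec S \<psi> - \<psi>))\<^sup>2 = (norm \<psi>)\<^sup>2 - measure (\<mu> \<psi>) S" using c[of 1] by simp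
  then have re: "Re (cinner (spec S \<psi>) \<psi>) = measure (\<mu> \<psi>) S" unfolding norm_diff_square n by simp
  have "(\<integral>p. (cmod (complex_of_real (indicator S p) - \<i>))\<^sup>2 \<partial>\<mu> \<psi>) = (\<integral>p. 1 + 1 * indicator S p \<partial>\<mu> \<psi>)"
    by (rule Bochner_Integration.integral_cong) (auto simp: indicator_def cmod_power2)
  also have "\<dots> = (norm \<psi>)\<^sup>2 + measure (\<mu> \<psi>) S"
    using intS[of 1] by (subst Bochner_Integration.integral_add) (auto simp: m space[OF p] total[OF p])
  finally have "(norm (spec S \<psi> - \<i> *\<^sub>C \<psi>))\<^sup>2 = (norm \<psi>)\<^sup>2 + measure (\<mu> \<psi>) S" using c[of \<i>] by simp
  then have im: "Im (cinner (spec S \<psi>) \<psi>) = 0"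
    unfolding norm_diff_square n by (simp add: norm_scaleC cinner_scaleC_right)
  have "cinner (spec S \<psi>) \<psi> = complex_of_real (measure (\<mu> \<psi>) S)" using re im by (simp add: complex_eq_iff)
  then show "cinner \<psi> (spec S \<psi>) = complex_of_real (measure (\<mu> \<psi>) S)"
    by (metis cinner_commute complex_cnj_complex_of_real)
qed

text \<open>The last clause transports common null sets of the \<mu>_\<psi> to \<open>E\<close>;
  this is how the support in the cone will be found.\<close>

theorem spectral_measure_exists:
  "\<exists>E. pvm E \<and> (\<forall>x \<psi>. cinner \<psi> (blinfun_apply (V x) \<psi>) = (\<integral>p. cis (x \<bullet> p) \<partial>pvm_measure E \<psi>)) \<and>
    (\<forall>S\<in>sets borel. (\<forall>\<psi>\<in>D. measure (\<mu> \<psi>) S = 0) \<longrightarrow> E S = 0)"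
proof -
  have "\<exists>F\<in>bounded_ops. \<forall>\<psi>\<in>D. blinfun_apply F \<psi> = spec S \<psi>" if S: "S \<in> sets borel" for S
  proof (rule operator_extension[OF D, where C = 1])
    fix \<psi> assume p: "\<psi> \<in> D"
    interpret finite_measure "\<mu> \<psi>" by (rule fin[OF p])
    have "(norm (spec S \<psi>))\<^sup>2 \<le> (norm \<psi>)\<^sup>2"
      unfolding spec_norm[OF S p] total[OF p, symmetric] using bounded_measure[of S] space[OF p] by simp
    then have "norm (spec S \<psi>) \<le> norm \<psi>" by (rule power2_le_imp_le) simp
    then show "norm (spec S \<psi>) \<le> 1 * norm \<psi>" by simp
  qed (simp_all add: spec_add[OF S] spec_scaleC[OF S])
  then have "\<forall>S\<in>sets borel. \<exists>F. F \<in> bounded_ops \<and> (\<forall>\<psi>\<in>D. blinfun_apply F \<psi> = spec S \<psi>)" by blast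
  from bchoice[OF this] obtain E where
    "\<forall>S\<in>sets borel. E S \<in> bounded_ops \<and> (\<forall>\<psi>\<in>D. blinfun_apply (E S) \<psi> = spec S \<psi>)" by blast
  then have E: "\<And>S. S \<in> sets borel \<Longrightarrow> E S \<in> bounded_ops"
    "\<And>S \<psi>. S \<in> sets borel \<Longrightarrow> \<psi> \<in> D \<Longrightarrow> blinfun_apply (E S) \<psi> = spec S \<psi>" by blast+
  have pvm: "pvm E"
    by (rule pvmI_dense[OF D(2) E(1) fin sets total]) (auto simp: E(2) spec_norm spec_cinner)
  \<comment> \<open>The given measures are recovered from \<open>E\<close>, which turns
    \<open>FT\<close> into the spectral representation on \<open>D\<close>.\<close>
  have eq: "pvm_measure E \<psi> = \<mu> \<psi>" if p: "\<psi> \<in> D" for \<psi>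
  proof (rule measure_eqI)
    interpret finite_measure "\<mu> \<psi>" by (rule fin[OF p])
    show "sets (pvm_measure E \<psi>) = sets (\<mu> \<psi>)" using pvm sets[OF p] by simp
    fix S assume "S \<in> sets (pvm_measure E \<psi>)"
    then have S: "S \<in> sets borel" using pvm by simp
    show "emeasure (pvm_measure E \<psi>) S = emeasure (\<mu> \<psi>) S"
      by (simp add: emeasure_pvm_measure[OF pvm S] E(2)[OF S p] spec_norm[OF S p] emeasure_eq_measure)
  qed
  have "cinner \<psi> (blinfun_apply (V x) \<psi>) = (\<integral>p. cis (x \<bullet> p) \<partial>pvm_measure E \<psi>)" for x \<psi>
    by (rule pvm_cis_from_dense[OF pvm D(2)]) (simp add: eq FT)
  moreover have "E S = 0" if S: "S \<in> sets borel" and z: "\<forall>\<psi>\<in>D. measure (\<mu> \<psi>) S = 0" for S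
  proof (rule blinfun_eq_on_dense[OF D(2)])
    fix \<psi> assume "\<psi> \<in> D"
    then show "blinfun_apply (E S) \<psi> = blinfun_apply 0 \<psi>"
      using spec_norm[OF S, of \<psi>] z E(2)[OF S] by simp
  qed
  ultimately show ?thesis using pvm by blast
qed

end


section \<open>Limits of measures along a mean\<close>


lemma
  assumes m: "mean m" and f: "bounded (f ` {0<..1})"
  shows mean_add: "bounded (g ` {0<..1}) \<Longrightarrow> m (\<lambda>l. f l + g l) = m f + m g"
    and mean_cmult: "m (\<lambda>l. c * f l) = c * m f"
    and mean_nonneg: "(\<And>l. l \<in> {0<..1} \<Longrightarrow> f l \<in> \<real>\<^sub>\<ge>\<^sub>0) \<Longrightarrow> m f \<in> \<real>\<^sub>\<ge>\<^sub>0"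
  using assms unfolding mean_def by blast+

lemma mean_diff:
  assumes m: "mean m" and f: "bounded (f ` {0<..1})" and g: "bounded (g ` {0<..1})"
  shows "m (\<lambda>l. f l - g l) = m f - m g"
proof -
  have "bounded ((\<lambda>l. (-1) * g l) ` {0<..1})"
    using g by (auto simp: bounded_iff)
  then show ?thesis using mean_add[OF m f, of "\<lambda>l. (-1) * g l"] mean_cmult[OF m g, of "-1"] by simp
qed

text \<open>Positivity is tested on (0,1] only, so \<open>f - g\<close> and \<open>g - f\<close>
  both have nonnegative mean, while these two means are opposite.\<close>

lemma mean_cong:
  assumes m: "mean m" and f: "bounded (f ` {0<..1})" and eq: "\<And>l. l \<in> {0<..1} \<Longrightarrow> f l = g l"
  shows "m f = m g"
proof -
  have g: "bounded (g ` {0<..1})" using f eq by (metis (no_types, lifting) image_cong)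
  have "bounded ((\<lambda>l. f l - g l) ` {0<..1})" "bounded ((\<lambda>l. g l - f l) ` {0<..1})"
    by (auto intro!: boundedI[of _ 0] simp: eq)
  then have "m (\<lambda>l. f l - g l) \<in> \<real>\<^sub>\<ge>\<^sub>0" "m (\<lambda>l. g l - f l) \<in> \<real>\<^sub>\<ge>\<^sub>0"
    by (auto intro!: mean_nonneg[OF m] simp: eq)
  then show ?thesis
    by (auto simp: mean_diff[OF m f g] mean_diff[OF m g f] complex_nonneg_Reals_iff complex_eq_iff)
qed

lemma bounded_of_real_image:
  "(\<And>l. l \<in> A \<Longrightarrow> \<bar>f l\<bar> \<le> C) \<Longrightarrow> bounded ((\<lambda>l. complex_of_real (f l)) ` A)"
  by (auto intro!: boundedI[of _ C])

lemma mean_const: assumes m: "mean m" shows "m (\<lambda>_. c) = c"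
proof -
  have "m (\<lambda>_. c * 1) = c * m (\<lambda>_. 1)" by (rule mean_cmult[OF m]) (auto intro!: boundedI[of _ 1])
  then show ?thesis using m by (simp add: mean_def)
qed

text \<open>Adding the bound \<open>C\<close> makes the function nonnegative on (0,1], and the mean
  of such a function is real.\<close>

lemma mean_real:
  assumes m: "mean m" and C: "\<And>l. l \<in> {0<..1} \<Longrightarrow> \<bar>f l\<bar> \<le> C"
  shows "m (\<lambda>l. complex_of_real (f l)) = complex_of_real (Re (m (\<lambda>l. complex_of_real (f l))))"
proof -
  have b: "bounded ((\<lambda>l. complex_of_real (f l)) ` {0<..1})" "bounded ((\<lambda>l. complex_of_real C) ` {0<..1::real})"
    by (rule bounded_of_real_image[OF C], assumption) (rule bounded_of_real_image[where C = "\<bar>C\<bar>"], simp)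
  have "m (\<lambda>l. complex_of_real C + complex_of_real (f l)) \<in> \<real>\<^sub>\<ge>\<^sub>0"
  proof (rule mean_nonneg[OF m bounded_plus_comp[OF b(2) b(1)]])
    fix l :: real assume "l \<in> {0<..1}"
    then have "0 \<le> C + f l" using C[of l] by (simp add: abs_le_iff)
    then show "complex_of_real C + complex_of_real (f l) \<in> \<real>\<^sub>\<ge>\<^sub>0" by (simp add: complex_nonneg_Reals_iff)
  qed
  then have "Im (m (\<lambda>l. complex_of_real (f l))) = 0"
    unfolding mean_add[OF m b(2) b(1)] by (simp add: mean_const[OF m] complex_nonneg_Reals_iff)
  then show ?thesis by (simp add: complex_eq_iff)
qed

lemma mean_mono:
  assumes m: "mean m" and C: "\<And>l. l \<in> {0<..1} \<Longrightarrow> \<bar>f l\<bar> \<le> C" and D: "\<And>l. l \<in> {0<..1} \<Longrightarrow> \<bar>g l\<bar> \<le> D"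
    and le: "\<And>l. l \<in> {0<..1} \<Longrightarrow> f l \<le> g l"
  shows "Re (m (\<lambda>l. complex_of_real (f l))) \<le> Re (m (\<lambda>l. complex_of_real (g l)))"
proof -
  have b: "bounded ((\<lambda>l. complex_of_real (f l)) ` {0<..1})" "bounded ((\<lambda>l. complex_of_real (g l)) ` {0<..1})"
    by (rule bounded_of_real_image[OF C], assumption) (rule bounded_of_real_image[OF D])
  have "m (\<lambda>l. complex_of_real (g l) - complex_of_real (f l)) \<in> \<real>\<^sub>\<ge>\<^sub>0"
    using le by (intro mean_nonneg[OF m]) (auto simp: complex_nonneg_Reals_iff intro!: bounded_minus_comp b)
  then show ?thesis unfolding mean_diff[OF m b(2) b(1)] by (simp add: complex_nonneg_Reals_iff)
qed

text \<open>Averaging \<open>1 - cos(tq)\<close> over \<open>0 \<le> t \<le> \<delta>\<close> gives \<open>1 - sin(\<delta>q)/(\<delta>q)\<close>, which is at least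
  \<open>1/2\<close> once \<open>\<bar>q\<bar> \<ge> 2/\<delta>\<close>.\<close>

lemma tail_bound:
  fixes b :: "'a::euclidean_space"
  assumes N: "finite_measure N" and sN [measurable_cong]: "sets N = sets borel" and d: "\<delta> > 0"
    and le: "\<And>t. 0 \<le> t \<Longrightarrow> t \<le> \<delta> \<Longrightarrow> (\<integral>p. 1 - cos (t * (b \<bullet> p)) \<partial>N) \<le> e"
  shows "measure N {p. \<bar>b \<bullet> p\<bar> \<ge> 2 / \<delta>} \<le> 2 * e"
proof -
  interpret N: finite_measure N by fact
  interpret pair_sigma_finite lborel N by unfold_locales
  \<comment> \<open>Nonnegative extended values, so that Tonelli exchanges the average over
    \<open>t\<close> with the integral over \<open>p\<close>.\<close>
  define h where "h t p = ennreal (1 - cos (t * (b \<bullet> p))) * indicator {0..\<delta>} t" for t p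
  have hm: "(\<lambda>(t, p). h t p) \<in> borel_measurable (lborel \<Otimes>\<^sub>M N)"
    unfolding h_def by measurable
  have e0: "e \<ge> 0" using le[of 0] d by simp
  have T: "{p. \<bar>b \<bullet> p\<bar> \<ge> 2 / \<delta>} \<in> sets borel" by measurable
  have inner: "ennreal (\<delta> / 2) * indicator {p. \<bar>b \<bullet> p\<bar> \<ge> 2 / \<delta>} p \<le> (\<integral>\<^sup>+t. h t p \<partial>lborel)" for p
  proof (cases "\<bar>b \<bullet> p\<bar> \<ge> 2 / \<delta>")
    case True
    define q where "q = b \<bullet> p"
    have q: "\<bar>q\<bar> \<ge> 2 / \<delta>" using True by (simp add: q_def)
    then have q0: "q \<noteq> 0" "\<bar>q\<bar> > 0" using d by (auto simp: field_simps)
    \<comment> \<open>The primitive in \<open>t\<close> is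
      \<open>t - sin (t * q) / q\<close>.\<close>
    have "(\<integral>\<^sup>+t. h t p \<partial>lborel) = ennreal ((\<delta> - sin (\<delta> * q) / q) - (0 - sin (0 * q) / q))"
      unfolding h_def q_def[symmetric]
      by (rule nn_integral_FTC_Icc) (use d q0 in \<open>auto intro!: derivative_eq_intros\<close>)
    also have "\<dots> \<ge> ennreal (\<delta> / 2)"
    proof (rule ennreal_leI)
      have "\<bar>sin (\<delta> * q) / q\<bar> \<le> 1 / \<bar>q\<bar>" using abs_sin_le_one[of "\<delta> * q"] by (simp add: abs_divide divide_right_mono)
      also have "\<dots> \<le> \<delta> / 2" using q q0 d by (simp add: field_simps)
      finally have "sin (\<delta> * q) / q \<le> \<delta> / 2" by (rule abs_le_D1)
      moreover have "0 - sin (0 * q) / q = 0" by simp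
      ultimately show "\<delta> / 2 \<le> (\<delta> - sin (\<delta> * q) / q) - (0 - sin (0 * q) / q)" by linarith
    qed
    finally show ?thesis using True by simp
  qed simp
  have "ennreal (\<delta> / 2) * emeasure N {p. \<bar>b \<bullet> p\<bar> \<ge> 2 / \<delta>} =
      (\<integral>\<^sup>+p. ennreal (\<delta> / 2) * indicator {p. \<bar>b \<bullet> p\<bar> \<ge> 2 / \<delta>} p \<partial>N)"
    using T sN by (subst nn_integral_cmult_indicator) auto
  also have "\<dots> \<le> (\<integral>\<^sup>+p. (\<integral>\<^sup>+t. h t p \<partial>lborel) \<partial>N)"
    by (intro nn_integral_mono inner)
  also have "\<dots> = (\<integral>\<^sup>+t. (\<integral>\<^sup>+p. h t p \<partial>N) \<partial>lborel)"
    using Fubini'[OF hm] by simp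
  also have "\<dots> \<le> (\<integral>\<^sup>+t. ennreal e * indicator {0..\<delta>} t \<partial>lborel)"
  proof (rule nn_integral_mono)
    fix t :: real
    show "(\<integral>\<^sup>+p. h t p \<partial>N) \<le> ennreal e * indicator {0..\<delta>} t"
    proof (cases "t \<in> {0..\<delta>}")
      case True
      have "integrable N (\<lambda>p. 1 - cos (t * (b \<bullet> p)))"
      proof (rule N.integrable_const_bound[of _ 2])
        show "AE p in N. norm (1 - cos (t * (b \<bullet> p))) \<le> 2"
          using cos_ge_minus_one[of "t * (b \<bullet> _)"] by (intro AE_I2) (smt (verit) cos_ge_minus_one cos_le_one real_norm_def)
      qed measurable
      then have "(\<integral>\<^sup>+p. h t p \<partial>N) = ennreal (\<integral>p. 1 - cos (t * (b \<bullet> p)) \<partial>N)"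
        unfolding h_def using True by (simp add: nn_integral_eq_integral)
      also have "\<dots> \<le> ennreal e" using True le[of t] by (intro ennreal_leI) auto
      finally show ?thesis using True by simp
    qed (simp add: h_def)
  qed
  also have "\<dots> = ennreal (e * \<delta>)" using d e0 by (simp add: nn_integral_cmult_indicator ennreal_mult)
  finally have "ennreal (\<delta> / 2 * measure N {p. \<bar>b \<bullet> p\<bar> \<ge> 2 / \<delta>}) \<le> ennreal (e * \<delta>)"
    using d ennreal_mult[of "\<delta> / 2" "measure N {p. \<bar>b \<bullet> p\<bar> \<ge> 2 / \<delta>}"]
    by (simp add: N.emeasure_eq_measure del: ennreal_le_iff2)
  then have "\<delta> / 2 * measure N {p. \<bar>b \<bullet> p\<bar> \<ge> 2 / \<delta>} \<le> e * \<delta>" using e0 d by (simp add: ennreal_le_iff)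
  then show ?thesis using d by (simp add: field_simps)
qed

text \<open>A vector outside a large ball has a large coordinate, so the complement of the ball is
  covered by one pair of half-spaces per basis direction, each controlled by
  \<open>tail_bound\<close>.\<close>

lemma uniform_tightness:
  fixes N :: "'i \<Rightarrow> 'a::euclidean_space measure"
  assumes N: "\<And>i. i \<in> I \<Longrightarrow> finite_measure (N i)" "\<And>i. i \<in> I \<Longrightarrow> sets (N i) = sets borel"
    and tight: "\<And>e. e > 0 \<Longrightarrow> \<exists>d>0. \<forall>x. norm x \<le> d \<longrightarrow> (\<forall>i\<in>I. (\<integral>p. 1 - cos (x \<bullet> p) \<partial>N i) \<le> e)"
    and e: "e > 0"
  shows "\<exists>R. \<forall>i\<in>I. measure (N i) (- cball 0 R) \<le> e"
proof -
  define n where "n = real DIM('a)"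
  have n: "n > 0" by (simp add: n_def)
  obtain \<delta> where d: "\<delta> > 0" "\<And>x i. norm x \<le> \<delta> \<Longrightarrow> i \<in> I \<Longrightarrow> (\<integral>p. 1 - cos (x \<bullet> p) \<partial>N i) \<le> e / (2 * n)"
    using tight[of "e / (2 * n)"] e n by (metis divide_pos_pos mult_pos_pos zero_less_numeral)
  \<comment> \<open>If all coordinates stay below \<open>2 / \<delta>\<close>, the l1 norm and with
    it the norm is at most \<open>R\<close>. The denominator \<open>2 * n\<close> above absorbs the
    factor 2 of \<open>tail_bound\<close> and the number of directions.\<close>
  define R where "R = n * (2 / \<delta>)"
  have "measure (N i) (- cball 0 R) \<le> e" if i: "i \<in> I" for i
  proof -
    interpret finite_measure "N i" by (rule N(1)[OF i])
    define T where "T b = {p::'a. \<bar>b \<bullet> p\<bar> \<ge> 2 / \<delta>}" for b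
    have Tm: "T b \<in> sets (N i)" for b unfolding T_def N(2)[OF i] by measurable
    have "- cball 0 R \<subseteq> (\<Union>b\<in>Basis. T b)"
    proof (rule subsetI, rule ccontr)
      fix p :: 'a assume p: "p \<in> - cball 0 R" "p \<notin> (\<Union>b\<in>Basis. T b)"
      have "norm p \<le> (\<Sum>b\<in>Basis. \<bar>p \<bullet> b\<bar>)" by (rule norm_le_l1)
      also have "\<dots> \<le> (\<Sum>b\<in>(Basis::'a set). 2 / \<delta>)"
        using p(2) by (intro sum_mono) (auto simp: T_def inner_commute less_imp_le not_le)
      also have "\<dots> = R" by (simp add: R_def n_def)
      finally show False using p(1) by simp
    qed
    then have "measure (N i) (- cball 0 R) \<le> measure (N i) (\<Union>b\<in>Basis. T b)"
      using Tm by (intro finite_measure_mono) auto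
    also have "\<dots> \<le> (\<Sum>b\<in>Basis. measure (N i) (T b))"
      by (rule finite_measure_subadditive_finite) (use Tm in auto)
    also have "\<dots> \<le> (\<Sum>b\<in>(Basis::'a set). 2 * (e / (2 * n)))"
    proof (rule sum_mono)
      fix b :: 'a assume b: "b \<in> Basis"
      show "measure (N i) (T b) \<le> 2 * (e / (2 * n))" unfolding T_def
      proof (rule tail_bound[OF N(1)[OF i] N(2)[OF i] d(1)])
        fix t assume "0 \<le> t" "t \<le> \<delta>"
        then show "(\<integral>p. 1 - cos (t * (b \<bullet> p)) \<partial>N i) \<le> e / (2 * n)"
          using d(2)[of "t *\<^sub>R b" i] i b by simp
      qed
    qed
    also have "\<dots> = e" using n by (simp add: n_def)
    finally show ?thesis .
  qed
  then show ?thesis by blast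
qed

section \<open>Passing measures through a mean\<close>

lemma Dini_compact:
  fixes h :: "nat \<Rightarrow> 'a::metric_space \<Rightarrow> real"
  assumes K: "compact K" and c: "\<And>k. continuous_on UNIV (h k)" and dec: "\<And>x. decseq (\<lambda>k. h k x)"
    and lim: "\<And>x. (\<lambda>k. h k x) \<longlonglongrightarrow> 0" and e: "e > 0"
  shows "\<exists>k. \<forall>x\<in>K. h k x < e"
proof -
  have "\<exists>C'\<subseteq>UNIV. finite C' \<and> K \<subseteq> (\<Union>k\<in>C'. {x. h k x < e})"
  proof (rule compactE_image[OF K])
    show "open {x. h k x < e}" for k by (rule open_Collect_less[OF c continuous_on_const])
    show "K \<subseteq> (\<Union>k\<in>UNIV. {x. h k x < e})"
    proof
      fix x
      have "\<forall>\<^sub>F k in sequentially. h k x < e" using lim[of x] e by (rule order_tendstoD(2))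
      then show "x \<in> (\<Union>k\<in>UNIV. {x. h k x < e})" using eventually_happens'[OF sequentially_bot] by auto
    qed
  qed blast
  then obtain C' where C': "finite C'" "K \<subseteq> (\<Union>k\<in>C'. {x. h k x < e})" by blast
  \<comment> \<open>Inserting 0 keeps the maximum defined when the subcover is empty.\<close>
  have "h (Max (insert 0 C')) x < e" if x: "x \<in> K" for x
  proof -
    obtain k where k: "k \<in> C'" "h k x < e" using C'(2) x by blast
    have "h (Max (insert 0 C')) x \<le> h k x" using dec[of x] C'(1) k(1) by (auto simp: decseq_def)
    then show ?thesis using k(2) by simp
  qed
  then show ?thesis by blast
qed

text \<open>The averaged integral is a Daniell functional: a sequence decreasing to zero is
  uniformly small on a large ball by Dini, and outside the ball tightness makes its integrals small
  for all scales together. Estimates uniform in the scale are the ones that survive a mean, which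
  explains the form of the tightness hypothesis.\<close>

lemma mean_bochner:
  fixes N :: "real \<Rightarrow> 'a::euclidean_space measure"
  assumes m: "mean m"
    and fN: "\<And>l. l \<in> {0<..1} \<Longrightarrow> finite_measure (N l)" and sN: "\<And>l. l \<in> {0<..1} \<Longrightarrow> sets (N l) = sets borel"
    and B: "\<And>l. l \<in> {0<..1} \<Longrightarrow> measure (N l) UNIV \<le> B"
    and tight: "\<And>e. e > 0 \<Longrightarrow> \<exists>d>0. \<forall>x. norm x \<le> d \<longrightarrow> (\<forall>l\<in>{0<..1}. (\<integral>p. 1 - cos (x \<bullet> p) \<partial>N l) \<le> e)"
  shows "\<exists>\<mu>. finite_measure \<mu> \<and> sets \<mu> = sets borel \<and>
    (\<forall>x. (\<integral>p. cis (x \<bullet> p) \<partial>\<mu>) = m (\<lambda>l. \<integral>p. cis (x \<bullet> p) \<partial>N l)) \<and>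
    (\<forall>W. open W \<longrightarrow> (\<forall>l\<in>{0<..1}. measure (N l) W = 0) \<longrightarrow> measure \<mu> W = 0)"
proof -
  define \<Lambda> where "\<Lambda> f = Re (m (\<lambda>l. complex_of_real (\<integral>p. f p \<partial>N l)))" for f :: "'a \<Rightarrow> real"
  have sp: "space (N l) = UNIV" if "l \<in> {0<..1}" for l using sets_eq_imp_space_eq[OF sN[OF that]] by simp
  have B0: "B \<ge> 0" by (rule order_trans[OF measure_nonneg B[of 1]]) simp
  have int: "integrable (N l) f" if "bounded_borel f" "l \<in> {0<..1}" for f l
    by (rule bounded_borel_integrable[OF that(1) fN[OF that(2)] sN[OF that(2)]])
  have ub: "(\<integral>p. f p \<partial>N l) \<le> C * B" if f: "bounded_borel f" "\<And>p. f p \<le> C" "C \<ge> 0" and l: "l \<in> {0<..1}" for f C l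
  proof -
    interpret finite_measure "N l" by (rule fN[OF l])
    have "(\<integral>p. f p \<partial>N l) \<le> (\<integral>p. C \<partial>N l)" using f(2) by (intro integral_mono int[OF f(1) l]) auto
    also have "\<dots> \<le> C * B" using B[OF l] f(3) sp[OF l] by (simp add: mult.commute[of _ C] mult_left_mono)
    finally show ?thesis .
  qed
  have bd: "\<bar>\<integral>p. f p \<partial>N l\<bar> \<le> C * B" if f: "bounded_borel f" "\<And>p. \<bar>f p\<bar> \<le> C" and l: "l \<in> {0<..1}" for f C l
  proof -
    have "C \<ge> 0" using f(2) abs_ge_zero order_trans by blast
    have "(\<integral>p. - f p \<partial>N l) \<le> C * B"
      using bounded_borel_diff[OF bounded_borel_const[of 0] f(1)] f(2) l \<open>C \<ge> 0\<close>
      by (intro ub) (auto simp: abs_le_iff)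
    moreover have "(\<integral>p. f p \<partial>N l) \<le> C * B"
      using f l \<open>C \<ge> 0\<close> by (intro ub) (auto simp: abs_le_iff)
    ultimately show ?thesis by (simp add: abs_le_iff)
  qed
  have bdd: "\<exists>C. \<forall>l\<in>{0<..1}. \<bar>\<integral>p. f p \<partial>N l\<bar> \<le> C" if f: "bounded_borel f" for f
    using f bd[OF f] unfolding bounded_borel_def by blast
  have bdc: "bounded ((\<lambda>l. complex_of_real (\<integral>p. f p \<partial>N l)) ` {0<..1})" if f: "bounded_borel f" for f
    using bdd[OF f] bounded_of_real_image[of "{0<..1}" "\<lambda>l. \<integral>p. f p \<partial>N l"] by blast
  have bound: "\<Lambda> f \<le> Re (m (\<lambda>l. complex_of_real c))" if f: "bounded_borel f" "\<And>l. l \<in> {0<..1} \<Longrightarrow> (\<integral>p. f p \<partial>N l) \<le> c" for f c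
  proof -
    obtain C where C: "\<And>l. l \<in> {0<..1} \<Longrightarrow> \<bar>\<integral>p. f p \<partial>N l\<bar> \<le> C" using bdd[OF f(1)] by blast
    show ?thesis unfolding \<Lambda>_def
      by (rule mean_mono[OF m C, where D = "\<bar>c\<bar>"]) (use f(2) in auto)
  qed
  interpret daniell_functional \<Lambda>
  proof
    fix f g :: "'a \<Rightarrow> real" assume f: "Cb f" and g: "Cb g"
    note bf = bounded_borel_Cb[OF f] and bg = bounded_borel_Cb[OF g]
    have "m (\<lambda>l. complex_of_real (\<integral>p. f p \<partial>N l) + complex_of_real (\<integral>p. g p \<partial>N l)) =
        m (\<lambda>l. complex_of_real (\<integral>p. f p + g p \<partial>N l))"
      by (rule mean_cong[OF m bounded_plus_comp[OF bdc[OF bf] bdc[OF bg]]]) (simp add: int bf bg)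
    then show "\<Lambda> (\<lambda>x. f x + g x) = \<Lambda> f + \<Lambda> g"
      unfolding \<Lambda>_def mean_add[OF m bdc[OF bf] bdc[OF bg]] by (metis plus_complex.sel(1))
  next
    fix f :: "'a \<Rightarrow> real" and c :: real assume f: "Cb f"
    note bf = bounded_borel_Cb[OF f]
    have "m (\<lambda>l. complex_of_real c * complex_of_real (\<integral>p. f p \<partial>N l)) = complex_of_real c * m (\<lambda>l. complex_of_real (\<integral>p. f p \<partial>N l))"
      by (rule mean_cmult[OF m bdc[OF bf]])
    then show "\<Lambda> (\<lambda>x. c * f x) = c * \<Lambda> f" unfolding \<Lambda>_def by simp
  next
    fix f :: "'a \<Rightarrow> real" assume f: "Cb f" "\<And>x. 0 \<le> f x"
    have "m (\<lambda>l. complex_of_real (\<integral>p. f p \<partial>N l)) \<in> \<real>\<^sub>\<ge>\<^sub>0"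
      using f(2) by (intro mean_nonneg[OF m bdc[OF bounded_borel_Cb[OF f(1)]]])
        (simp add: complex_nonneg_Reals_iff integral_nonneg_AE)
    then show "0 \<le> \<Lambda> f" by (simp add: \<Lambda>_def complex_nonneg_Reals_iff)
  next
    fix h :: "nat \<Rightarrow> 'a \<Rightarrow> real"
    assume h: "\<And>k. Cb (h k)" and dec: "\<And>x. decseq (\<lambda>k. h k x)" and lim: "\<And>x. (\<lambda>k. h k x) \<longlonglongrightarrow> 0"
    note bh = bounded_borel_Cb[OF h]
    have hc: "continuous_on UNIV (h k)" for k using h unfolding Cb_def by blast
    have h0: "0 \<le> h k x" for k x using decseq_ge[OF dec lim] by simp
    obtain C where C: "C > 0" "\<And>x. \<bar>h 0 x\<bar> \<le> C" using Cb_boundE[OF h] by blast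
    have hC: "h k x \<le> C" for k x using dec[of x] C(2)[of x] unfolding decseq_def by (smt (verit) zero_le)
    show "(\<lambda>k. \<Lambda> (h k)) \<longlonglongrightarrow> 0"
    proof (rule LIMSEQ_I)
      fix e :: real assume e: "e > 0"
      \<comment> \<open>\<open>\<epsilon> * B\<close> will bound the contribution of the ball and
        \<open>C * \<epsilon>\<close> that of its complement; together they make
        \<open>e / 2\<close>.\<close>
      define S where "S = B + C"
      define \<epsilon> where "\<epsilon> = e / (2 * S)"
      have "S > 0" using B0 C(1) by (simp add: S_def)
      then have "\<epsilon> > 0" "\<epsilon> * S < e" using e by (simp_all add: \<epsilon>_def)
      then have eps: "\<epsilon> > 0" "\<epsilon> * (B + C) < e" by (simp_all add: S_def)
      obtain R where R: "\<And>l. l \<in> {0<..1} \<Longrightarrow> measure (N l) (- cball 0 R) \<le> \<epsilon>"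
        using uniform_tightness[OF fN sN tight eps(1)] by blast
      obtain K where K: "\<And>x. x \<in> cball 0 R \<Longrightarrow> h K x < \<epsilon>"
        using Dini_compact[OF compact_cball[of 0 R] hc dec lim eps(1)] by blast
      have "\<Lambda> (h k) \<le> \<epsilon> * (B + C)" if k: "k \<ge> K" for k
      proof -
        have "\<Lambda> (h k) \<le> Re (m (\<lambda>l. complex_of_real (\<epsilon> * (B + C))))"
        proof (rule bound[OF bh])
          fix l :: real assume l: "l \<in> {0<..1}"
          interpret finite_measure "N l" by (rule fN[OF l])
          have S: "- cball 0 R \<in> sets (borel :: 'a measure)" by measurable
          have bb: "bounded_borel (\<lambda>p. \<epsilon> + C * indicator (- cball 0 R) p :: real)"
            using S by (intro bounded_borel_add bounded_borel_mult) auto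
          have "(\<integral>p. h k p \<partial>N l) \<le> (\<integral>p. \<epsilon> + C * indicator (- cball 0 R) p \<partial>N l)"
          proof (rule integral_mono[OF int[OF bh l] int[OF bb l]])
            fix p
            have "h k p \<le> h K p" using dec[of p] k by (simp add: decseq_def)
            then show "h k p \<le> \<epsilon> + C * indicator (- cball 0 R) p"
              using K[of p] hC[of k p] eps(1) by (cases "p \<in> cball 0 R") auto
          qed
          also have "\<dots> = \<epsilon> * measure (N l) UNIV + C * measure (N l) (- cball 0 R)"
            using S sN[OF l] sp[OF l]
            by (subst Bochner_Integration.integral_add) (auto simp: less_top[symmetric] emeasure_eq_measure)
          also have "\<dots> \<le> \<epsilon> * B + C * \<epsilon>"
            using B[OF l] R[OF l] eps(1) C(1) by (intro add_mono mult_left_mono) auto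
          finally show "(\<integral>p. h k p \<partial>N l) \<le> \<epsilon> * (B + C)" by (simp add: distrib_left mult.commute)
        qed
        then show ?thesis by (simp add: mean_const[OF m])
      qed
      moreover have "0 \<le> \<Lambda> (h k)" for k
      proof -
        have "m (\<lambda>l. complex_of_real (\<integral>p. h k p \<partial>N l)) \<in> \<real>\<^sub>\<ge>\<^sub>0"
          using h0 by (intro mean_nonneg[OF m bdc[OF bh]]) (simp add: complex_nonneg_Reals_iff integral_nonneg_AE)
        then show ?thesis by (simp add: \<Lambda>_def complex_nonneg_Reals_iff)
      qed
      ultimately show "\<exists>no. \<forall>n\<ge>no. norm (\<Lambda> (h n) - 0) < e"
        using eps(2) by (intro exI[of _ K]) (auto intro: le_less_trans)
    qed
  qed
  have real: "complex_of_real (\<integral>p. f p \<partial>riesz_measure) = m (\<lambda>l. complex_of_real (\<integral>p. f p \<partial>N l))"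
    if f: "Cb f" for f
  proof -
    obtain C where C: "\<And>l. l \<in> {0<..1} \<Longrightarrow> \<bar>\<integral>p. f p \<partial>N l\<bar> \<le> C" using bdd[OF bounded_borel_Cb[OF f]] by blast
    have "m (\<lambda>l. complex_of_real (\<integral>p. f p \<partial>N l)) = complex_of_real (\<Lambda> f)"
      unfolding \<Lambda>_def by (rule mean_real[OF m C])
    then show ?thesis using riesz_integral[OF f] by simp
  qed
  have FT: "(\<integral>p. cis (x \<bullet> p) \<partial>riesz_measure) = m (\<lambda>l. \<integral>p. cis (x \<bullet> p) \<partial>N l)" for x
  proof -
    have c: "Cb (\<lambda>p. cos (x \<bullet> p))" and s: "Cb (\<lambda>p. sin (x \<bullet> p))"
      by (rule CbI[of _ 1]; auto intro!: continuous_intros)+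
    note bc = bdc[OF bounded_borel_Cb[OF c]] and bs = bdc[OF bounded_borel_Cb[OF s]]
    have bis: "bounded ((\<lambda>l. \<i> * complex_of_real (\<integral>p. sin (x \<bullet> p) \<partial>N l)) ` {0<..1})"
      using bs by (auto simp: bounded_iff norm_mult)
    have "(\<integral>p. cis (x \<bullet> p) \<partial>riesz_measure) =
        complex_of_real (\<integral>p. cos (x \<bullet> p) \<partial>riesz_measure) + \<i> * complex_of_real (\<integral>p. sin (x \<bullet> p) \<partial>riesz_measure)"
      unfolding integral_cis(1)[OF finite_measure_riesz sets_riesz] by (simp add: complex_eq_iff)
    also have "\<dots> = m (\<lambda>l. complex_of_real (\<integral>p. cos (x \<bullet> p) \<partial>N l) + \<i> * complex_of_real (\<integral>p. sin (x \<bullet> p) \<partial>N l))"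
      unfolding real[OF c] real[OF s] mean_add[OF m bc bis] mean_cmult[OF m bs] ..
    also have "\<dots> = m (\<lambda>l. \<integral>p. cis (x \<bullet> p) \<partial>N l)"
      by (rule mean_cong[OF m bounded_plus_comp[OF bc bis]])
         (simp add: integral_cis(1)[OF fN sN] complex_eq_iff)
    finally show ?thesis .
  qed
  \<comment> \<open>An open set is exhausted by continuous bumps, each of integral zero against all
    \<open>N l\<close>. Continuity of the bumps matters, as \<open>riesz_integral\<close> identifies
    the averaged integral for such functions.\<close>
  have supp: "measure riesz_measure W = 0" if W: "open W" and z: "\<forall>l\<in>{0<..1}. measure (N l) W = 0" for W
  proof -
    interpret R: finite_measure riesz_measure by (rule finite_measure_riesz)
    have Wm: "W \<in> sets borel" using W by simp
    have "(\<integral>p. bump W k p \<partial>riesz_measure) \<le> 0" for k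
    proof -
      have "\<Lambda> (bump W k) \<le> Re (m (\<lambda>l. complex_of_real 0))"
      proof (rule bound[OF bounded_borel_Cb[OF Cb_bump]])
        fix l :: real assume l: "l \<in> {0<..1}"
        interpret finite_measure "N l" by (rule fN[OF l])
        have "(\<integral>p. bump W k p \<partial>N l) \<le> (\<integral>p. indicator W p \<partial>N l)"
          using bump_le_1[of W k] bump_outside[of _ W k]
          by (intro integral_mono int[OF bounded_borel_Cb[OF Cb_bump] l] int[OF bounded_borel_indicator[OF Wm] l])
             (auto simp: indicator_def)
        also have "\<dots> = 0" using z l Wm sN[OF l] sp[OF l] by simp
        finally show "(\<integral>p. bump W k p \<partial>N l) \<le> 0" .
      qed
      then show ?thesis by (simp add: riesz_integral[symmetric] mean_const[OF m])
    qed
    moreover have "(\<lambda>k. \<integral>p. bump W k p \<partial>riesz_measure) \<longlonglongrightarrow> (\<integral>p. indicator W p \<partial>riesz_measure)"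
      using bump_LIMSEQ[OF W] bump_nonneg[of W] bump_le_1[of W]
      by (intro bounded_borel_tendsto_integral[where C = 1, OF _ _ _ _ finite_measure_riesz sets_riesz])
         (auto intro: bounded_borel_Cb bounded_borel_indicator Wm)
    ultimately have "(\<integral>p. indicator W p \<partial>riesz_measure) \<le> (0::real)"
      by (intro LIMSEQ_le_const2) auto
    then show ?thesis using Wm measure_nonneg[of riesz_measure W] by simp
  qed
  show ?thesis
    using finite_measure_riesz sets_riesz FT supp by blast
qed


section \<open>The scaling algebra\<close>


lemma mink_commute: "mink x y = mink y x"
  by (simp add: mink_def mult.commute)

lemma mink_axis_None: "mink (axis None 1) x = x $ None"
  by (simp add: mink_def axis_def)

text \<open>By Cauchy-Schwarz on the space parts, the product of the time components of two unit
  timelike vectors strictly exceeds their spatial product. This is what makes \<open>lorentz\<close>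
  closed under products.\<close>

lemma mink_timelike_pos:
  assumes u: "mink u u = 1" "u $ None > 0" and v: "mink v v = 1" "v $ None > 0"
  shows "mink u v > 0"
proof -
  define S where "S = (\<Sum>i\<in>UNIV. u $ Some i * v $ Some i)"
  define a b where "a = (\<Sum>i\<in>UNIV. (u $ Some i)\<^sup>2)" and "b = (\<Sum>i\<in>UNIV. (v $ Some i)\<^sup>2)"
  have ab: "a = (u $ None)\<^sup>2 - 1" "b = (v $ None)\<^sup>2 - 1" "a \<ge> 0" "b \<ge> 0"
    using u(1) v(1) by (auto simp: mink_def a_def b_def power2_eq_square intro!: sum_nonneg)
  have "S\<^sup>2 \<le> a * b" unfolding S_def a_def b_def by (rule Cauchy_Schwarz_ineq_sum)
  also have "\<dots> < (u $ None * v $ None)\<^sup>2"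
  proof -
    have "(u $ None * v $ None)\<^sup>2 = (a + 1) * (b + 1)" using ab by (simp add: power_mult_distrib)
    then show ?thesis using ab(3,4) by (simp add: algebra_simps)
  qed
  finally have "\<bar>S\<bar> < \<bar>u $ None * v $ None\<bar>" using abs_le_square_iff not_le by blast
  then show ?thesis using u(2) v(2) by (simp add: mink_def S_def abs_less_iff)
qed

text \<open>Expresses time orientation through the image of the time axis, to which invariance of
  \<open>mink\<close> can be applied.\<close>

lemma matrix_entry_None: "L $ None $ None = mink (axis None 1) (L *v axis None 1)"
  by (simp add: mink_axis_None matrix_vector_mult_basis column_def)

lemma lorentz_one: "mat 1 \<in> lorentz"
  by (simp add: lorentz_def det_I) (simp add: mat_def)

lemma lorentz_inverse:
  assumes L: "L \<in> lorentz"
  shows "\<exists>M\<in>lorentz. L ** M = mat 1 \<and> M ** L = mat 1"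
proof -
  have "invertible L" using L by (simp add: invertible_det_nz lorentz_def)
  then obtain M where M: "L ** M = mat 1" "M ** L = mat 1" unfolding invertible_def by blast
  have LM: "L *v (M *v x) = x" for x using M(1) by (simp add: matrix_vector_mul_assoc)
  have pres: "mink (L *v x) (L *v y) = mink x y" for x y using L by (simp add: lorentz_def)
  have "mink (M *v x) (M *v y) = mink x y" for x y using pres[of "M *v x" "M *v y"] LM by simp
  moreover have "det M = 1" using det_mul[of L M] M(1) L by (simp add: det_I lorentz_def)
  \<comment> \<open>Applying \<open>L\<close> to both arguments moves it from the second one, where
    it cancels \<open>M\<close>, to the first.\<close>
  moreover have "M $ None $ None = L $ None $ None"
    unfolding matrix_entry_None using pres[of "axis None 1" "M *v axis None 1"] LM
    by (simp add: mink_commute)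
  ultimately have "M \<in> lorentz" using L by (simp add: lorentz_def)
  then show ?thesis using M by blast
qed

text \<open>The time-time entry of \<open>L ** M\<close> is the Minkowski product of the images of
  the time axis under the inverse of \<open>L\<close> and under \<open>M\<close>, two
  future-directed unit vectors.\<close>

lemma lorentz_mult:
  assumes L: "L \<in> lorentz" and M: "M \<in> lorentz"
  shows "L ** M \<in> lorentz"
proof -
  obtain N where N: "N \<in> lorentz" "L ** N = mat 1" "N ** L = mat 1" using lorentz_inverse[OF L] by blast
  have pos: "mink (K *v axis None 1) (K *v axis None 1) = 1" "(K *v axis None 1) $ None > 0" if "K \<in> lorentz" for K
    using that matrix_entry_None[of K] mink_axis_None[of "axis None 1"]
    by (auto simp: lorentz_def mink_axis_None)
  have "mink (L *v (N *v axis None 1)) (L *v (M *v axis None 1)) = mink (N *v axis None 1) (M *v axis None 1)"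
    using L by (simp add: lorentz_def)
  then have "(L ** M) $ None $ None = mink (N *v axis None 1) (M *v axis None 1)"
    using N(2) by (simp add: matrix_entry_None matrix_vector_mul_assoc)
  then have "(L ** M) $ None $ None > 0" using mink_timelike_pos[OF pos[OF N(1)] pos[OF M]] by simp
  then show ?thesis using L M
    by (auto simp: lorentz_def det_mul matrix_vector_mul_assoc[symmetric])
qed

lemma carrier_scaling_group: "carrier scaling_group = {0<..} \<times> UNIV \<times> lorentz"
  and mult_scaling_group: "(\<mu>, x, L) \<otimes>\<^bsub>scaling_group\<^esub> (\<nu>, y, M) = (\<mu> * \<nu>, inverse \<nu> *\<^sub>R x + L *v y, L ** M)"
  and one_scaling_group: "\<one>\<^bsub>scaling_group\<^esub> = (1, 0, mat 1)"
  by (simp_all add: scaling_group_def)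

lemma group_scaling_group: "group (scaling_group :: (real \<times> 's::finite spacetime \<times> 's stmatrix) monoid)"
proof (rule groupI)
  fix g h k :: "real \<times> 's spacetime \<times> 's stmatrix"
  assume g: "g \<in> carrier scaling_group" and h: "h \<in> carrier scaling_group" and k: "k \<in> carrier scaling_group"
  obtain \<mu> x L where g': "g = (\<mu>, x, L)" by (cases g)
  obtain \<nu> y M where h': "h = (\<nu>, y, M)" by (cases h)
  obtain \<rho> z K where k': "k = (\<rho>, z, K)" by (cases k)
  show "g \<otimes>\<^bsub>scaling_group\<^esub> h \<in> carrier scaling_group"
    using g h unfolding g' h' mult_scaling_group by (auto simp: carrier_scaling_group lorentz_mult)
  show "g \<otimes>\<^bsub>scaling_group\<^esub> h \<otimes>\<^bsub>scaling_group\<^esub> k = g \<otimes>\<^bsub>scaling_group\<^esub> (h \<otimes>\<^bsub>scaling_group\<^esub> k)"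
    using g h k unfolding g' h' k' mult_scaling_group
    by (auto simp: carrier_scaling_group matrix_mul_assoc matrix_vector_mul_assoc[symmetric]
        matrix_vector_right_distrib scaleR_matrix_vector_assoc matrix_vector_mult_scaleR
        scaleR_add_right inverse_mult_distrib mult.commute)
  show "\<one>\<^bsub>scaling_group\<^esub> \<otimes>\<^bsub>scaling_group\<^esub> g = g"
    unfolding g' one_scaling_group mult_scaling_group by simp
  show "\<exists>h\<in>carrier scaling_group. h \<otimes>\<^bsub>scaling_group\<^esub> g = \<one>\<^bsub>scaling_group\<^esub>"
  proof -
    obtain N where N: "N \<in> lorentz" "N ** L = mat 1"
      using lorentz_inverse[of L] g by (auto simp: g' carrier_scaling_group)
    \<comment> \<open>The translation part y of the left inverse solves
      \<open>inverse \<mu> *\<^sub>R y + N *v x = 0\<close>.\<close>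
    show ?thesis
      using g N
      by (intro bexI[of _ "(inverse \<mu>, - (\<mu> *\<^sub>R (N *v x)), N)"])
         (auto simp: g' carrier_scaling_group mult_scaling_group one_scaling_group)
  qed
qed (auto simp: carrier_scaling_group one_scaling_group lorentz_one)

text \<open>Multiplication from the right, because \<alpha>_h applied to \<alpha>_k A is the orbit
  of A at hk.\<close>

lemma continuous_mult_right_scaling_group:
  fixes k :: "real \<times> 's::finite spacetime \<times> 's stmatrix"
  shows "((\<lambda>h. h \<otimes>\<^bsub>scaling_group\<^esub> k) \<longlongrightarrow> g \<otimes>\<^bsub>scaling_group\<^esub> k) (at g within S)"
proof -
  obtain \<nu> y M where k: "k = (\<nu>, y, M)" by (cases k)
  have eq: "h \<otimes>\<^bsub>scaling_group\<^esub> k =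
      (fst h * \<nu>, inverse \<nu> *\<^sub>R fst (snd h) + snd (snd h) *v y, snd (snd h) ** M)" for h
    unfolding k by (cases h) (simp add: mult_scaling_group)
  have id: "((\<lambda>h. h) \<longlongrightarrow> g) (at g within S)" by (rule tendsto_ident_at)
  note s = tendsto_snd[OF tendsto_snd[OF id]]
  have e: "((\<lambda>h. snd (snd h) $ i $ j) \<longlongrightarrow> snd (snd g) $ i $ j) (at g within S)" for i j
    by (intro tendsto_vec_nth s)
  show ?thesis unfolding eq matrix_vector_mult_def matrix_matrix_mult_def
    by (intro tendsto_Pair tendsto_intros tendsto_vec_lambda e id)
qed

lemma poincare_mult: "(x, L) \<otimes>\<^bsub>poincare_group\<^esub> (y, M) = (x + L *v y, L ** M)"
  by (simp add: poincare_group_def)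

lemma carrier_poincare_group: "carrier poincare_group = UNIV \<times> lorentz"
  by (simp add: poincare_group_def)

section \<open>Bounded operator functions\<close>

lemma
  assumes "A \<in> bounded_opfuns"
  shows opfun_in_bounded_ops: "A l \<in> bounded_ops"
    and opfun_nonpos: "l \<le> 0 \<Longrightarrow> A l = 0"
    and norm_le_opfun_norm: "norm (A l) \<le> opfun_norm A"
    and opfun_norm_nonneg: "0 \<le> opfun_norm A"
proof -
  have A: "\<And>l. l > 0 \<Longrightarrow> A l \<in> bounded_ops" "\<And>l. l \<le> 0 \<Longrightarrow> A l = 0" "bounded (A ` {0<..})"
    using assms by (auto simp: bounded_opfuns_def)
  then show "A l \<in> bounded_ops" "l \<le> 0 \<Longrightarrow> A l = 0" by (cases "l > 0"; simp)+
  obtain C where C: "\<And>l. l > 0 \<Longrightarrow> norm (A l) \<le> C" using A(3) by (auto simp: bounded_iff)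
  have le: "norm (A l) \<le> opfun_norm A" if "l > 0" for l
    unfolding opfun_norm_def using that C by (intro cSUP_upper) (auto intro!: bdd_aboveI2[of _ _ C])
  show pos: "0 \<le> opfun_norm A" using le[of 1] norm_ge_zero order_trans zero_less_one by blast
  show "norm (A l) \<le> opfun_norm A" using le[of l] pos A(2)[of l] by (cases "l > 0") auto
qed

lemma opfun_norm_le: "(\<And>l. l > 0 \<Longrightarrow> norm (A l) \<le> C) \<Longrightarrow> opfun_norm A \<le> C"
  unfolding opfun_norm_def by (rule cSUP_least) auto

lemma bounded_opfunsI:
  assumes "\<And>l. l > 0 \<Longrightarrow> A l \<in> bounded_ops" "\<And>l. l \<le> 0 \<Longrightarrow> A l = 0" "\<And>l. l > 0 \<Longrightarrow> norm (A l) \<le> C"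
  shows "A \<in> bounded_opfuns"
  using assms by (auto simp: bounded_opfuns_def bounded_iff)

lemma bounded_opfuns_add:
  assumes A: "A \<in> bounded_opfuns" and B: "B \<in> bounded_opfuns"
  shows "(\<lambda>l. A l + B l) \<in> bounded_opfuns"
  by (rule bounded_opfunsI[of _ "opfun_norm A + opfun_norm B"])
     (auto simp: opfun_in_bounded_ops[OF A] opfun_in_bounded_ops[OF B] opfun_nonpos[OF A] opfun_nonpos[OF B]
        intro!: norm_triangle_mono norm_le_opfun_norm A B)

lemma bounded_opfuns_diff:
  assumes A: "A \<in> bounded_opfuns" and B: "B \<in> bounded_opfuns"
  shows "(\<lambda>l. A l - B l) \<in> bounded_opfuns"
  by (rule bounded_opfunsI[of _ "opfun_norm A + opfun_norm B"])
     (auto simp: opfun_in_bounded_ops[OF A] opfun_in_bounded_ops[OF B] opfun_nonpos[OF A] opfun_nonpos[OF B]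
        intro!: order_trans[OF norm_triangle_ineq4] add_mono norm_le_opfun_norm A B)

lemma bounded_opfuns_scaleC:
  assumes A: "A \<in> bounded_opfuns" shows "(\<lambda>l. op_scaleC c (A l)) \<in> bounded_opfuns"
  by (rule bounded_opfunsI[of _ "cmod c * opfun_norm A"])
    (auto simp: opfun_in_bounded_ops[OF A] opfun_nonpos[OF A] intro!: order_trans[OF norm_op_scaleC_le] mult_left_mono norm_le_opfun_norm A)

lemma bounded_opfuns_compose:
  assumes A: "A \<in> bounded_opfuns" and B: "B \<in> bounded_opfuns"
  shows "(\<lambda>l. A l o\<^sub>L B l) \<in> bounded_opfuns"
proof (rule bounded_opfunsI[of _ "opfun_norm A * opfun_norm B"])
  show "A l o\<^sub>L B l = 0" if "l \<le> 0" for l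
    by (rule blinfun_eqI) (simp add: opfun_nonpos[OF A that])
qed (auto simp: opfun_in_bounded_ops[OF A] opfun_in_bounded_ops[OF B]
    intro!: order_trans[OF norm_blinfun_compose] mult_mono norm_le_opfun_norm A B opfun_norm_nonneg)

lemma bounded_opfuns_cadj:
  assumes A: "A \<in> bounded_opfuns" shows "(\<lambda>l. cadj (A l)) \<in> bounded_opfuns"
  by (rule bounded_opfunsI[of _ "opfun_norm A"])
     (auto simp: opfun_in_bounded_ops[OF A] opfun_nonpos[OF A] norm_le_opfun_norm[OF A])

context vacuum_net
begin

section \<open>The action on operator functions\<close>

lemma U_unitary: "L \<in> lorentz \<Longrightarrow> unitary_op (U (x, L))"
  using rep by (auto simp: unitary_rep_def carrier_poincare_group)

lemma U_mult: "L \<in> lorentz \<Longrightarrow> M \<in> lorentz \<Longrightarrow> U (x + L *v y, L ** M) = U (x, L) o\<^sub>L U (y, M)"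
  using rep unfolding unitary_rep_def carrier_poincare_group
  by (metis SigmaI UNIV_I poincare_mult)

lemma U_one: "U (0, mat 1) = id_blinfun"
  using rep by (simp add: unitary_rep_def poincare_group_def)

lemma U_vacuum: "L \<in> lorentz \<Longrightarrow> blinfun_apply (U (x, L)) \<Omega> = \<Omega>"
  using vacuum_invariant by (simp add: carrier_poincare_group)

lemma U_cadj_vacuum: "L \<in> lorentz \<Longrightarrow> blinfun_apply (cadj (U (x, L))) \<Omega> = \<Omega>"
  by (metis U_unitary U_vacuum unitary_op_cadj_apply(1))

lemma act_apply: "l > 0 \<Longrightarrow> scaling_act U (\<mu>, x, L) A l = ad (U ((\<mu> * l) *\<^sub>R x, L)) (A (\<mu> * l))"
  by (simp add: scaling_act_def)

lemma act_nonpos: "l \<le> 0 \<Longrightarrow> scaling_act U g A l = 0"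
  by (cases g) (simp add: scaling_act_def)

text \<open>At each scale the action conjugates the value at another scale by a unitary, and both
  are independent of \<open>A\<close>. Algebraic properties of the action thus reduce to those of
  \<open>ad\<close>.\<close>

lemma act_unitary:
  assumes "g \<in> carrier scaling_group" "l > 0"
  obtains V k where "unitary_op V" "k > 0" "\<And>A. scaling_act U g A l = ad V (A k)"
proof -
  obtain \<mu> x L where "g = (\<mu>, x, L)" by (cases g)
  then show thesis
    using assms that[of "U ((\<mu> * l) *\<^sub>R x, L)" "\<mu> * l"] U_unitary by (auto simp: carrier_scaling_group act_apply)
qed

lemma act_mult:
  assumes g: "g \<in> carrier scaling_group" and h: "h \<in> carrier scaling_group"
  shows "scaling_act U (g \<otimes>\<^bsub>scaling_group\<^esub> h) A = scaling_act U g (scaling_act U h A)"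
proof
  fix l
  obtain \<mu> x L where g': "g = (\<mu>, x, L)" by (cases g)
  obtain \<nu> y M where h': "h = (\<nu>, y, M)" by (cases h)
  have p: "\<mu> > 0" "\<nu> > 0" "L \<in> lorentz" "M \<in> lorentz" using g h by (auto simp: g' h' carrier_scaling_group)
  show "scaling_act U (g \<otimes>\<^bsub>scaling_group\<^esub> h) A l = scaling_act U g (scaling_act U h A) l"
  proof (cases "l > 0")
    case True
    \<comment> \<open>The \<open>inverse \<nu>\<close> in the group law cancels the extra \<nu> by
      which the product rescales the first translation.\<close>
    have "(\<mu> * \<nu> * l) *\<^sub>R (inverse \<nu> *\<^sub>R x + L *v y) = (\<mu> * l) *\<^sub>R x + L *v ((\<nu> * (\<mu> * l)) *\<^sub>R y)"
      using p by (simp add: scaleR_add_right matrix_vector_mult_scaleR mult_ac)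
    then have "U ((\<mu> * \<nu> * l) *\<^sub>R (inverse \<nu> *\<^sub>R x + L *v y), L ** M) =
        U ((\<mu> * l) *\<^sub>R x, L) o\<^sub>L U ((\<nu> * (\<mu> * l)) *\<^sub>R y, M)"
      using U_mult[OF p(3,4)] by simp
    then show ?thesis
      using True p by (simp add: g' h' mult_scaling_group act_apply ad_ad U_unitary mult_ac)
  qed (simp add: act_nonpos)
qed

lemma act_one: "A \<in> bounded_opfuns \<Longrightarrow> scaling_act U (1, 0, mat 1) A = A"
proof
  fix l assume A: "A \<in> bounded_opfuns"
  show "scaling_act U (1, 0, mat 1) A l = A l"
    by (cases "l > 0") (auto simp: act_apply act_nonpos opfun_nonpos[OF A] U_one ad_id_left)
qed

lemma act_add:
  assumes g: "g \<in> carrier scaling_group"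
  shows "scaling_act U g (\<lambda>l. A l + B l) = (\<lambda>l. scaling_act U g A l + scaling_act U g B l)"
    and act_diff: "scaling_act U g (\<lambda>l. A l - B l) = (\<lambda>l. scaling_act U g A l - scaling_act U g B l)"
proof -
  have "scaling_act U g (\<lambda>l. A l + B l) l = scaling_act U g A l + scaling_act U g B l \<and>
    scaling_act U g (\<lambda>l. A l - B l) l = scaling_act U g A l - scaling_act U g B l" for l
  proof (cases "l > 0")
    case True
    then obtain V k where "unitary_op V" "k > 0" "\<And>A. scaling_act U g A l = ad V (A k)"
      using act_unitary[OF g] by blast
    then show ?thesis by (simp add: ad_add ad_diff)
  qed (simp add: act_nonpos)
  then show "scaling_act U g (\<lambda>l. A l + B l) = (\<lambda>l. scaling_act U g A l + scaling_act U g B l)"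
    "scaling_act U g (\<lambda>l. A l - B l) = (\<lambda>l. scaling_act U g A l - scaling_act U g B l)" by blast+
qed

lemma act_scaleC:
  assumes g: "g \<in> carrier scaling_group"
  shows "scaling_act U g (\<lambda>l. op_scaleC c (A l)) = (\<lambda>l. op_scaleC c (scaling_act U g A l))"
proof
  fix l
  show "scaling_act U g (\<lambda>l. op_scaleC c (A l)) l = op_scaleC c (scaling_act U g A l)"
  proof (cases "l > 0")
    case True
    then obtain V k where "unitary_op V" "k > 0" "\<And>A. scaling_act U g A l = ad V (A k)"
      using act_unitary[OF g] by blast
    then show ?thesis by (simp add: ad_op_scaleC unitary_op_bounded_ops)
  qed (simp add: act_nonpos)
qed

lemma act_compose:
  assumes g: "g \<in> carrier scaling_group"
  shows "scaling_act U g (\<lambda>l. A l o\<^sub>L B l) = (\<lambda>l. scaling_act U g A l o\<^sub>L scaling_act U g B l)"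
proof
  fix l
  show "scaling_act U g (\<lambda>l. A l o\<^sub>L B l) l = scaling_act U g A l o\<^sub>L scaling_act U g B l"
  proof (cases "l > 0")
    case True
    then obtain V k where "unitary_op V" "k > 0" "\<And>A. scaling_act U g A l = ad V (A k)"
      using act_unitary[OF g] by blast
    then show ?thesis by (simp add: ad_compose)
  next
    case False
    have "(0 :: 'h \<Rightarrow>\<^sub>L 'h) o\<^sub>L 0 = 0" by (rule blinfun_eqI) simp
    then show ?thesis using False by (simp add: act_nonpos)
  qed
qed

lemma act_cadj:
  assumes g: "g \<in> carrier scaling_group" and A: "A \<in> bounded_opfuns"
  shows "scaling_act U g (\<lambda>l. cadj (A l)) = (\<lambda>l. cadj (scaling_act U g A l))"
proof
  fix l
  show "scaling_act U g (\<lambda>l. cadj (A l)) l = cadj (scaling_act U g A l)"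
  proof (cases "l > 0")
    case True
    then obtain V k where "unitary_op V" "k > 0" "\<And>A. scaling_act U g A l = ad V (A k)"
      using act_unitary[OF g] by blast
    then show ?thesis by (simp add: ad_cadj opfun_in_bounded_ops[OF A])
  qed (simp add: act_nonpos)
qed

lemma act_norm_le:
  assumes g: "g \<in> carrier scaling_group" and A: "A \<in> bounded_opfuns"
  shows "norm (scaling_act U g A l) \<le> opfun_norm A"
proof (cases "l > 0")
  case True
  then obtain V k where "unitary_op V" "k > 0" "\<And>A. scaling_act U g A l = ad V (A k)"
    using act_unitary[OF g] by blast
  then show ?thesis using norm_ad_le[of V "A k"] norm_le_opfun_norm[OF A, of k] by simp
qed (simp add: act_nonpos opfun_norm_nonneg[OF A])

lemma act_bounded_opfuns:
  assumes g: "g \<in> carrier scaling_group" and A: "A \<in> bounded_opfuns"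
  shows "scaling_act U g A \<in> bounded_opfuns"
proof (rule bounded_opfunsI[OF _ act_nonpos act_norm_le[OF g A]])
  fix l :: real assume "l > 0"
  then obtain V k where "unitary_op V" "k > 0" "\<And>A. scaling_act U g A l = ad V (A k)"
    using act_unitary[OF g] by blast
  then show "scaling_act U g A l \<in> bounded_ops" by (simp add: ad_bounded_ops opfun_in_bounded_ops[OF A])
qed

section \<open>Norm continuity of orbits\<close>

definition act_dist :: "'h opfun \<Rightarrow> real \<times> 's spacetime \<times> 's stmatrix \<Rightarrow> real \<times> 's spacetime \<times> 's stmatrix \<Rightarrow> real" where
  "act_dist A g h = opfun_norm (\<lambda>l. scaling_act U h A l - scaling_act U g A l)"

text \<open>Norm continuity is separated from localisation, so that its permanence properties can be
  proved without reference to a region.\<close>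

definition act_continuous :: "'h opfun \<Rightarrow> bool" where
  "act_continuous A \<longleftrightarrow> A \<in> bounded_opfuns \<and>
     (\<forall>g\<in>carrier scaling_group. (act_dist A g \<longlongrightarrow> 0) (at g within carrier scaling_group))"

lemma scaling_local_algebra_iff:
  "A \<in> scaling_local_algebra \<AA> U R \<longleftrightarrow> act_continuous A \<and> (\<forall>l>0. A l \<in> \<AA> ((\<lambda>y. l *\<^sub>R y) ` R))"
  by (auto simp: scaling_local_algebra_def act_continuous_def act_dist_def[abs_def])

lemma act_dist_upper:
  assumes A: "A \<in> bounded_opfuns" and g: "g \<in> carrier scaling_group" "h \<in> carrier scaling_group"
  shows "norm (scaling_act U h A l - scaling_act U g A l) \<le> act_dist A g h" "0 \<le> act_dist A g h"
  unfolding act_dist_def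
  using norm_le_opfun_norm[OF bounded_opfuns_diff[OF act_bounded_opfuns[OF g(2) A] act_bounded_opfuns[OF g(1) A]]]
    opfun_norm_nonneg[OF bounded_opfuns_diff[OF act_bounded_opfuns[OF g(2) A] act_bounded_opfuns[OF g(1) A]]] by auto

lemma act_continuousI:
  assumes A: "A \<in> bounded_opfuns"
    and le: "\<And>g h l. g \<in> carrier scaling_group \<Longrightarrow> h \<in> carrier scaling_group \<Longrightarrow> l > 0 \<Longrightarrow>
      norm (scaling_act U h A l - scaling_act U g A l) \<le> F g h"
    and lim: "\<And>g. g \<in> carrier scaling_group \<Longrightarrow> (F g \<longlongrightarrow> 0) (at g within carrier scaling_group)"
  shows "act_continuous A"
  unfolding act_continuous_def
proof (intro conjI A ballI)
  fix g :: "real \<times> 's spacetime \<times> 's stmatrix" assume g: "g \<in> carrier scaling_group"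
  show "(act_dist A g \<longlongrightarrow> 0) (at g within carrier scaling_group)"
  proof (rule Lim_null_comparison[OF _ lim[OF g]])
    have "norm (act_dist A g h) \<le> F g h" if h: "h \<in> carrier scaling_group" for h
      using act_dist_upper(2)[OF A g h] le[OF g h] unfolding act_dist_def by (simp add: opfun_norm_le)
    then show "\<forall>\<^sub>F h in at g within carrier scaling_group. norm (act_dist A g h) \<le> F g h"
      by (auto simp: eventually_at_filter)
  qed
qed

lemma act_continuous_lim:
  "act_continuous A \<Longrightarrow> g \<in> carrier scaling_group \<Longrightarrow> (act_dist A g \<longlongrightarrow> 0) (at g within carrier scaling_group)"
  by (simp add: act_continuous_def)

lemma act_continuous_add:
  assumes A: "act_continuous A" and B: "act_continuous B"
  shows "act_continuous (\<lambda>l. A l + B l)"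
proof (rule act_continuousI[where F = "\<lambda>g h. act_dist A g h + act_dist B g h"])
  have b: "A \<in> bounded_opfuns" "B \<in> bounded_opfuns" using A B by (auto simp: act_continuous_def)
  then show "(\<lambda>l. A l + B l) \<in> bounded_opfuns" by (rule bounded_opfuns_add)
  fix g h :: "real \<times> 's spacetime \<times> 's stmatrix" and l :: real
  assume g: "g \<in> carrier scaling_group"
  show "((\<lambda>h. act_dist A g h + act_dist B g h) \<longlongrightarrow> 0) (at g within carrier scaling_group)"
    using tendsto_add[OF act_continuous_lim[OF A g] act_continuous_lim[OF B g]] by simp
  assume h: "h \<in> carrier scaling_group"
  show "norm (scaling_act U h (\<lambda>l. A l + B l) l - scaling_act U g (\<lambda>l. A l + B l) l) \<le> act_dist A g h + act_dist B g h"
    unfolding act_add[OF g] act_add[OF h]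
    using norm_triangle_mono[OF act_dist_upper(1)[OF b(1) g h] act_dist_upper(1)[OF b(2) g h], of l l]
    by (simp add: add_diff_add)
qed

lemma act_continuous_scaleC:
  assumes A: "act_continuous A" shows "act_continuous (\<lambda>l. op_scaleC c (A l))"
proof (rule act_continuousI[where F = "\<lambda>g h. cmod c * act_dist A g h"])
  have b: "A \<in> bounded_opfuns" using A by (auto simp: act_continuous_def)
  then show "(\<lambda>l. op_scaleC c (A l)) \<in> bounded_opfuns" by (rule bounded_opfuns_scaleC)
  fix g h :: "real \<times> 's spacetime \<times> 's stmatrix" and l :: real
  assume g: "g \<in> carrier scaling_group"
  show "((\<lambda>h. cmod c * act_dist A g h) \<longlongrightarrow> 0) (at g within carrier scaling_group)"
    using tendsto_mult[OF tendsto_const act_continuous_lim[OF A g], of "cmod c"] by simp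
  assume h: "h \<in> carrier scaling_group"
  show "norm (scaling_act U h (\<lambda>l. op_scaleC c (A l)) l - scaling_act U g (\<lambda>l. op_scaleC c (A l)) l) \<le> cmod c * act_dist A g h"
    unfolding act_scaleC[OF g] act_scaleC[OF h] op_scaleC_diff
    by (auto intro!: order_trans[OF norm_op_scaleC_le] mult_left_mono act_dist_upper(1)[OF b g h])
qed

lemma act_continuous_cadj:
  assumes A: "act_continuous A" shows "act_continuous (\<lambda>l. cadj (A l))"
proof (rule act_continuousI[where F = "act_dist A"])
  have b: "A \<in> bounded_opfuns" using A by (auto simp: act_continuous_def)
  then show "(\<lambda>l. cadj (A l)) \<in> bounded_opfuns" by (rule bounded_opfuns_cadj)
  fix g h :: "real \<times> 's spacetime \<times> 's stmatrix" and l :: real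
  assume g: "g \<in> carrier scaling_group"
  show "(act_dist A g \<longlongrightarrow> 0) (at g within carrier scaling_group)" by (rule act_continuous_lim[OF A g])
  assume h: "h \<in> carrier scaling_group"
  note bo = opfun_in_bounded_ops[OF act_bounded_opfuns[OF h b]] opfun_in_bounded_ops[OF act_bounded_opfuns[OF g b]]
  show "norm (scaling_act U h (\<lambda>l. cadj (A l)) l - scaling_act U g (\<lambda>l. cadj (A l)) l) \<le> act_dist A g h"
    unfolding act_cadj[OF g b] act_cadj[OF h b] cadj_diff[OF bo, symmetric]
    using act_dist_upper(1)[OF b g h, of l] bo by simp
qed

lemma act_continuous_compose:
  assumes A: "act_continuous A" and B: "act_continuous B"
  shows "act_continuous (\<lambda>l. A l o\<^sub>L B l)"
proof (rule act_continuousI[where F = "\<lambda>g h. act_dist A g h * opfun_norm B + opfun_norm A * act_dist B g h"])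
  have b: "A \<in> bounded_opfuns" "B \<in> bounded_opfuns" using A B by (auto simp: act_continuous_def)
  then show "(\<lambda>l. A l o\<^sub>L B l) \<in> bounded_opfuns" by (rule bounded_opfuns_compose)
  fix g h :: "real \<times> 's spacetime \<times> 's stmatrix" and l :: real
  assume g: "g \<in> carrier scaling_group"
  have "((\<lambda>h. act_dist A g h * opfun_norm B + opfun_norm A * act_dist B g h) \<longlongrightarrow> 0 * opfun_norm B + opfun_norm A * 0) (at g within carrier scaling_group)"
    by (intro tendsto_intros act_continuous_lim[OF A g] act_continuous_lim[OF B g])
  then show "((\<lambda>h. act_dist A g h * opfun_norm B + opfun_norm A * act_dist B g h) \<longlongrightarrow> 0) (at g within carrier scaling_group)"
    by simp
  assume h: "h \<in> carrier scaling_group"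
  have eq: "(S o\<^sub>L T) - (S' o\<^sub>L T') = ((S - S') o\<^sub>L T) + (S' o\<^sub>L (T - T'))" for S T S' T' :: "'h \<Rightarrow>\<^sub>L 'h"
    by (rule blinfun_eqI) (simp add: blinfun.diff_left blinfun.add_left blinfun.diff_right)
  show "norm (scaling_act U h (\<lambda>l. A l o\<^sub>L B l) l - scaling_act U g (\<lambda>l. A l o\<^sub>L B l) l)
      \<le> act_dist A g h * opfun_norm B + opfun_norm A * act_dist B g h"
    unfolding act_compose[OF g] act_compose[OF h] eq
    by (intro norm_triangle_mono order_trans[OF norm_blinfun_compose] mult_mono act_dist_upper[OF b(1) g h]
        act_dist_upper[OF b(2) g h] act_norm_le g h b norm_ge_zero opfun_norm_nonneg)
qed

lemma act_continuous_act:
  assumes A: "act_continuous A" and k: "k \<in> carrier scaling_group"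
  shows "act_continuous (scaling_act U k A)"
proof (rule act_continuousI[where F = "\<lambda>g h. act_dist A (g \<otimes>\<^bsub>scaling_group\<^esub> k) (h \<otimes>\<^bsub>scaling_group\<^esub> k)"])
  interpret G: group "scaling_group :: (real \<times> 's spacetime \<times> 's stmatrix) monoid" by (rule group_scaling_group)
  have b: "A \<in> bounded_opfuns" using A by (auto simp: act_continuous_def)
  then show "scaling_act U k A \<in> bounded_opfuns" by (rule act_bounded_opfuns[OF k])
  fix g h :: "real \<times> 's spacetime \<times> 's stmatrix" and l :: real
  assume g: "g \<in> carrier scaling_group"
  have gk: "g \<otimes>\<^bsub>scaling_group\<^esub> k \<in> carrier scaling_group" using g k by simp
  \<comment> \<open>The given limit leaves out the limit point itself. Composition with right
    multiplication goes through continuity, for which the value at that point must be known.\<close>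
  have "act_dist A (g \<otimes>\<^bsub>scaling_group\<^esub> k) (g \<otimes>\<^bsub>scaling_group\<^esub> k) = 0"
    by (simp add: act_dist_def opfun_norm_def)
  then have "continuous (at (g \<otimes>\<^bsub>scaling_group\<^esub> k) within carrier scaling_group) (act_dist A (g \<otimes>\<^bsub>scaling_group\<^esub> k))"
    unfolding continuous_within using act_continuous_lim[OF A gk] by simp
  then have "((\<lambda>h. act_dist A (g \<otimes>\<^bsub>scaling_group\<^esub> k) (h \<otimes>\<^bsub>scaling_group\<^esub> k)) \<longlongrightarrow>
      act_dist A (g \<otimes>\<^bsub>scaling_group\<^esub> k) (g \<otimes>\<^bsub>scaling_group\<^esub> k)) (at g within carrier scaling_group)"
    by (rule continuous_within_tendsto_compose[OF _ _ continuous_mult_right_scaling_group])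
       (use k in \<open>simp add: eventually_at_filter\<close>)
  then show "((\<lambda>h. act_dist A (g \<otimes>\<^bsub>scaling_group\<^esub> k) (h \<otimes>\<^bsub>scaling_group\<^esub> k)) \<longlongrightarrow> 0) (at g within carrier scaling_group)"
    by (simp add: \<open>act_dist A (g \<otimes>\<^bsub>scaling_group\<^esub> k) (g \<otimes>\<^bsub>scaling_group\<^esub> k) = 0\<close>)
  assume h: "h \<in> carrier scaling_group"
  have hk: "h \<otimes>\<^bsub>scaling_group\<^esub> k \<in> carrier scaling_group" using h k by simp
  show "norm (scaling_act U h (scaling_act U k A) l - scaling_act U g (scaling_act U k A) l)
      \<le> act_dist A (g \<otimes>\<^bsub>scaling_group\<^esub> k) (h \<otimes>\<^bsub>scaling_group\<^esub> k)"
    unfolding act_mult[OF g k, symmetric] act_mult[OF h k, symmetric] by (rule act_dist_upper(1)[OF b gk hk])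
qed

section \<open>Local scaling algebras and their norm closure\<close>

lemma regions_Un: "R \<in> regions \<Longrightarrow> S \<in> regions \<Longrightarrow> R \<union> S \<in> regions"
  by (auto simp: regions_def)

lemma regions_scale: "R \<in> regions \<Longrightarrow> l > 0 \<Longrightarrow> (\<lambda>y. l *\<^sub>R y) ` R \<in> regions"
  by (auto simp: regions_def open_scaling bounded_scaling)

lemma regions_act:
  assumes R: "R \<in> regions" and g: "(\<mu>, x, L) \<in> carrier scaling_group"
  shows "(\<lambda>y. \<mu> *\<^sub>R (L *v y + x)) ` R \<in> regions"
proof -
  have L: "L \<in> lorentz" and \<mu>: "\<mu> > 0" using g by (auto simp: carrier_scaling_group)
  obtain M where "L ** M = mat 1" using lorentz_inverse[OF L] by blast
  then have "surj ((*v) L)"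
    by (intro surjI[of _ "(*v) M"]) (simp add: matrix_vector_mul_assoc)
  then have "open ((*v) L ` R)"
    using R by (intro open_surjective_linear_image matrix_vector_mul_linear) (simp_all add: regions_def)
  moreover have "bounded ((*v) L ` R)"
    using R by (intro bounded_linear_image matrix_vector_mul_bounded_linear) (simp add: regions_def)
  ultimately have "open ((*v) L ` R)" "bounded ((*v) L ` R)" .
  then have "open ((+) x ` (*v) L ` R)" "bounded ((+) x ` (*v) L ` R)"
    by (auto intro: open_translation bounded_translation)
  then have "(+) x ` (*v) L ` R \<in> regions" by (simp add: regions_def)
  from regions_scale[OF this \<mu>] show ?thesis by (simp add: image_image add.commute)
qed

lemma local_algebra_mono:
  assumes "R \<in> regions" "S \<in> regions" "R \<subseteq> S"
  shows "scaling_local_algebra \<AA> U R \<subseteq> scaling_local_algebra \<AA> U S"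
  using isotony[OF regions_scale[OF assms(1)] regions_scale[OF assms(2)] image_mono[OF assms(3)]]
  by (auto simp: scaling_local_algebra_iff subset_iff)

lemma
  assumes R: "R \<in> regions" and A: "A \<in> scaling_local_algebra \<AA> U R"
  shows local_algebra_add: "B \<in> scaling_local_algebra \<AA> U R \<Longrightarrow> (\<lambda>l. A l + B l) \<in> scaling_local_algebra \<AA> U R"
    and local_algebra_compose: "B \<in> scaling_local_algebra \<AA> U R \<Longrightarrow> (\<lambda>l. A l o\<^sub>L B l) \<in> scaling_local_algebra \<AA> U R"
    and local_algebra_scaleC: "(\<lambda>l. op_scaleC c (A l)) \<in> scaling_local_algebra \<AA> U R"
    and local_algebra_cadj: "(\<lambda>l. cadj (A l)) \<in> scaling_local_algebra \<AA> U R"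
  using algebras[OF regions_scale[OF R]] A
  by (auto simp: scaling_local_algebra_iff act_continuous_add act_continuous_compose act_continuous_scaleC
      act_continuous_cadj W_star_algebra_def)

lemma local_algebra_act:
  assumes R: "R \<in> regions" and A: "A \<in> scaling_local_algebra \<AA> U R" and g: "(\<mu>, x, L) \<in> carrier scaling_group"
  shows "scaling_act U (\<mu>, x, L) A \<in> scaling_local_algebra \<AA> U ((\<lambda>y. \<mu> *\<^sub>R (L *v y + x)) ` R)"
proof -
  have L: "L \<in> lorentz" and \<mu>: "\<mu> > 0" using g by (auto simp: carrier_scaling_group)
  have "scaling_act U (\<mu>, x, L) A l \<in> \<AA> ((\<lambda>y. l *\<^sub>R y) ` (\<lambda>y. \<mu> *\<^sub>R (L *v y + x)) ` R)" if l: "l > 0" for l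
  proof -
    have ml: "\<mu> * l > 0" using \<mu> l by simp
    \<comment> \<open>The dilation by \<open>\<mu> * l\<close> commutes with the Lorentz part and
      rescales the translation, so it can be moved outside.\<close>
    have "poincare_act ((\<mu> * l) *\<^sub>R x, L) ` (\<lambda>y. (\<mu> * l) *\<^sub>R y) ` R = (\<lambda>y. l *\<^sub>R y) ` (\<lambda>y. \<mu> *\<^sub>R (L *v y + x)) ` R"
      unfolding image_image
      by (rule image_cong) (auto simp: poincare_act_def matrix_vector_mult_scaleR scaleR_add_right mult.commute)
    moreover have "ad (U ((\<mu> * l) *\<^sub>R x, L)) ` \<AA> ((\<lambda>y. (\<mu> * l) *\<^sub>R y) ` R) =
        \<AA> (poincare_act ((\<mu> * l) *\<^sub>R x, L) ` (\<lambda>y. (\<mu> * l) *\<^sub>R y) ` R)"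
      using L by (intro covariance regions_scale[OF R ml]) (simp add: carrier_poincare_group)
    moreover have "A (\<mu> * l) \<in> \<AA> ((\<lambda>y. (\<mu> * l) *\<^sub>R y) ` R)"
      using A ml by (simp add: scaling_local_algebra_iff)
    ultimately show ?thesis using l by (auto simp: act_apply)
  qed
  then show ?thesis
    using act_continuous_act[OF _ g] A by (simp add: scaling_local_algebra_iff)
qed

abbreviation \<AA>\<^sub>s where "\<AA>\<^sub>s \<equiv> scaling_algebra \<AA> U"

lemma scaling_algebra_bounded: "A \<in> \<AA>\<^sub>s \<Longrightarrow> A \<in> bounded_opfuns"
  by (simp add: scaling_algebra_def)

lemma scaling_algebra_approx:
  assumes A: "A \<in> \<AA>\<^sub>s" and e: "e > 0"
  obtains R B where "R \<in> regions" "B \<in> scaling_local_algebra \<AA> U R" "\<forall>l. norm (A l - B l) < e" "B \<in> bounded_opfuns"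
proof -
  obtain R B where RB: "R \<in> regions" "B \<in> scaling_local_algebra \<AA> U R" "opfun_norm (\<lambda>l. A l - B l) < e"
    using A e by (auto simp: scaling_algebra_def)
  have b: "B \<in> bounded_opfuns" using RB(2) by (simp add: scaling_local_algebra_iff act_continuous_def)
  have "norm (A l - B l) < e" for l
    using norm_le_opfun_norm[OF bounded_opfuns_diff[OF scaling_algebra_bounded[OF A] b], of l] RB(3) by simp
  then show thesis using that RB b by blast
qed

lemma scaling_algebraI:
  assumes A: "A \<in> bounded_opfuns"
    and ap: "\<And>e. e > 0 \<Longrightarrow> \<exists>R\<in>regions. \<exists>B\<in>scaling_local_algebra \<AA> U R. \<forall>l>0. norm (A l - B l) \<le> e"
  shows "A \<in> \<AA>\<^sub>s"
proof -
  have "\<exists>R\<in>regions. \<exists>B\<in>scaling_local_algebra \<AA> U R. opfun_norm (\<lambda>l. A l - B l) < e" if "e > 0" for e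
  proof -
    obtain R B where "R \<in> regions" "B \<in> scaling_local_algebra \<AA> U R" "\<And>l. l > 0 \<Longrightarrow> norm (A l - B l) \<le> e / 2"
      using ap[of "e / 2"] \<open>e > 0\<close> by auto
    moreover from this have "opfun_norm (\<lambda>l. A l - B l) \<le> e / 2" by (intro opfun_norm_le)
    ultimately show ?thesis using \<open>e > 0\<close> by (intro bexI[of _ R] bexI[of _ B]) auto
  qed
  then show ?thesis using A by (simp add: scaling_algebra_def)
qed

lemma scaling_algebra_add:
  assumes A: "A \<in> \<AA>\<^sub>s" and B: "B \<in> \<AA>\<^sub>s" shows "(\<lambda>l. A l + B l) \<in> \<AA>\<^sub>s"
proof (rule scaling_algebraI)
  show "(\<lambda>l. A l + B l) \<in> bounded_opfuns" by (intro bounded_opfuns_add scaling_algebra_bounded A B)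
  fix e :: real assume e: "e > 0"
  then have e2: "e / 2 > 0" by simp
  obtain R A' where A': "R \<in> regions" "A' \<in> scaling_local_algebra \<AA> U R" "\<forall>l. norm (A l - A' l) < e / 2" "A' \<in> bounded_opfuns"
    using scaling_algebra_approx[OF A e2] by blast
  obtain S B' where B': "S \<in> regions" "B' \<in> scaling_local_algebra \<AA> U S" "\<forall>l. norm (B l - B' l) < e / 2" "B' \<in> bounded_opfuns"
    using scaling_algebra_approx[OF B e2] by blast
  note RS = regions_Un[OF A'(1) B'(1)]
  have "A' \<in> scaling_local_algebra \<AA> U (R \<union> S)" "B' \<in> scaling_local_algebra \<AA> U (R \<union> S)"
    using local_algebra_mono[OF A'(1) RS] local_algebra_mono[OF B'(1) RS] A'(2) B'(2) by auto
  moreover have "norm (A l + B l - (A' l + B' l)) \<le> e" for l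
    using norm_triangle_mono[OF less_imp_le[OF A'(3)[rule_format]] less_imp_le[OF B'(3)[rule_format]], of l l] by (simp add: add_diff_add)
  ultimately show "\<exists>R\<in>regions. \<exists>C\<in>scaling_local_algebra \<AA> U R. \<forall>l>0. norm (A l + B l - C l) \<le> e"
    using RS local_algebra_add[OF RS] by (intro bexI[of _ "R \<union> S"] bexI[of _ "\<lambda>l. A' l + B' l"]) auto
qed

lemma scaling_algebra_compose:
  assumes A: "A \<in> \<AA>\<^sub>s" and B: "B \<in> \<AA>\<^sub>s" shows "(\<lambda>l. A l o\<^sub>L B l) \<in> \<AA>\<^sub>s"
proof (rule scaling_algebraI)
  note b = scaling_algebra_bounded[OF A] scaling_algebra_bounded[OF B]
  show "(\<lambda>l. A l o\<^sub>L B l) \<in> bounded_opfuns" by (intro bounded_opfuns_compose b)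
  fix e :: real assume e: "e > 0"
  define K where "K = opfun_norm A + opfun_norm B + 1"
  have K: "K > 0" "opfun_norm A + 1 \<le> K" "opfun_norm B \<le> K" using opfun_norm_nonneg[OF b(1)] opfun_norm_nonneg[OF b(2)] by (auto simp: K_def)
  \<comment> \<open>\<open>d \<le> 1\<close> keeps the norm of \<open>A' l\<close> below
    \<open>K\<close>, and \<open>2 * K * d \<le> e\<close> pays for replacing the two factors in
    turn.\<close>
  define d where "d = min 1 (e / (2 * K))"
  have d: "d > 0" "d \<le> 1" "2 * K * d \<le> e" using e K by (auto simp: d_def min_def field_simps)
  obtain R A' where A': "R \<in> regions" "A' \<in> scaling_local_algebra \<AA> U R" "\<forall>l. norm (A l - A' l) < d" "A' \<in> bounded_opfuns"
    using scaling_algebra_approx[OF A d(1)] by blast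
  obtain S B' where B': "S \<in> regions" "B' \<in> scaling_local_algebra \<AA> U S" "\<forall>l. norm (B l - B' l) < d" "B' \<in> bounded_opfuns"
    using scaling_algebra_approx[OF B d(1)] by blast
  note RS = regions_Un[OF A'(1) B'(1)]
  have "A' \<in> scaling_local_algebra \<AA> U (R \<union> S)" "B' \<in> scaling_local_algebra \<AA> U (R \<union> S)"
    using local_algebra_mono[OF A'(1) RS] local_algebra_mono[OF B'(1) RS] A'(2) B'(2) by auto
  moreover have "norm ((A l o\<^sub>L B l) - (A' l o\<^sub>L B' l)) \<le> e" for l
  proof -
    have eq: "(A l o\<^sub>L B l) - (A' l o\<^sub>L B' l) = ((A l - A' l) o\<^sub>L B l) + (A' l o\<^sub>L (B l - B' l))"
      by (rule blinfun_eqI) (simp add: blinfun.diff_left blinfun.add_left blinfun.diff_right)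
    have "norm (A' l) \<le> norm (A l) + norm (A l - A' l)"
      by (metis norm_triangle_sub norm_minus_commute)
    then have "norm (A' l) \<le> K" using norm_le_opfun_norm[OF b(1), of l] A'(3)[rule_format, of l] d(2) K(2) by linarith
    moreover have "norm (B l) \<le> K" using norm_le_opfun_norm[OF b(2), of l] K(3) by linarith
    ultimately have "norm ((A l o\<^sub>L B l) - (A' l o\<^sub>L B' l)) \<le> d * K + K * d"
      unfolding eq using A'(3)[rule_format, of l] B'(3)[rule_format, of l] d K
      by (intro norm_triangle_mono order_trans[OF norm_blinfun_compose] mult_mono) auto
    then show ?thesis using d(3) by (simp add: mult_ac)
  qed
  ultimately show "\<exists>R\<in>regions. \<exists>C\<in>scaling_local_algebra \<AA> U R. \<forall>l>0. norm ((A l o\<^sub>L B l) - C l) \<le> e"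
    using RS local_algebra_compose[OF RS] by (intro bexI[of _ "R \<union> S"] bexI[of _ "\<lambda>l. A' l o\<^sub>L B' l"]) auto
qed

lemma scaling_algebra_scaleC:
  assumes A: "A \<in> \<AA>\<^sub>s" shows "(\<lambda>l. op_scaleC c (A l)) \<in> \<AA>\<^sub>s"
proof (rule scaling_algebraI)
  show "(\<lambda>l. op_scaleC c (A l)) \<in> bounded_opfuns" by (intro bounded_opfuns_scaleC scaling_algebra_bounded A)
  fix e :: real assume e: "e > 0"
  define d where "d = e / (cmod c + 1)"
  have "e / (x + 1) > 0 \<and> x * (e / (x + 1)) \<le> e" if "x \<ge> 0" for x :: real
    using e that by (simp add: field_simps)
  then have d: "d > 0" "cmod c * d \<le> e" by (simp_all add: d_def)
  obtain R A' where A': "R \<in> regions" "A' \<in> scaling_local_algebra \<AA> U R" "\<forall>l. norm (A l - A' l) < d" "A' \<in> bounded_opfuns"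
    using scaling_algebra_approx[OF A d(1)] by blast
  have "norm (op_scaleC c (A l - A' l)) \<le> e" for l
    using norm_op_scaleC_le[of c "A l - A' l"] mult_left_mono[OF less_imp_le[OF A'(3)[rule_format]], of "cmod c" l] d(2) by simp
  then show "\<exists>R\<in>regions. \<exists>C\<in>scaling_local_algebra \<AA> U R. \<forall>l>0. norm (op_scaleC c (A l) - C l) \<le> e"
    unfolding op_scaleC_diff[symmetric] using local_algebra_scaleC[OF A'(1,2), of c] by (intro bexI[OF _ A'(1)] bexI) auto
qed

lemma scaling_algebra_cadj:
  assumes A: "A \<in> \<AA>\<^sub>s" shows "(\<lambda>l. cadj (A l)) \<in> \<AA>\<^sub>s"
proof (rule scaling_algebraI)
  note b = scaling_algebra_bounded[OF A]
  show "(\<lambda>l. cadj (A l)) \<in> bounded_opfuns" by (intro bounded_opfuns_cadj b)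
  fix e :: real assume e: "e > 0"
  obtain R A' where A': "R \<in> regions" "A' \<in> scaling_local_algebra \<AA> U R" "\<forall>l. norm (A l - A' l) < e" "A' \<in> bounded_opfuns"
    using scaling_algebra_approx[OF A e] by blast
  have "norm (cadj (A l) - cadj (A' l)) \<le> e" for l
    using A'(3)[rule_format, of l] opfun_in_bounded_ops[OF b] opfun_in_bounded_ops[OF A'(4)]
    by (simp add: cadj_diff[symmetric])
  then show "\<exists>R\<in>regions. \<exists>C\<in>scaling_local_algebra \<AA> U R. \<forall>l>0. norm (cadj (A l) - C l) \<le> e"
    using local_algebra_cadj[OF A'(1,2)] by (intro bexI[OF _ A'(1)] bexI) auto
qed

lemma scaling_algebra_act:
  assumes A: "A \<in> \<AA>\<^sub>s" and g: "g \<in> carrier scaling_group" shows "scaling_act U g A \<in> \<AA>\<^sub>s"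
proof (rule scaling_algebraI)
  note b = scaling_algebra_bounded[OF A]
  show "scaling_act U g A \<in> bounded_opfuns" by (intro act_bounded_opfuns g b)
  fix e :: real assume e: "e > 0"
  obtain R A' where A': "R \<in> regions" "A' \<in> scaling_local_algebra \<AA> U R" "\<forall>l. norm (A l - A' l) < e" "A' \<in> bounded_opfuns"
    using scaling_algebra_approx[OF A e] by blast
  obtain \<mu> x L where g': "g = (\<mu>, x, L)" by (cases g)
  have "norm (scaling_act U g A l - scaling_act U g A' l) \<le> e" for l
  proof -
    have "norm (scaling_act U g (\<lambda>l. A l - A' l) l) \<le> opfun_norm (\<lambda>l. A l - A' l)"
      by (rule act_norm_le[OF g bounded_opfuns_diff[OF b A'(4)]])
    also have "\<dots> \<le> e" using A'(3)[rule_format] by (intro opfun_norm_le) (auto intro: less_imp_le)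
    finally show ?thesis by (simp add: act_diff[OF g])
  qed
  then show "\<exists>R\<in>regions. \<exists>C\<in>scaling_local_algebra \<AA> U R. \<forall>l>0. norm (scaling_act U g A l - C l) \<le> e"
    using local_algebra_act[OF A'(1,2), of \<mu> x L] regions_act[OF A'(1), of \<mu> x L] g unfolding g'
    by (intro bexI) auto
qed

text \<open>Every \<alpha>_h is a contraction, so approximating \<open>A\<close> in norm
  approximates its whole orbit uniformly, and continuity passes to the norm closure.\<close>

lemma scaling_algebra_continuous:
  assumes A: "A \<in> \<AA>\<^sub>s" shows "act_continuous A"
  unfolding act_continuous_def
proof (intro conjI ballI)
  note b = scaling_algebra_bounded[OF A]
  then show "A \<in> bounded_opfuns" .
  fix g :: "real \<times> 's spacetime \<times> 's stmatrix" assume g: "g \<in> carrier scaling_group"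
  show "(act_dist A g \<longlongrightarrow> 0) (at g within carrier scaling_group)"
  proof (rule tendstoI)
    fix e :: real assume e: "e > 0"
    then have e4: "e / 4 > 0" by simp
    obtain R A' where A': "R \<in> regions" "A' \<in> scaling_local_algebra \<AA> U R" "\<forall>l. norm (A l - A' l) < e / 4" "A' \<in> bounded_opfuns"
      using scaling_algebra_approx[OF A e4] by blast
    have le: "norm (scaling_act U h A l - scaling_act U h A' l) \<le> e / 4" if h: "h \<in> carrier scaling_group" for h l
    proof -
      have "norm (scaling_act U h (\<lambda>l. A l - A' l) l) \<le> opfun_norm (\<lambda>l. A l - A' l)"
        by (rule act_norm_le[OF h bounded_opfuns_diff[OF b A'(4)]])
      also have "\<dots> \<le> e / 4" using A'(3)[rule_format] by (intro opfun_norm_le) (auto intro: less_imp_le)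
      finally show ?thesis by (simp add: act_diff[OF h])
    qed
    have "(act_dist A' g \<longlongrightarrow> 0) (at g within carrier scaling_group)"
      using A'(2) g by (simp add: scaling_local_algebra_iff act_continuous_lim)
    then have "\<forall>\<^sub>F h in at g within carrier scaling_group. act_dist A' g h < e / 4"
      using e4 by (rule order_tendstoD(2))
    moreover have "\<forall>\<^sub>F h in at g within carrier scaling_group. h \<in> carrier scaling_group"
      by (simp add: eventually_at_filter)
    ultimately show "\<forall>\<^sub>F h in at g within carrier scaling_group. dist (act_dist A g h) 0 < e"
    proof eventually_elim
      case (elim h)
      \<comment> \<open>Three quarters leave room for a strict inequality, as the supremum in
        \<open>act_dist\<close> yields only \<le>.\<close>
      have "act_dist A g h \<le> 3 * (e / 4)" unfolding act_dist_def
      proof (rule opfun_norm_le)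
        fix l :: real
        have "scaling_act U h A l - scaling_act U g A l = (scaling_act U h A l - scaling_act U h A' l) +
            (scaling_act U h A' l - scaling_act U g A' l) + (scaling_act U g A' l - scaling_act U g A l)" by simp
        also have "norm \<dots> \<le> e / 4 + e / 4 + e / 4"
          using le[OF elim(2)] le[OF g] act_dist_upper(1)[OF A'(4) g elim(2), of l] elim(1)
          by (intro norm_triangle_mono) (auto simp: norm_minus_commute)
        finally show "norm (scaling_act U h A l - scaling_act U g A l) \<le> 3 * (e / 4)" by simp
      qed
      then show ?case using act_dist_upper(2)[OF b g elim(2)] e by simp
    qed
  qed
qed

text \<open>The unit of the scaling algebra; it vanishes for \<open>l \<le> 0\<close> by the
  convention for operator functions.\<close>

definition opfun_one :: "'h opfun" where
  "opfun_one l = (if l > 0 then id_blinfun else 0)"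

lemma act_opfun_one: assumes g: "g \<in> carrier scaling_group" shows "scaling_act U g opfun_one = opfun_one"
proof
  fix l
  show "scaling_act U g opfun_one l = opfun_one l"
  proof (cases "l > 0")
    case True
    then obtain V k where "unitary_op V" "k > 0" "\<And>A. scaling_act U g A l = ad V (A k)"
      using act_unitary[OF g] by blast
    then show ?thesis using True by (simp add: opfun_one_def ad_id)
  qed (simp add: act_nonpos opfun_one_def)
qed

lemma opfun_one_in_scaling_algebra: "opfun_one \<in> \<AA>\<^sub>s"
proof -
  have b: "opfun_one \<in> bounded_opfuns"
    by (rule bounded_opfunsI[of _ 1]) (auto simp: opfun_one_def intro: norm_blinfun_id_le)
  have "act_continuous opfun_one"
    by (rule act_continuousI[OF b, where F = "\<lambda>_ _. 0"]) (auto simp: act_opfun_one)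
  \<comment> \<open>The empty region will do: it is fixed by all dilations, and its algebra contains
    the identity.\<close>
  moreover have "({} :: 's spacetime set) \<in> regions" by (simp add: regions_def)
  moreover from this have "id_blinfun \<in> \<AA> {}" using algebras by (simp add: W_star_algebra_def)
  ultimately have "opfun_one \<in> scaling_local_algebra \<AA> U {}"
    by (simp add: scaling_local_algebra_iff opfun_one_def)
  then show ?thesis using b \<open>{} \<in> regions\<close>
    by (intro scaling_algebraI) (auto intro!: bexI[of _ "{}"] bexI[of _ opfun_one])
qed

end


section \<open>The scaling limit\<close>


text \<open>Reflection of space, which converts the Minkowski product into the Euclidean one of the
  Fourier analysis.\<close>

definition flip :: "'s::finite spacetime \<Rightarrow> 's spacetime" where
  "flip x = (\<chi> j. case j of None \<Rightarrow> x $ None | Some i \<Rightarrow> - x $ Some i)"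

lemma sum_option: "(\<Sum>j\<in>UNIV. f j) = f None + (\<Sum>i\<in>UNIV. f (Some i))" for f :: "'s::finite option \<Rightarrow> real"
  by (simp add: UNIV_option_conv sum.reindex)

lemma inner_flip: "flip x \<bullet> p = mink x p"
  by (simp add: inner_vec_def sum_option flip_def mink_def sum_negf)

lemma flip_flip [simp]: "flip (flip x) = x"
  by (simp add: flip_def vec_eq_iff split: option.splits)

lemma flip_zero [simp]: "flip 0 = 0" and flip_add: "flip (x + y) = flip x + flip y"
  by (auto simp: flip_def vec_eq_iff split: option.splits)

lemma norm_flip [simp]: "norm (flip x) = norm x"
  by (simp add: norm_eq_sqrt_inner inner_vec_def sum_option flip_def)

lemma mink_flip: "mink (l *\<^sub>R flip x) p = x \<bullet> (l *\<^sub>R p)"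
proof -
  have "mink (l *\<^sub>R flip x) p = l * mink (flip x) p"
    by (simp add: mink_def sum_distrib_left algebra_simps)
  then show ?thesis by (simp add: inner_flip[symmetric])
qed

lemma closed_forward_cone: "closed (forward_cone :: 's::finite spacetime set)"
proof -
  have "closed {p::'s spacetime. 0 \<le> p $ None}" "closed {p::'s spacetime. 0 \<le> mink p p}"
    unfolding mink_def by (intro closed_Collect_le continuous_intros)+
  then show ?thesis unfolding forward_cone_def by (rule closed_Collect_conj)
qed

lemma forward_cone_scale: "l > 0 \<Longrightarrow> l *\<^sub>R p \<in> forward_cone \<longleftrightarrow> p \<in> forward_cone"
proof -
  assume l: "l > 0"
  have "mink (l *\<^sub>R p) (l *\<^sub>R p) = l\<^sup>2 * mink p p"
    by (simp add: mink_def sum_distrib_left power2_eq_square algebra_simps)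
  then show ?thesis using l by (simp add: forward_cone_def zero_le_mult_iff)
qed

text \<open>The complement of the support is a union of open sets on which \<open>E\<close>
  vanishes, a priori uncountable; Lindelof reduces it to a countable one.\<close>

lemma pvm_measure_outside_support:
  fixes E :: "'p::second_countable_topology set \<Rightarrow> 'h::chilbert_space \<Rightarrow>\<^sub>L 'h"
  assumes E: "pvm E" and W: "open W" "W \<inter> pvm_support E = {}"
  shows "measure (pvm_measure E \<psi>) W = 0"
proof -
  interpret finite_measure "pvm_measure E \<psi>" by (rule finite_measure_pvm_measure[OF E])
  define F where "F = {V. open V \<and> E V = 0}"
  obtain F' where F': "F' \<subseteq> F" "countable F'" "\<Union>F' = \<Union>F"
    using Lindelof[of F] unfolding F_def by auto
  have "(\<Union>V\<in>F'. V) \<in> null_sets (pvm_measure E \<psi>)"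
  proof (rule null_sets_UN'[OF F'(2)])
    fix V assume "V \<in> F'"
    then have V: "open V" "E V = 0" using F'(1) by (auto simp: F_def)
    then show "V \<in> null_sets (pvm_measure E \<psi>)" using E by (simp add: null_sets_def emeasure_pvm_measure)
  qed
  moreover have "W \<subseteq> (\<Union>V\<in>F'. V)"
  proof
    fix p assume "p \<in> W"
    then have "p \<notin> pvm_support E" using W by auto
    then have "p \<in> \<Union>F" by (auto simp: pvm_support_def F_def)
    then show "p \<in> (\<Union>V\<in>F'. V)" using F'(3) by auto
  qed
  ultimately have "W \<in> null_sets (pvm_measure E \<psi>)"
    using W(1) E by (auto intro: null_sets_subset)
  then show ?thesis by (simp add: null_sets_def measure_def)
qed

locale scaling_limit = vacuum_net \<AA> U \<Omega>
  for \<AA> :: "'s::finite spacetime set \<Rightarrow> ('h::chilbert_space \<Rightarrow>\<^sub>L 'h) set"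
    and U :: "'s spacetime \<times> 's stmatrix \<Rightarrow> 'h \<Rightarrow>\<^sub>L 'h" and \<Omega> :: 'h +
  fixes m :: "(real \<Rightarrow> complex) \<Rightarrow> complex"
    and \<pi>\<^sub>0 :: "'h opfun \<Rightarrow> 'k::chilbert_space \<Rightarrow>\<^sub>L 'k"
    and \<Omega>\<^sub>0 :: 'k
  assumes m: "mean m" and gns: "gns_triple (scaling_algebra \<AA> U) (scaling_limit_state m \<Omega>) \<pi>\<^sub>0 \<Omega>\<^sub>0"
begin

abbreviation G where "G \<equiv> (scaling_group :: (real \<times> 's spacetime \<times> 's stmatrix) monoid)"
abbreviation \<alpha> where "\<alpha> \<equiv> scaling_act U"
abbreviation \<omega>\<^sub>0 where "\<omega>\<^sub>0 \<equiv> scaling_limit_state m \<Omega>"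

section \<open>GNS vectors and the invariance group\<close>

definition v :: "'h opfun \<Rightarrow> 'k" where "v A = blinfun_apply (\<pi>\<^sub>0 A) \<Omega>\<^sub>0"

lemma gns_facts:
  shows "A \<in> \<AA>\<^sub>s \<Longrightarrow> \<pi>\<^sub>0 A \<in> bounded_ops"
    and "A \<in> \<AA>\<^sub>s \<Longrightarrow> B \<in> \<AA>\<^sub>s \<Longrightarrow> \<pi>\<^sub>0 (\<lambda>l. A l + B l) = \<pi>\<^sub>0 A + \<pi>\<^sub>0 B"
    and "A \<in> \<AA>\<^sub>s \<Longrightarrow> \<pi>\<^sub>0 (\<lambda>l. op_scaleC c (A l)) = op_scaleC c (\<pi>\<^sub>0 A)"
    and "A \<in> \<AA>\<^sub>s \<Longrightarrow> B \<in> \<AA>\<^sub>s \<Longrightarrow> \<pi>\<^sub>0 (\<lambda>l. A l o\<^sub>L B l) = \<pi>\<^sub>0 A o\<^sub>L \<pi>\<^sub>0 B"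
    and "A \<in> \<AA>\<^sub>s \<Longrightarrow> \<pi>\<^sub>0 (\<lambda>l. cadj (A l)) = cadj (\<pi>\<^sub>0 A)"
    and "A \<in> \<AA>\<^sub>s \<Longrightarrow> \<omega>\<^sub>0 A = cinner \<Omega>\<^sub>0 (blinfun_apply (\<pi>\<^sub>0 A) \<Omega>\<^sub>0)"
  using gns by (simp_all add: gns_triple_def)

lemma dense: "closure (v ` \<AA>\<^sub>s) = UNIV"
  using gns by (simp add: gns_triple_def v_def[abs_def])

lemma v_add: "A \<in> \<AA>\<^sub>s \<Longrightarrow> B \<in> \<AA>\<^sub>s \<Longrightarrow> v (\<lambda>l. A l + B l) = v A + v B"
  by (simp add: v_def gns_facts(2) blinfun.add_left)

lemma v_scaleC: "A \<in> \<AA>\<^sub>s \<Longrightarrow> v (\<lambda>l. op_scaleC c (A l)) = c *\<^sub>C v A"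
  by (simp add: v_def gns_facts(3))

lemma v_compose: "A \<in> \<AA>\<^sub>s \<Longrightarrow> B \<in> \<AA>\<^sub>s \<Longrightarrow> v (\<lambda>l. A l o\<^sub>L B l) = blinfun_apply (\<pi>\<^sub>0 A) (v B)"
  by (simp add: v_def gns_facts(4))

lemma
  assumes A: "A \<in> \<AA>\<^sub>s" and B: "B \<in> \<AA>\<^sub>s"
  shows scaling_algebra_diff: "(\<lambda>l. A l - B l) \<in> \<AA>\<^sub>s" and v_diff: "v (\<lambda>l. A l - B l) = v A - v B"
proof -
  have eq: "(\<lambda>l. A l - B l) = (\<lambda>l. A l + op_scaleC (-1) (B l))"
    by (intro ext blinfun_eqI) (simp add: blinfun.diff_left blinfun.add_left scaleC_minus_one)
  show "(\<lambda>l. A l - B l) \<in> \<AA>\<^sub>s" unfolding eq by (intro scaling_algebra_add scaling_algebra_scaleC A B)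
  show "v (\<lambda>l. A l - B l) = v A - v B"
    unfolding eq by (simp add: v_add v_scaleC scaling_algebra_scaleC A B scaleC_minus_one)
qed

lemma complex_subspace_range: "complex_subspace (v ` \<AA>\<^sub>s)"
  unfolding complex_subspace_def
proof (intro conjI ballI allI)
  fix x y assume "x \<in> v ` \<AA>\<^sub>s" "y \<in> v ` \<AA>\<^sub>s"
  then obtain A B where A: "A \<in> \<AA>\<^sub>s" "x = v A" and B: "B \<in> \<AA>\<^sub>s" "y = v B" by blast
  show "x + y \<in> v ` \<AA>\<^sub>s"
    unfolding A(2) B(2) v_add[OF A(1) B(1), symmetric] by (intro imageI scaling_algebra_add A(1) B(1))
next
  fix c x assume "x \<in> v ` \<AA>\<^sub>s"
  then obtain A where A: "A \<in> \<AA>\<^sub>s" "x = v A" by blast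
  show "c *\<^sub>C x \<in> v ` \<AA>\<^sub>s"
    unfolding A(2) v_scaleC[OF A(1), symmetric] by (intro imageI scaling_algebra_scaleC A(1))
qed

lemma cinner_v: "A \<in> \<AA>\<^sub>s \<Longrightarrow> B \<in> \<AA>\<^sub>s \<Longrightarrow> cinner (v A) (v B) = \<omega>\<^sub>0 (\<lambda>l. cadj (A l) o\<^sub>L B l)"
  by (simp add: v_def gns_facts scaling_algebra_cadj scaling_algebra_compose cinner_cadj)

lemma cinner_v_mean:
  assumes A: "A \<in> \<AA>\<^sub>s" and B: "B \<in> \<AA>\<^sub>s"
  shows "cinner (v A) (v B) = m (\<lambda>l. cinner (blinfun_apply (A l) \<Omega>) (blinfun_apply (B l) \<Omega>))"
proof -
  have "cinner \<Omega> (blinfun_apply (cadj (A l) o\<^sub>L B l) \<Omega>) = cinner (blinfun_apply (A l) \<Omega>) (blinfun_apply (B l) \<Omega>)" for l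
    by (simp add: cinner_cadj[OF opfun_in_bounded_ops[OF scaling_algebra_bounded[OF A]]])
  then show ?thesis unfolding cinner_v[OF A B] scaling_limit_state_def by (simp only:)
qed

lemma norm_vacuum_le: "A \<in> bounded_opfuns \<Longrightarrow> norm (blinfun_apply (A l) \<Omega>) \<le> opfun_norm A"
  using norm_blinfun[of "A l" \<Omega>] norm_le_opfun_norm[of A l] by (simp add: vacuum_norm)

lemma bounded_cinner_vacuum:
  assumes A: "A \<in> bounded_opfuns" and B: "B \<in> bounded_opfuns"
  shows "bounded ((\<lambda>l. cinner (blinfun_apply (A l) \<Omega>) (blinfun_apply (B l) \<Omega>)) ` S)"
  by (auto intro!: boundedI[of _ "opfun_norm A * opfun_norm B"] order_trans[OF Cauchy_Schwarz_cinner]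
      mult_mono norm_vacuum_le A B opfun_norm_nonneg)

text \<open>The squared norm on the left is the mean of the squared norms of A_\<lambda> \<Omega>,
  so the bound comes straight from the state.\<close>

lemma norm_v_le: assumes A: "A \<in> \<AA>\<^sub>s" shows "norm (v A) \<le> opfun_norm A"
proof -
  note b = scaling_algebra_bounded[OF A]
  have le: "(norm (blinfun_apply (A l) \<Omega>))\<^sup>2 \<le> (opfun_norm A)\<^sup>2" for l
    using norm_vacuum_le[OF b, of l] by (simp add: power_mono)
  have "complex_of_real ((norm (v A))\<^sup>2) = m (\<lambda>l. complex_of_real ((norm (blinfun_apply (A l) \<Omega>))\<^sup>2))"
    using cinner_v_mean[OF A A] by (simp only: cinner_self)
  then have "(norm (v A))\<^sup>2 = Re (m (\<lambda>l. complex_of_real ((norm (blinfun_apply (A l) \<Omega>))\<^sup>2)))"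
    by (metis Re_complex_of_real)
  also have "\<dots> \<le> Re (m (\<lambda>l. complex_of_real ((opfun_norm A)\<^sup>2)))"
    by (rule mean_mono[OF m, where C = "(opfun_norm A)\<^sup>2" and D = "(opfun_norm A)\<^sup>2"]) (use le in auto)
  finally have "(norm (v A))\<^sup>2 \<le> (opfun_norm A)\<^sup>2" by (simp add: mean_const[OF m] del: of_real_power)
  then show ?thesis by (rule power2_le_imp_le) (rule opfun_norm_nonneg[OF b])
qed

definition G\<^sub>0 where "G\<^sub>0 = invariance_group \<AA> U \<omega>\<^sub>0"

lemma G\<^sub>0_carrier: "g \<in> G\<^sub>0 \<Longrightarrow> g \<in> carrier G"
  and G\<^sub>0_invariant: "g \<in> G\<^sub>0 \<Longrightarrow> A \<in> \<AA>\<^sub>s \<Longrightarrow> \<omega>\<^sub>0 (\<alpha> g A) = \<omega>\<^sub>0 A"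
  by (auto simp: G\<^sub>0_def invariance_group_def)

lemma G\<^sub>0I: "g \<in> carrier G \<Longrightarrow> (\<And>A. A \<in> \<AA>\<^sub>s \<Longrightarrow> \<omega>\<^sub>0 (\<alpha> g A) = \<omega>\<^sub>0 A) \<Longrightarrow> g \<in> G\<^sub>0"
  by (auto simp: G\<^sub>0_def invariance_group_def)

lemma act_one': "A \<in> \<AA>\<^sub>s \<Longrightarrow> \<alpha> \<one>\<^bsub>G\<^esub> A = A"
  unfolding one_scaling_group by (rule act_one[OF scaling_algebra_bounded])

lemma subgroup_G\<^sub>0: "subgroup G\<^sub>0 G"
proof -
  interpret G: group G by (rule group_scaling_group)
  show ?thesis
  proof (rule subgroup.intro)
    show "G\<^sub>0 \<subseteq> carrier G" using G\<^sub>0_carrier by blast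
    show "\<one>\<^bsub>G\<^esub> \<in> G\<^sub>0" by (rule G\<^sub>0I) (auto simp: act_one')
    show "g \<otimes>\<^bsub>G\<^esub> h \<in> G\<^sub>0" if "g \<in> G\<^sub>0" "h \<in> G\<^sub>0" for g h
      using that G\<^sub>0_carrier by (intro G\<^sub>0I) (auto simp: act_mult G\<^sub>0_invariant scaling_algebra_act)
    show "inv\<^bsub>G\<^esub> g \<in> G\<^sub>0" if g: "g \<in> G\<^sub>0" for g
    proof (rule G\<^sub>0I)
      note gc = G\<^sub>0_carrier[OF g]
      show ic: "inv\<^bsub>G\<^esub> g \<in> carrier G" using gc by simp
      fix A assume A: "A \<in> \<AA>\<^sub>s"
      have "\<omega>\<^sub>0 (\<alpha> (inv\<^bsub>G\<^esub> g) A) = \<omega>\<^sub>0 (\<alpha> g (\<alpha> (inv\<^bsub>G\<^esub> g) A))"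
        by (rule G\<^sub>0_invariant[OF g scaling_algebra_act[OF A ic], symmetric])
      also have "\<dots> = \<omega>\<^sub>0 A" using gc by (simp add: act_mult[OF gc ic, symmetric] act_one'[OF A])
      finally show "\<omega>\<^sub>0 (\<alpha> (inv\<^bsub>G\<^esub> g) A) = \<omega>\<^sub>0 A" .
    qed
  qed
qed

lemma translation_apply:
  "l > 0 \<Longrightarrow> blinfun_apply (\<alpha> (1, x, mat 1) A l) \<Omega> = blinfun_apply (U (l *\<^sub>R x, mat 1)) (blinfun_apply (A l) \<Omega>)"
  by (simp add: act_apply ad_apply U_cadj_vacuum lorentz_one)

lemma translation_carrier: "(1, x, mat 1) \<in> carrier G"
  by (simp add: carrier_scaling_group lorentz_one)

text \<open>The vacuum is translation invariant at every scale, so the function to be averaged does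
  not change. A dilation would shift \<lambda> itself, to which a mean may be sensitive.\<close>

lemma translation_in_G\<^sub>0: "(1, x, mat 1) \<in> G\<^sub>0"
proof (rule G\<^sub>0I[OF translation_carrier])
  fix A assume A: "A \<in> \<AA>\<^sub>s"
  note b = act_bounded_opfuns[OF translation_carrier scaling_algebra_bounded[OF A], of x]
  show "\<omega>\<^sub>0 (\<alpha> (1, x, mat 1) A) = \<omega>\<^sub>0 A"
    unfolding scaling_limit_state_def
  proof (rule mean_cong[OF m])
    show "bounded ((\<lambda>l. cinner \<Omega> (blinfun_apply (\<alpha> (1, x, mat 1) A l) \<Omega>)) ` {0<..1})"
      using norm_vacuum_le[OF b]
      by (auto intro!: boundedI[of _ "opfun_norm (\<alpha> (1, x, mat 1) A)"] order_trans[OF Cauchy_Schwarz_cinner] simp: vacuum_norm)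
    fix l :: real assume "l \<in> {0<..1}"
    then have "l > 0" by simp
    have "cinner \<Omega> (blinfun_apply (U (l *\<^sub>R x, mat 1)) \<phi>) = cinner (blinfun_apply (U (l *\<^sub>R x, mat 1)) \<Omega>) (blinfun_apply (U (l *\<^sub>R x, mat 1)) \<phi>)" for \<phi>
      by (simp add: U_vacuum lorentz_one)
    then show "cinner \<Omega> (blinfun_apply (\<alpha> (1, x, mat 1) A l) \<Omega>) = cinner \<Omega> (blinfun_apply (A l) \<Omega>)"
      by (simp add: translation_apply \<open>l > 0\<close> unitary_op_cinner U_unitary lorentz_one)
  qed
qed

section \<open>The unitary implementation of the invariance group\<close>

lemma v_act_isometry:
  assumes g: "g \<in> G\<^sub>0" and A: "A \<in> \<AA>\<^sub>s" and B: "B \<in> \<AA>\<^sub>s"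
  shows "cinner (v (\<alpha> g A)) (v (\<alpha> g B)) = cinner (v A) (v B)"
proof -
  note gc = G\<^sub>0_carrier[OF g]
  have "cinner (v (\<alpha> g A)) (v (\<alpha> g B)) = \<omega>\<^sub>0 (\<alpha> g (\<lambda>l. cadj (A l) o\<^sub>L B l))"
    by (simp add: cinner_v scaling_algebra_act A B gc act_compose act_cadj scaling_algebra_bounded)
  also have "\<dots> = cinner (v A) (v B)"
    by (simp add: G\<^sub>0_invariant[OF g] scaling_algebra_compose scaling_algebra_cadj A B cinner_v)
  finally show ?thesis .
qed

lemma v_act_norm: "g \<in> G\<^sub>0 \<Longrightarrow> A \<in> \<AA>\<^sub>s \<Longrightarrow> norm (v (\<alpha> g A)) = norm (v A)"
  using v_act_isometry[of g A A] by (simp add: cinner_self power2_eq_iff_nonneg del: of_real_power)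

text \<open>\<open>v\<close> need not be injective; this makes the prescription v(A) \<mapsto>
  v(\<alpha>_g A) independent of the representative.\<close>

lemma v_act_cong:
  assumes g: "g \<in> G\<^sub>0" and A: "A \<in> \<AA>\<^sub>s" and B: "B \<in> \<AA>\<^sub>s" and eq: "v A = v B"
  shows "v (\<alpha> g A) = v (\<alpha> g B)"
proof -
  note gc = G\<^sub>0_carrier[OF g]
  have "norm (v (\<alpha> g A) - v (\<alpha> g B)) = norm (v (\<alpha> g (\<lambda>l. A l - B l)))"
    by (simp add: act_diff[OF gc] v_diff scaling_algebra_act A B gc)
  also have "\<dots> = 0" by (simp add: v_act_norm[OF g scaling_algebra_diff[OF A B]] v_diff[OF A B] eq)
  finally show ?thesis by simp
qed

lemma implementation_exists:
  assumes g: "g \<in> G\<^sub>0"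
  shows "\<exists>W\<in>bounded_ops. \<forall>A\<in>\<AA>\<^sub>s. blinfun_apply W (v A) = v (\<alpha> g A)"
proof -
  note gc = G\<^sub>0_carrier[OF g]
  define r where "r x = (SOME A. A \<in> \<AA>\<^sub>s \<and> v A = x)" for x
  define f where "f x = v (\<alpha> g (r x))" for x
  have r: "r (v A) \<in> \<AA>\<^sub>s" "v (r (v A)) = v A" if "A \<in> \<AA>\<^sub>s" for A
    using someI[of "\<lambda>B. B \<in> \<AA>\<^sub>s \<and> v B = v A" A] that by (auto simp: r_def)
  have f: "f (v A) = v (\<alpha> g A)" if A: "A \<in> \<AA>\<^sub>s" for A
    unfolding f_def by (rule v_act_cong[OF g r(1)[OF A] A r(2)[OF A]])
  have "\<exists>W\<in>bounded_ops. \<forall>x\<in>v ` \<AA>\<^sub>s. blinfun_apply W x = f x"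
  proof (rule operator_extension[OF complex_subspace_range dense, where C = 1])
    fix x y assume "x \<in> v ` \<AA>\<^sub>s" "y \<in> v ` \<AA>\<^sub>s"
    then obtain A B where A: "A \<in> \<AA>\<^sub>s" "x = v A" and B: "B \<in> \<AA>\<^sub>s" "y = v B" by blast
    have "f (x + y) = v (\<alpha> g (\<lambda>l. A l + B l))"
      unfolding A(2) B(2) v_add[OF A(1) B(1), symmetric] by (rule f[OF scaling_algebra_add[OF A(1) B(1)]])
    then show "f (x + y) = f x + f y"
      by (simp add: act_add[OF gc] v_add scaling_algebra_act gc A B f)
  next
    fix x c assume "x \<in> v ` \<AA>\<^sub>s"
    then obtain A where A: "A \<in> \<AA>\<^sub>s" "x = v A" by blast
    have "f (c *\<^sub>C x) = v (\<alpha> g (\<lambda>l. op_scaleC c (A l)))"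
      unfolding A(2) v_scaleC[OF A(1), symmetric] by (rule f[OF scaling_algebra_scaleC[OF A(1)]])
    then show "f (c *\<^sub>C x) = c *\<^sub>C f x"
      by (simp add: act_scaleC[OF gc] v_scaleC scaling_algebra_act gc A f)
  next
    fix x assume "x \<in> v ` \<AA>\<^sub>s"
    then show "norm (f x) \<le> 1 * norm x" by (auto simp: f v_act_norm[OF g])
  qed
  then show ?thesis using f by auto
qed

definition U\<^sub>0 where
  "U\<^sub>0 g = (SOME W. W \<in> bounded_ops \<and> (\<forall>A\<in>\<AA>\<^sub>s. blinfun_apply W (v A) = v (\<alpha> g A)))"

lemma
  assumes "g \<in> G\<^sub>0"
  shows U\<^sub>0_bounded_ops: "U\<^sub>0 g \<in> bounded_ops"
    and U\<^sub>0_v: "A \<in> \<AA>\<^sub>s \<Longrightarrow> blinfun_apply (U\<^sub>0 g) (v A) = v (\<alpha> g A)"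
proof -
  have "U\<^sub>0 g \<in> bounded_ops \<and> (\<forall>A\<in>\<AA>\<^sub>s. blinfun_apply (U\<^sub>0 g) (v A) = v (\<alpha> g A))"
    unfolding U\<^sub>0_def by (rule someI_ex) (use implementation_exists[OF assms] in blast)
  then show "U\<^sub>0 g \<in> bounded_ops" "A \<in> \<AA>\<^sub>s \<Longrightarrow> blinfun_apply (U\<^sub>0 g) (v A) = v (\<alpha> g A)" by auto
qed

lemma U\<^sub>0_one: "U\<^sub>0 \<one>\<^bsub>G\<^esub> = id_blinfun"
  by (rule blinfun_eq_on_dense[OF dense])
     (auto simp: U\<^sub>0_v[OF subgroup.one_closed[OF subgroup_G\<^sub>0]] act_one')

lemma U\<^sub>0_mult: assumes g: "g \<in> G\<^sub>0" and h: "h \<in> G\<^sub>0" shows "U\<^sub>0 (g \<otimes>\<^bsub>G\<^esub> h) = U\<^sub>0 g o\<^sub>L U\<^sub>0 h"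
  by (rule blinfun_eq_on_dense[OF dense])
     (auto simp: U\<^sub>0_v g h subgroup.m_closed[OF subgroup_G\<^sub>0] act_mult G\<^sub>0_carrier scaling_algebra_act)

lemma U\<^sub>0_isometry:
  assumes g: "g \<in> G\<^sub>0"
  shows "cinner (blinfun_apply (U\<^sub>0 g) x) (blinfun_apply (U\<^sub>0 g) y) = cinner x y"
proof (rule continuous_eq_on_dense[OF dense, where x = y])
  fix y assume "y \<in> v ` \<AA>\<^sub>s"
  then obtain B where B: "B \<in> \<AA>\<^sub>s" "y = v B" by blast
  show "cinner (blinfun_apply (U\<^sub>0 g) x) (blinfun_apply (U\<^sub>0 g) y) = cinner x y"
    by (rule continuous_eq_on_dense[OF dense, where x = x])
       (auto intro!: continuous_intros simp: B U\<^sub>0_v g v_act_isometry)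
qed (auto intro!: continuous_intros)

lemma
  assumes g: "g \<in> G\<^sub>0"
  shows U\<^sub>0_unitary: "unitary_op (U\<^sub>0 g)" and U\<^sub>0_cadj: "cadj (U\<^sub>0 g) = U\<^sub>0 (inv\<^bsub>G\<^esub> g)"
proof -
  interpret G: group G by (rule group_scaling_group)
  have i: "inv\<^bsub>G\<^esub> g \<in> G\<^sub>0" by (rule subgroup.m_inv_closed[OF subgroup_G\<^sub>0 g])
  have "U\<^sub>0 g o\<^sub>L U\<^sub>0 (inv\<^bsub>G\<^esub> g) = id_blinfun" "U\<^sub>0 (inv\<^bsub>G\<^esub> g) o\<^sub>L U\<^sub>0 g = id_blinfun"
    using G\<^sub>0_carrier[OF g] by (simp_all add: U\<^sub>0_mult[symmetric] g i U\<^sub>0_one)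
  from unitary_opI[OF U\<^sub>0_bounded_ops[OF g] U\<^sub>0_bounded_ops[OF i] this U\<^sub>0_isometry[OF g]]
  show "unitary_op (U\<^sub>0 g)" "cadj (U\<^sub>0 g) = U\<^sub>0 (inv\<^bsub>G\<^esub> g)" .
qed

text \<open>On a vector \<open>v B\<close> this is the computation \<alpha>_g(A \<alpha>_h(B)) =
  \<alpha>_g(A) B, where h is the inverse of g.\<close>

lemma U\<^sub>0_covariant:
  assumes g: "g \<in> G\<^sub>0" and A: "A \<in> \<AA>\<^sub>s"
  shows "ad (U\<^sub>0 g) (\<pi>\<^sub>0 A) = \<pi>\<^sub>0 (\<alpha> g A)"
proof (rule blinfun_eq_on_dense[OF dense])
  interpret G: group G by (rule group_scaling_group)
  note gc = G\<^sub>0_carrier[OF g]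
  have i: "inv\<^bsub>G\<^esub> g \<in> G\<^sub>0" by (rule subgroup.m_inv_closed[OF subgroup_G\<^sub>0 g])
  note ic = G\<^sub>0_carrier[OF i]
  fix x assume "x \<in> v ` \<AA>\<^sub>s"
  then obtain B where B: "B \<in> \<AA>\<^sub>s" "x = v B" by blast
  have B': "\<alpha> (inv\<^bsub>G\<^esub> g) B \<in> \<AA>\<^sub>s" by (rule scaling_algebra_act[OF B(1) ic])
  have "blinfun_apply (ad (U\<^sub>0 g) (\<pi>\<^sub>0 A)) x = v (\<alpha> g (\<lambda>l. A l o\<^sub>L \<alpha> (inv\<^bsub>G\<^esub> g) B l))"
    by (simp add: ad_apply U\<^sub>0_cadj[OF g] B U\<^sub>0_v[OF i] v_compose[OF A B', symmetric]
        U\<^sub>0_v[OF g scaling_algebra_compose[OF A B']])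
  also have "\<dots> = v (\<lambda>l. \<alpha> g A l o\<^sub>L B l)"
    using gc by (simp add: act_compose[OF gc] act_mult[OF gc ic, symmetric] act_one'[OF B(1)])
  also have "\<dots> = blinfun_apply (\<pi>\<^sub>0 (\<alpha> g A)) x"
    by (simp add: v_compose scaling_algebra_act A B gc)
  finally show "blinfun_apply (ad (U\<^sub>0 g) (\<pi>\<^sub>0 A)) x = blinfun_apply (\<pi>\<^sub>0 (\<alpha> g A)) x" .
qed

text \<open>Cyclicity makes \<open>\<pi>\<^sub>0\<close> unital: the image of the unit fixes every
  vector \<open>v B\<close>.\<close>

lemma vacuum_eq: "v opfun_one = \<Omega>\<^sub>0"
proof -
  have "\<pi>\<^sub>0 opfun_one = id_blinfun"
  proof (rule blinfun_eq_on_dense[OF dense])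
    fix x assume "x \<in> v ` \<AA>\<^sub>s"
    then obtain B where B: "B \<in> \<AA>\<^sub>s" "x = v B" by blast
    have "(\<lambda>l. opfun_one l o\<^sub>L B l) = B"
      by (intro ext blinfun_eqI) (simp add: opfun_one_def opfun_nonpos[OF scaling_algebra_bounded[OF B(1)]])
    then show "blinfun_apply (\<pi>\<^sub>0 opfun_one) x = blinfun_apply id_blinfun x"
      using v_compose[OF opfun_one_in_scaling_algebra B(1)] B(2) by simp
  qed
  then show ?thesis by (simp add: v_def)
qed

lemma U\<^sub>0_vacuum: assumes g: "g \<in> G\<^sub>0" shows "blinfun_apply (U\<^sub>0 g) \<Omega>\<^sub>0 = \<Omega>\<^sub>0"
  using U\<^sub>0_v[OF g opfun_one_in_scaling_algebra] by (simp add: act_opfun_one G\<^sub>0_carrier g vacuum_eq)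

lemma norm_v_act_diff:
  assumes A: "A \<in> \<AA>\<^sub>s" and g: "g \<in> carrier G" "h \<in> carrier G"
  shows "norm (v (\<alpha> h A) - v (\<alpha> g A)) \<le> act_dist A g h"
  using norm_v_le[OF scaling_algebra_diff[OF scaling_algebra_act[OF A g(2)] scaling_algebra_act[OF A g(1)]]]
  by (simp add: v_diff scaling_algebra_act A g act_dist_def)

lemma U\<^sub>0_continuous: "continuous_on G\<^sub>0 (\<lambda>g. blinfun_apply (U\<^sub>0 g) \<psi>)"
  unfolding continuous_on_def
proof (intro ballI tendstoI)
  fix g and e :: real assume g: "g \<in> G\<^sub>0" and e: "e > 0"
  have "\<psi> \<in> closure (v ` \<AA>\<^sub>s)" using dense by simp
  then obtain A where A: "A \<in> \<AA>\<^sub>s" "dist (v A) \<psi> < e / 3"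
    using e closure_approachable[of \<psi> "v ` \<AA>\<^sub>s"] by (metis (no_types, lifting) divide_pos_pos imageE zero_less_numeral)
  have "(act_dist A g \<longlongrightarrow> 0) (at g within G\<^sub>0)"
    by (rule tendsto_within_subset[OF act_continuous_lim[OF scaling_algebra_continuous[OF A(1)] G\<^sub>0_carrier[OF g]]])
       (use G\<^sub>0_carrier in blast)
  then have "\<forall>\<^sub>F h in at g within G\<^sub>0. act_dist A g h < e / 3" using e by (intro order_tendstoD(2)) auto
  moreover have "\<forall>\<^sub>F h in at g within G\<^sub>0. h \<in> G\<^sub>0" by (simp add: eventually_at_filter)
  ultimately show "\<forall>\<^sub>F h in at g within G\<^sub>0. dist (blinfun_apply (U\<^sub>0 h) \<psi>) (blinfun_apply (U\<^sub>0 g) \<psi>) < e"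
  proof eventually_elim
    case (elim h)
    have d: "norm (blinfun_apply (U\<^sub>0 k) \<psi> - v (\<alpha> k A)) < e / 3" if k: "k \<in> G\<^sub>0" for k
    proof -
      have "norm (blinfun_apply (U\<^sub>0 k) \<psi> - v (\<alpha> k A)) = norm (blinfun_apply (U\<^sub>0 k) (\<psi> - v A))"
        by (simp add: U\<^sub>0_v[OF k A(1)] blinfun.diff_right)
      then show ?thesis using A(2) by (simp add: unitary_op_norm U\<^sub>0_unitary k dist_norm norm_minus_commute)
    qed
    have "blinfun_apply (U\<^sub>0 h) \<psi> - blinfun_apply (U\<^sub>0 g) \<psi> = (blinfun_apply (U\<^sub>0 h) \<psi> - v (\<alpha> h A)) +
        (v (\<alpha> h A) - v (\<alpha> g A)) + (v (\<alpha> g A) - blinfun_apply (U\<^sub>0 g) \<psi>)" by simp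
    also have "norm \<dots> < e / 3 + e / 3 + e / 3"
    proof (intro norm_add_less)
      show "norm (v (\<alpha> h A) - v (\<alpha> g A)) < e / 3"
        using norm_v_act_diff[OF A(1) G\<^sub>0_carrier[OF g] G\<^sub>0_carrier[OF elim(2)]] elim(1) by simp
      show "norm (v (\<alpha> g A) - blinfun_apply (U\<^sub>0 g) \<psi>) < e / 3" using d[OF g] by (simp add: norm_minus_commute)
    qed (rule d[OF elim(2)])
    finally show ?case by (simp add: dist_norm)
  qed
qed

section \<open>The spectrum condition in the scaling limit\<close>

lemma spectral_data_exists:
  assumes A: "A \<in> \<AA>\<^sub>s"
  shows "\<exists>\<mu>. finite_measure \<mu> \<and> sets \<mu> = sets borel \<and>
    (\<forall>x. cinner (v A) (blinfun_apply (U\<^sub>0 (1, flip x, mat 1)) (v A)) = (\<integral>p. cis (x \<bullet> p) \<partial>\<mu>)) \<and>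
    measure \<mu> (- forward_cone) = 0"
proof -
  note b = scaling_algebra_bounded[OF A]
  obtain E where E: "pvm E" "\<And>x \<psi>. cinner \<psi> (blinfun_apply (U (x, mat 1)) \<psi>) = (\<integral>p. cis (mink x p) \<partial>pvm_measure E \<psi>)"
    and supp: "pvm_support E \<subseteq> forward_cone"
    using spectrum unfolding spectrum_condition_def joint_spectral_measure_def by blast
  define a where "a l = blinfun_apply (A l) \<Omega>" for l
  \<comment> \<open>At scale \<open>l\<close> the translation by x acts as the original translation
    by \<open>l\<close> times x, so the momenta of \<open>a l\<close> are dilated by
    \<open>l\<close>.\<close>
  define N where "N l = distr (pvm_measure E (a l)) borel (\<lambda>p. l *\<^sub>R p)" for l
  have scm: "(\<lambda>p. l *\<^sub>R p) \<in> measurable (pvm_measure E (a l)) borel" for l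
    by (simp add: measurable_cong_sets[OF sets_pvm_measure[OF E(1)] refl])
  have fN: "finite_measure (N l)" for l
    unfolding N_def by (rule finite_measure.finite_measure_distr[OF finite_measure_pvm_measure[OF E(1)] scm])
  have sN: "sets (N l) = sets borel" for l by (simp add: N_def)
  have mN: "measure (N l) S = measure (pvm_measure E (a l)) {p. l *\<^sub>R p \<in> S}" if "S \<in> sets borel" for l S
    unfolding N_def using measure_distr[OF scm that] E(1) by (simp add: vimage_def)
  have iN: "(\<integral>p. cis (x \<bullet> p) \<partial>N l) = cinner (a l) (blinfun_apply (U (l *\<^sub>R flip x, mat 1)) (a l))" for x l
  proof -
    have "(\<lambda>p. cis (x \<bullet> p)) \<in> borel_measurable borel"
      by (intro borel_measurable_continuous_onI continuous_intros)
    then have "(\<integral>p. cis (x \<bullet> p) \<partial>N l) = (\<integral>p. cis (x \<bullet> (l *\<^sub>R p)) \<partial>pvm_measure E (a l))"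
      unfolding N_def by (rule integral_distr[OF scm])
    then show ?thesis by (simp add: E(2) mink_flip)
  qed
  have aa: "cinner (a l) (blinfun_apply (U (l *\<^sub>R y, mat 1)) (a l)) =
      cinner (blinfun_apply (A l) \<Omega>) (blinfun_apply (\<alpha> (1, y, mat 1) A l) \<Omega>)" if "l > 0" for l y
    using that by (simp add: a_def translation_apply)
  have na: "norm (a l) \<le> opfun_norm A" for l unfolding a_def by (rule norm_vacuum_le[OF b])
  have tot: "measure (N l) UNIV \<le> (opfun_norm A)\<^sup>2" for l
    using mN[of UNIV l] pvm_measure_total[OF E(1), of "a l"] na[of l] by (simp add: power_mono)
  \<comment> \<open>The integral is minus the real part of the inner product of \<open>a l\<close>
    with the increment of the orbit of \<open>A\<close> applied to \<Omega>. Cauchy-Schwarz bounds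
    it by the norm of \<open>A\<close> times \<open>act_dist\<close>, and this bound does not depend
    on the scale.\<close>
  have tight: "\<exists>d>0. \<forall>x. norm x \<le> d \<longrightarrow> (\<forall>l\<in>{0<..1}. (\<integral>p. 1 - cos (x \<bullet> p) \<partial>N l) \<le> e)" if e: "e > 0" for e
  proof -
    define K where "K = opfun_norm A + 1"
    have K: "K > 0" "opfun_norm A \<le> K" using opfun_norm_nonneg[OF b] by (auto simp: K_def)
    have one: "(1, 0, mat 1) \<in> carrier G" by (rule translation_carrier)
    have "(act_dist A (1, 0, mat 1) \<longlongrightarrow> 0) (at (1, 0, mat 1) within carrier G)"
      by (rule act_continuous_lim[OF scaling_algebra_continuous[OF A] one])
    then have "\<forall>\<^sub>F h in at (1, 0, mat 1) within carrier G. act_dist A (1, 0, mat 1) h < e / K"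
      using e K by (intro order_tendstoD(2)) auto
    then obtain d where d: "d > 0" "\<And>h. h \<in> carrier G \<Longrightarrow> h \<noteq> (1, 0, mat 1) \<Longrightarrow> dist h (1, 0, mat 1) < d \<Longrightarrow>
        act_dist A (1, 0, mat 1) h < e / K"
      unfolding eventually_at by blast
    \<comment> \<open>The limit at the identity says nothing about the identity itself, where the
      distance is zero; hence the case distinction.\<close>
    have small: "act_dist A (1, 0, mat 1) (1, flip x, mat 1) \<le> e / K" if "norm x < d" for x
    proof (cases "flip x = 0")
      case True
      then show ?thesis using e K by (simp add: act_dist_def opfun_norm_def)
    next
      case False
      have "dist (1 :: real, flip x, mat 1 :: 's stmatrix) (1, 0, mat 1) = norm x"
        by (simp add: dist_Pair_Pair dist_norm)
      then show ?thesis using d(2)[OF translation_carrier[of "flip x"]] False that by (simp add: less_imp_le)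
    qed
    have "(\<integral>p. 1 - cos (x \<bullet> p) \<partial>N l) \<le> e" if x: "norm x < d" and l: "l \<in> {0<..1}" for x l
    proof -
      have l0: "l > 0" using l by simp
      interpret finite_measure "N l" by (rule fN)
      have sp: "space (N l) = UNIV" by (simp add: N_def)
      have "(\<integral>p. 1 - cos (x \<bullet> p) \<partial>N l) = measure (N l) UNIV - (\<integral>p. cos (x \<bullet> p) \<partial>N l)"
        using bounded_borel_integrable[OF bounded_borel_cos fN sN] by (simp add: sp)
      also have "\<dots> = Re (cinner (a l) (a l)) - Re (\<integral>p. cis (x \<bullet> p) \<partial>N l)"
        using mN[of UNIV l] pvm_measure_total[OF E(1), of "a l"] by (simp add: integral_cis(1)[OF fN sN])
      also have "\<dots> = - Re (cinner (a l) (blinfun_apply (\<alpha> (1, flip x, mat 1) A l - \<alpha> (1, 0, mat 1) A l) \<Omega>))"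
        unfolding iN aa[OF l0] by (simp add: act_one[OF b] blinfun.diff_left cinner_diff_right a_def)
      also have "\<dots> \<le> norm (a l) * norm (blinfun_apply (\<alpha> (1, flip x, mat 1) A l - \<alpha> (1, 0, mat 1) A l) \<Omega>)"
        by (rule order_trans[OF abs_le_D2[OF abs_Re_le_cmod] Cauchy_Schwarz_cinner])
      also have "\<dots> \<le> K * (e / K)"
      proof (rule mult_mono)
        show "norm (a l) \<le> K" using na[of l] K by simp
        have "norm (blinfun_apply (\<alpha> (1, flip x, mat 1) A l - \<alpha> (1, 0, mat 1) A l) \<Omega>) \<le>
            norm (\<alpha> (1, flip x, mat 1) A l - \<alpha> (1, 0, mat 1) A l)"
          using norm_blinfun[of "\<alpha> (1, flip x, mat 1) A l - \<alpha> (1, 0, mat 1) A l" \<Omega>] by (simp add: vacuum_norm)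
        also have "\<dots> \<le> act_dist A (1, 0, mat 1) (1, flip x, mat 1)"
          by (rule act_dist_upper(1)[OF b one translation_carrier])
        also have "\<dots> \<le> e / K" by (rule small[OF x])
        finally show "norm (blinfun_apply (\<alpha> (1, flip x, mat 1) A l - \<alpha> (1, 0, mat 1) A l) \<Omega>) \<le> e / K" .
      qed (use K in auto)
      also have "\<dots> = e" using K by simp
      finally show ?thesis .
    qed
    \<comment> \<open>Half of \<open>d\<close>, since the claim allows equality where the estimate
      has a strict inequality.\<close>
    then show ?thesis using d(1) by (intro exI[of _ "d / 2"]) auto
  qed
  obtain \<mu> where \<mu>: "finite_measure \<mu>" "sets \<mu> = sets borel"
      "\<And>x. (\<integral>p. cis (x \<bullet> p) \<partial>\<mu>) = m (\<lambda>l. \<integral>p. cis (x \<bullet> p) \<partial>N l)"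
      "\<And>W. open W \<Longrightarrow> (\<forall>l\<in>{0<..1}. measure (N l) W = 0) \<Longrightarrow> measure \<mu> W = 0"
    using mean_bochner[OF m fN sN tot tight] by blast
  have "cinner (v A) (blinfun_apply (U\<^sub>0 (1, flip x, mat 1)) (v A)) = (\<integral>p. cis (x \<bullet> p) \<partial>\<mu>)" for x
  proof -
    note tA = scaling_algebra_act[OF A translation_carrier, of "flip x"]
    have "cinner (v A) (blinfun_apply (U\<^sub>0 (1, flip x, mat 1)) (v A)) =
        m (\<lambda>l. cinner (blinfun_apply (A l) \<Omega>) (blinfun_apply (\<alpha> (1, flip x, mat 1) A l) \<Omega>))"
      unfolding U\<^sub>0_v[OF translation_in_G\<^sub>0 A] by (rule cinner_v_mean[OF A tA])
    also have "\<dots> = m (\<lambda>l. \<integral>p. cis (x \<bullet> p) \<partial>N l)"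
      by (rule mean_cong[OF m bounded_cinner_vacuum[OF b scaling_algebra_bounded[OF tA]]]) (simp add: iN aa)
    finally show ?thesis by (simp add: \<mu>(3))
  qed
  moreover have "measure \<mu> (- forward_cone) = 0"
  proof (rule \<mu>(4))
    show W: "open (- forward_cone :: 's spacetime set)" by (rule open_Compl[OF closed_forward_cone])
    have "measure (N l) (- forward_cone) = 0" if "l \<in> {0<..1}" for l
    proof -
      \<comment> \<open>The cone is invariant under dilations, so the rescaled measures keep the
        support property of \<open>E\<close>.\<close>
      have "{p. l *\<^sub>R p \<in> - forward_cone} = (- forward_cone :: 's spacetime set)"
        using that by (auto simp: forward_cone_scale)
      moreover have "measure (pvm_measure E (a l)) (- forward_cone) = 0"
        by (rule pvm_measure_outside_support[OF E(1) W]) (use supp in auto)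
      ultimately show ?thesis using mN[OF borel_open[OF W], of l] by simp
    qed
    then show "\<forall>l\<in>{0<..1}. measure (N l) (- forward_cone) = 0" by blast
  qed
  ultimately show ?thesis using \<mu>(1,2) by blast
qed

lemma U\<^sub>0_spectrum: "spectrum_condition (\<lambda>x. U\<^sub>0 (1, x, mat 1))"
proof -
  \<comment> \<open>With \<open>flip\<close> inserted the characters of \<open>V\<close> are
    Euclidean; additivity of \<open>flip\<close> keeps \<open>V\<close> a representation of
    translations.\<close>
  define V where "V x = U\<^sub>0 (1, flip x, mat 1)" for x
  define D where "D = v ` \<AA>\<^sub>s"
  have "\<forall>\<psi>\<in>D. \<exists>\<mu>. finite_measure \<mu> \<and> sets \<mu> = sets borel \<and>
    (\<forall>x. cinner \<psi> (blinfun_apply (V x) \<psi>) = (\<integral>p. cis (x \<bullet> p) \<partial>\<mu>)) \<and> measure \<mu> (- forward_cone) = 0"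
    unfolding D_def V_def using spectral_data_exists by blast
  from bchoice[OF this] obtain \<mu> where \<mu>: "\<forall>\<psi>\<in>D. finite_measure (\<mu> \<psi>) \<and> sets (\<mu> \<psi>) = sets borel \<and>
    (\<forall>x. cinner \<psi> (blinfun_apply (V x) \<psi>) = (\<integral>p. cis (x \<bullet> p) \<partial>\<mu> \<psi>)) \<and> measure (\<mu> \<psi>) (- forward_cone) = 0" by blast
  interpret dense_spectral_data V D \<mu>
  proof (intro dense_spectral_data.intro translation_rep.intro dense_spectral_data_axioms.intro)
    show "V 0 = id_blinfun" using U\<^sub>0_one by (simp add: V_def one_scaling_group)
    show "V (x + y) = V x o\<^sub>L V y" for x y
      using U\<^sub>0_mult[OF translation_in_G\<^sub>0[of "flip x"] translation_in_G\<^sub>0[of "flip y"]]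
      by (simp add: V_def mult_scaling_group flip_add)
    show "unitary_op (V x)" for x unfolding V_def by (rule U\<^sub>0_unitary[OF translation_in_G\<^sub>0])
    show "complex_subspace D" "closure D = UNIV" unfolding D_def by (rule complex_subspace_range, rule dense)
  qed (use \<mu> in blast)+
  obtain E where E: "pvm E" "\<And>x \<psi>. cinner \<psi> (blinfun_apply (V x) \<psi>) = (\<integral>p. cis (x \<bullet> p) \<partial>pvm_measure E \<psi>)"
    "\<And>S. S \<in> sets borel \<Longrightarrow> (\<forall>\<psi>\<in>D. measure (\<mu> \<psi>) S = 0) \<Longrightarrow> E S = 0"
    using spectral_measure_exists by blast
  have W: "open (- forward_cone :: 's spacetime set)" by (rule open_Compl[OF closed_forward_cone])
  \<comment> \<open>The complement of the cone is null for every vector of \<open>D\<close>. Being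
    an open set on which \<open>E\<close> vanishes, it misses the support.\<close>
  have "E (- forward_cone) = 0" using \<mu> by (intro E(3) borel_open[OF W]) blast
  then have "pvm_support E \<subseteq> forward_cone" using W by (auto simp: pvm_support_def)
  moreover have "cinner \<psi> (blinfun_apply (U\<^sub>0 (1, x, mat 1)) \<psi>) = (\<integral>p. cis (mink x p) \<partial>pvm_measure E \<psi>)" for x \<psi>
    using E(2)[of \<psi> "flip x"] by (simp add: V_def inner_flip)
  ultimately show ?thesis
    using E(1) unfolding spectrum_condition_def joint_spectral_measure_def by blast
qed

lemma U\<^sub>0_rep: "unitary_rep (G\<lparr>carrier := G\<^sub>0\<rparr>) U\<^sub>0"
  unfolding unitary_rep_def by (simp add: U\<^sub>0_unitary U\<^sub>0_one U\<^sub>0_mult U\<^sub>0_continuous)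

end

text \<open>The first two conjuncts give meaning to the rest: they ensure that
  \<open>unitary_rep\<close> is taken over a group and that the translations to which the spectrum
  condition refers belong to it.\<close>

theorem theorem2p5:
  fixes \<AA> :: "'s::finite spacetime set \<Rightarrow> ('h::chilbert_space \<Rightarrow>\<^sub>L 'h) set"
    and U :: "'s spacetime \<times> 's stmatrix \<Rightarrow> 'h \<Rightarrow>\<^sub>L 'h"
    and \<Omega> :: 'h
    and m :: "(real \<Rightarrow> complex) \<Rightarrow> complex"
    and \<pi>\<^sub>0 :: "'h opfun \<Rightarrow> 'k::chilbert_space \<Rightarrow>\<^sub>L 'k"
    and \<Omega>\<^sub>0 :: 'k
    and \<omega>\<^sub>0 :: "'h opfun \<Rightarrow> complex"
    and G\<^sub>0 :: "(real \<times> 's spacetime \<times> 's stmatrix) set"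
  assumes "vacuum_net \<AA> U \<Omega>"
    and "mean m"
    and "\<omega>\<^sub>0 = scaling_limit_state m \<Omega>"
    and "gns_triple (scaling_algebra \<AA> U) \<omega>\<^sub>0 \<pi>\<^sub>0 \<Omega>\<^sub>0"
    and "G\<^sub>0 = invariance_group \<AA> U \<omega>\<^sub>0"
  shows "subgroup G\<^sub>0 scaling_group \<and> (\<forall>x. (1, x, mat 1) \<in> G\<^sub>0) \<and>
    (\<exists>U\<^sub>0. unitary_rep (scaling_group\<lparr>carrier := G\<^sub>0\<rparr>) U\<^sub>0 \<and>
       (\<forall>g\<in>G\<^sub>0. \<forall>A\<in>scaling_algebra \<AA> U. ad (U\<^sub>0 g) (\<pi>\<^sub>0 A) = \<pi>\<^sub>0 (scaling_act U g A)) \<and>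
       (\<forall>g\<in>G\<^sub>0. blinfun_apply (U\<^sub>0 g) \<Omega>\<^sub>0 = \<Omega>\<^sub>0) \<and>
       spectrum_condition (\<lambda>x. U\<^sub>0 (1, x, mat 1)))"
proof -
  interpret L: scaling_limit \<AA> U \<Omega> m \<pi>\<^sub>0 \<Omega>\<^sub>0
    using assms by (intro scaling_limit.intro scaling_limit_axioms.intro) simp_all
  have "G\<^sub>0 = L.G\<^sub>0" using assms by (simp add: L.G\<^sub>0_def)
  then show ?thesis
    using L.subgroup_G\<^sub>0 L.translation_in_G\<^sub>0 L.U\<^sub>0_rep L.U\<^sub>0_covariant L.U\<^sub>0_vacuum L.U\<^sub>0_spectrum
    by (intro conjI exI[of _ L.U\<^sub>0]) auto
qed

end
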